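(* Let $f$ be an exact symplectic $C^1$ twist map of $\mathbb{A}$ and let $\mu$ be an irrational Mather measure of $f$. The two following assertions are equivalent: (i) for $\mu$-almost every $x$, $\operatorname{supp}\mu$ is not $C^1$-regular at $x$; (ii) the Lyapunov exponents of $\mu$ (for $f$) are non-zero.
   Context: $\mathbb{T}=\mathbb{R}/\mathbb{Z}$, $\mathbb{A}=\mathbb{T}\times\mathbb{R}$ with coordinates $(\theta,r)$, symplectic form $d\theta\wedge dr$ and its usual Riemannian metric. $\pi:\mathbb{A}\to\mathbb{T}$ is the first projection, $\tilde\pi:\mathbb{R}^2\to\mathbb{R}$ its lift, $p:\mathbb{R}^2\to\mathbb{A}$ the universal covering. A $C^1$ diffeomorphism $f:\mathbb{A}\to\mathbb{A}$ isotopic to the identity is a positive twist map if, for any lift $\tilde f:\mathbb{R}^2\to\mathbb{R}^2$ and every $\tilde\theta\in\mathbb{R}$, the maps $r\mapsto\tilde\pi\circ\tilde f(\tilde\theta,r)$ and $r\mapsto\tilde\pi\circ\tilde f^{-1}(\tilde\theta,r)$ are both diffeomorphisms (of $\mathbb{R}$), the first increasing and the second decreasing. If $f$ is a positive twist map, $f^{-1}$ is a negative twist map. A twist map may be positive or negative. $f$ is exact symplectic if the 1-form $f^*(r\,d\theta)-r\,d\theta$ is exact. A non-empty set $M\subset\mathbb{A}$ is $f$-ordered if it is compact, $f$-invariant, and for all $z,z'\in p^{-1}(M)$: $\tilde\pi(z)<\tilde\pi(z')\Leftrightarrow\tilde\pi(\tilde f(z))<\tilde\pi(\tilde f(z'))$.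 An Aubry-Mather set of $f$ is a minimal (for inclusion) $f$-ordered set. For an Aubry-Mather set $M$ there is a bi-Lipschitz orientation preserving homeomorphism $h$ of $\mathbb{T}$ with $\pi\circ f(\theta,r)=h(\theta)$ for all $(\theta,r)\in M$; the rotation number $\rho(M,\tilde f)$ is that of a lift $\tilde h$ of $h$ with $\tilde h(\tilde\theta)=\tilde\pi\circ\tilde f(\tilde\theta,r)$ on $p^{-1}(M)$. $M$ is irrational if $\rho(M,\tilde f)$ is irrational. Each Aubry-Mather set $M$ carries a unique $f$-invariant Borel probability measure $\mu(M,f)$; it is ergodic with support $M$. Such a measure is called a Mather measure, irrational if $M$ is irrational. The Lyapunov exponents of an (ergodic) Mather measure $\mu$ are those of the cocycle $Df$ over $(f,\mu)$. For $M\subset\mathbb{A}$ and $x\in M$, the paratingent cone $P_M(x)\subset T_x\mathbb{A}$ is the set of limits $v=\lim_{n\to\infty}\frac{x_n-y_n}{t_n}$ where $(x_n),(y_n)$ are sequences in $M$ converging to $x$, $(t_n)$ is a sequence of positive reals converging to $0$, and $x_n-y_n$ denotes the lift in $[-\frac12,\frac12[^2\subset\mathbb{R}^2$. $M$ is $C^1$-regular at $x$ if there is a line $D$ of $T_x\mathbb{A}$ with $P_M(x)\subset D$. *)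

theory Defs
  imports "HOL-Probability.Probability"
begin

quotient_type circle = real / "\<lambda>x y::real. x - y \<in> \<int>"
  morphisms rep_circle to_circle
proof (rule equivpI)
  show "reflp (\<lambda>x y::real. x - y \<in> \<int>)" by (simp add: reflp_def)
  show "symp (\<lambda>x y::real. x - y \<in> \<int>)"
    by (auto simp: symp_def) (metis Ints_minus minus_diff_eq)
  show "transp (\<lambda>x y::real. x - y \<in> \<int>)"
    by (auto simp: transp_def) (metis Ints_add diff_add_cancel add_diff_eq)
qed

lemma to_circle_eq_iff: "to_circle x = to_circle y \<longleftrightarrow> x - y \<in> \<int>"
  by (simp add: circle.abs_eq_iff)

text \<open>The representative in \<open>{-1/2..<1/2}\<close> of a difference of two points of the circle.\<close>

lift_definition circle_diff :: "circle \<Rightarrow> circle \<Rightarrow> real"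
  is "\<lambda>x y. (x - y) - of_int \<lfloor>(x - y) + 1/2\<rfloor>"
proof -
  fix x x' y y' :: real
  assume "x - x' \<in> \<int>" "y - y' \<in> \<int>"
  then have "(x - y) - (x' - y') \<in> \<int>"
    by (metis Ints_diff diff_diff_eq2 diff_diff_add add_diff_eq diff_add_eq add.commute)
  then obtain k where "x - y = (x' - y') + of_int k"
    by (metis Ints_cases diff_eq_eq add.commute)
  moreover have "\<lfloor>((x' - y') + of_int k) + 1/2\<rfloor> = \<lfloor>(x' - y') + 1/2\<rfloor> + k"
    by linarith
  ultimately show "(x - y) - of_int \<lfloor>(x - y) + 1/2\<rfloor> = (x' - y') - of_int \<lfloor>(x' - y') + 1/2\<rfloor>"
    by simp
qed

lemma circle_diff_bounds: "-1/2 \<le> circle_diff a b" "circle_diff a b < 1/2"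
  by (transfer, linarith)+

lemma to_circle_surj: "\<exists>x. a = to_circle x"
  by (metis Quotient3_abs_rep Quotient3_circle)

lemma circle_diff_minimal: "\<bar>circle_diff (to_circle x) (to_circle y)\<bar> \<le> \<bar>x - y + of_int k\<bar>"
proof -
  define d where "d = (x - y) - of_int \<lfloor>(x - y) + 1/2\<rfloor>"
  define m where "m = \<lfloor>(x - y) + 1/2\<rfloor> + k"
  have d: "-1/2 \<le> d" "d < 1/2" unfolding d_def by linarith+
  have e: "x - y + of_int k = d + of_int m" by (simp add: d_def m_def)
  have "\<bar>d\<bar> \<le> \<bar>d + of_int m\<bar>"
  proof (cases "m = 0")
    case False
    then have "1 \<le> \<bar>m\<bar>" by linarith
    then have "1 \<le> \<bar>of_int m :: real\<bar>" by linarith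
    then show ?thesis using d by linarith
  qed simp
  then show ?thesis unfolding e by (simp add: circle_diff.abs_eq d_def)
qed

lemma circle_diff_attained: "\<exists>k. circle_diff (to_circle x) (to_circle y) = x - y + of_int k"
  by (rule exI[of _ "- \<lfloor>(x - y) + 1/2\<rfloor>"]) (simp add: circle_diff.abs_eq)

instantiation circle :: metric_space
begin

definition dist_circle :: "circle \<Rightarrow> circle \<Rightarrow> real"
  where "dist_circle a b = \<bar>circle_diff a b\<bar>"

definition uniformity_circle :: "(circle \<times> circle) filter"
  where "uniformity_circle = (INF e\<in>{0<..}. principal {(x, y). dist x y < e})"

definition open_circle :: "circle set \<Rightarrow> bool"
  where "open_circle U \<longleftrightarrow> (\<forall>x\<in>U. eventually (\<lambda>(x', y). x' = x \<longrightarrow> y \<in> U) uniformity)"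

instance
proof
  fix a b c :: circle
  obtain x y z where abc: "a = to_circle x" "b = to_circle y" "c = to_circle z"
    using to_circle_surj by metis
  show "dist a b = 0 \<longleftrightarrow> a = b"
  proof
    assume "dist a b = 0"
    then have "x - y = of_int \<lfloor>(x - y) + 1/2\<rfloor>"
      by (simp add: abc dist_circle_def circle_diff.abs_eq)
    then have "x - y \<in> \<int>" by (metis Ints_of_int)
    then show "a = b" by (simp add: abc to_circle_eq_iff)
  next
    assume "a = b"
    then show "dist a b = 0"
      using circle_diff_minimal[of x x 0] by (simp add: abc dist_circle_def)
  qed
  obtain k where k: "circle_diff a c = x - z + of_int k"
    using circle_diff_attained abc by blast
  obtain l where l: "circle_diff b c = y - z + of_int l"
    using circle_diff_attained abc by blast
  have "\<bar>circle_diff a b\<bar> \<le> \<bar>x - y + of_int (k - l)\<bar>"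
    unfolding abc by (rule circle_diff_minimal)
  then show "dist a b \<le> dist a c + dist b c"
    unfolding dist_circle_def k l by simp
qed (rule uniformity_circle_def open_circle_def)+

end

type_synonym annulus = "circle \<times> real"

definition to_annulus :: "real \<times> real \<Rightarrow> annulus"
  where "to_annulus z = (to_circle (fst z), snd z)"

lemma open_circle_iff_quotient: "open U \<longleftrightarrow> open (to_circle -` U)"
proof
  assume U: "open U"
  show "open (to_circle -` U)"
    unfolding open_dist
  proof clarsimp
    fix x assume "to_circle x \<in> U"
    then obtain e where e: "e > 0" "\<And>b. dist b (to_circle x) < e \<Longrightarrow> b \<in> U"
      using U by (metis open_dist)
    have "to_circle y \<in> U" if "dist y x < e" for y
      using circle_diff_minimal[of y x 0] that e(2)[of "to_circle y"]
      by (simp add: dist_circle_def dist_real_def)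
    then show "\<exists>e>0. \<forall>y. dist y x < e \<longrightarrow> to_circle y \<in> U" using e(1) by blast
  qed
next
  assume U: "open (to_circle -` U)"
  show "open U"
    unfolding open_dist
  proof
    fix a assume a: "a \<in> U"
    obtain x where x: "a = to_circle x" using to_circle_surj by blast
    then obtain e where e: "e > 0" "\<And>y. dist y x < e \<Longrightarrow> to_circle y \<in> U"
      using U a unfolding open_dist by (metis vimageE vimageI)
    have "b \<in> U" if b: "dist b a < e" for b
    proof -
      obtain y where y: "b = to_circle y" using to_circle_surj by blast
      obtain k where k: "circle_diff b a = y - x + of_int k"
        using circle_diff_attained x y by blast
      have "dist (y + of_int k) x < e"
        using b k by (simp add: dist_circle_def dist_real_def algebra_simps)
      moreover have "b = to_circle (y + of_int k)" by (simp add: y to_circle_eq_iff)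
      ultimately show ?thesis using e(2) by simp
    qed
    then show "\<exists>e>0. \<forall>y. dist y a < e \<longrightarrow> y \<in> U" using e(1) by blast
  qed
qed

definition is_lift :: "(real \<times> real \<Rightarrow> real \<times> real) \<Rightarrow> (annulus \<Rightarrow> annulus) \<Rightarrow> bool"
  where "is_lift F f \<longleftrightarrow>
    continuous_on UNIV F \<and> (\<forall>z. to_annulus (F z) = f (to_annulus z))"

definition C1_map :: "(annulus \<Rightarrow> annulus) \<Rightarrow> bool"
  where "C1_map f \<longleftrightarrow>
    (\<exists>F F'. is_lift F f \<and>
       (\<forall>z. (F has_derivative blinfun_apply (F' z)) (at z)) \<and> continuous_on UNIV F')"

definition C1_diffeomorphism :: "(annulus \<Rightarrow> annulus) \<Rightarrow> bool"
  where "C1_diffeomorphism f \<longleftrightarrow> bij f \<and> C1_map f \<and> C1_map (inv f)"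

text \<open>The isotopy runs through homeomorphisms, the weakest of the usual requirements.\<close>

definition isotopic_to_identity :: "(annulus \<Rightarrow> annulus) \<Rightarrow> bool"
  where "isotopic_to_identity f \<longleftrightarrow>
    homotopic_with (homeomorphic_map euclidean euclidean) euclidean euclidean id f"

text \<open>
  Tangent spaces of the annulus are identified with \<open>\<real>\<^sup>2\<close> through the covering \<^const>\<open>to_annulus\<close>.
  For a differentiable \<open>f\<close> the derivative of a lift does not depend on the lift, nor on the point
  chosen over \<open>x\<close>.
\<close>

definition tangent_map :: "(annulus \<Rightarrow> annulus) \<Rightarrow> annulus \<Rightarrow> real \<times> real \<Rightarrow> real \<times> real"
  where "tangent_map f x =
    (THE A. \<exists>F z. is_lift F f \<and> to_annulus z = x \<and> (F has_derivative A) (at z))"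

definition C1_diffeo_real :: "(real \<Rightarrow> real) \<Rightarrow> bool"
  where "C1_diffeo_real g \<longleftrightarrow>
    bij g \<and> g C1_differentiable_on UNIV \<and> inv g C1_differentiable_on UNIV"

definition positive_twist_map :: "(annulus \<Rightarrow> annulus) \<Rightarrow> bool"
  where "positive_twist_map f \<longleftrightarrow>
    C1_diffeomorphism f \<and> isotopic_to_identity f \<and>
    (\<forall>F. is_lift F f \<longrightarrow> (\<forall>\<theta>.
       C1_diffeo_real (\<lambda>r. fst (F (\<theta>, r))) \<and> strict_mono (\<lambda>r. fst (F (\<theta>, r))) \<and>
       C1_diffeo_real (\<lambda>r. fst (inv F (\<theta>, r))) \<and>
       strict_antimono_on UNIV (\<lambda>r. fst (inv F (\<theta>, r)))))"

definition negative_twist_map :: "(annulus \<Rightarrow> annulus) \<Rightarrow> bool"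
  where "negative_twist_map f \<longleftrightarrow> (\<exists>g. positive_twist_map g \<and> f = inv g)"

definition twist_map :: "(annulus \<Rightarrow> annulus) \<Rightarrow> bool"
  where "twist_map f \<longleftrightarrow> positive_twist_map f \<or> negative_twist_map f"

type_synonym one_form = "annulus \<Rightarrow> real \<times> real \<Rightarrow> real"

definition r_d\<theta> :: one_form
  where "r_d\<theta> x v = snd x * fst v"

definition pullback_form :: "(annulus \<Rightarrow> annulus) \<Rightarrow> one_form \<Rightarrow> one_form"
  where "pullback_form f \<omega> x v = \<omega> (f x) (tangent_map f x v)"

definition exact_form :: "one_form \<Rightarrow> bool"
  where "exact_form \<omega> \<longleftrightarrow>
    (\<exists>S :: annulus \<Rightarrow> real. \<forall>z. ((\<lambda>w. S (to_annulus w)) has_derivative \<omega> (to_annulus z)) (at z))"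

definition exact_symplectic :: "(annulus \<Rightarrow> annulus) \<Rightarrow> bool"
  where "exact_symplectic f \<longleftrightarrow> exact_form (\<lambda>x v. pullback_form f r_d\<theta> x v - r_d\<theta> x v)"

definition f_ordered :: "(annulus \<Rightarrow> annulus) \<Rightarrow> annulus set \<Rightarrow> bool"
  where "f_ordered f M \<longleftrightarrow>
    M \<noteq> {} \<and> compact M \<and> f ` M = M \<and>
    (\<forall>F. is_lift F f \<longrightarrow>
       (\<forall>z \<in> to_annulus -` M. \<forall>z' \<in> to_annulus -` M.
          fst z < fst z' \<longleftrightarrow> fst (F z) < fst (F z')))"

definition aubry_mather_set :: "(annulus \<Rightarrow> annulus) \<Rightarrow> annulus set \<Rightarrow> bool"
  where "aubry_mather_set f M \<longleftrightarrow> f_ordered f M \<and> (\<forall>N \<subseteq> M. f_ordered f N \<longrightarrow> N = M)"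

definition is_circle_lift :: "(real \<Rightarrow> real) \<Rightarrow> (circle \<Rightarrow> circle) \<Rightarrow> bool"
  where "is_circle_lift H h \<longleftrightarrow>
    continuous_on UNIV H \<and> (\<forall>t. to_circle (H t) = h (to_circle t))"

definition bilipschitz_circle_homeo :: "(circle \<Rightarrow> circle) \<Rightarrow> bool"
  where "bilipschitz_circle_homeo h \<longleftrightarrow>
    bij h \<and> (\<exists>L. L-lipschitz_on UNIV h) \<and> (\<exists>L. L-lipschitz_on UNIV (inv h))"

definition orientation_preserving :: "(circle \<Rightarrow> circle) \<Rightarrow> bool"
  where "orientation_preserving h \<longleftrightarrow> (\<forall>H. is_circle_lift H h \<longrightarrow> strict_mono H)"

definition translation_number :: "(real \<Rightarrow> real) \<Rightarrow> real"
  where "translation_number H = lim (\<lambda>n. (H ^^ n) 0 / real n)"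

definition rotation_number ::
    "(annulus \<Rightarrow> annulus) \<Rightarrow> annulus set \<Rightarrow> (real \<times> real \<Rightarrow> real \<times> real) \<Rightarrow> real"
  where "rotation_number f M F =
    (THE \<rho>. \<exists>h H. bilipschitz_circle_homeo h \<and> orientation_preserving h \<and>
       (\<forall>x \<in> M. fst (f x) = h (fst x)) \<and>
       is_circle_lift H h \<and>
       (\<forall>z \<in> to_annulus -` M. H (fst z) = fst (F z)) \<and>
       \<rho> = translation_number H)"

text \<open>Changing the lift changes the rotation number by an integer.\<close>

definition irrational_set :: "(annulus \<Rightarrow> annulus) \<Rightarrow> annulus set \<Rightarrow> bool"
  where "irrational_set f M \<longleftrightarrow> (\<forall>F. is_lift F f \<longrightarrow> rotation_number f M F \<notin> \<rat>)"

definition invariant_prob_on :: "(annulus \<Rightarrow> annulus) \<Rightarrow> annulus set \<Rightarrow> annulus measure \<Rightarrow> bool"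
  where "invariant_prob_on f M \<mu> \<longleftrightarrow>
    prob_space \<mu> \<and> sets \<mu> = sets borel \<and> distr \<mu> borel f = \<mu> \<and> emeasure \<mu> M = 1"

definition irrational_mather_measure :: "(annulus \<Rightarrow> annulus) \<Rightarrow> annulus measure \<Rightarrow> bool"
  where "irrational_mather_measure f \<mu> \<longleftrightarrow>
    (\<exists>M. aubry_mather_set f M \<and> irrational_set f M \<and> invariant_prob_on f M \<mu>)"

definition measure_support :: "'a::topological_space measure \<Rightarrow> 'a set"
  where "measure_support \<mu> = {x. \<forall>U. open U \<and> x \<in> U \<longrightarrow> emeasure \<mu> U > 0}"

text \<open>
  By Oseledets' theorem, for almost every \<open>x\<close> the limit below exists for all nonzero \<open>v\<close>, and the
  set of its values is almost everywhere constant for an ergodic measure.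
\<close>

definition lyapunov_exponents :: "(annulus \<Rightarrow> annulus) \<Rightarrow> annulus measure \<Rightarrow> real set"
  where "lyapunov_exponents f \<mu> =
    {\<kappa>. AE x in \<mu>. \<exists>v. v \<noteq> 0 \<and>
       (\<lambda>n. ln (norm (tangent_map (f ^^ n) x v)) / real n) \<longlonglongrightarrow> \<kappa>}"

text \<open>
  The second coordinate needs no reduction. For sequences with a common limit the first coordinate
  is eventually small, so the choice of representative is immaterial in the cone.
\<close>

definition annulus_diff :: "annulus \<Rightarrow> annulus \<Rightarrow> real \<times> real"
  where "annulus_diff x y = (circle_diff (fst x) (fst y), snd x - snd y)"

definition paratingent_cone :: "annulus set \<Rightarrow> annulus \<Rightarrow> (real \<times> real) set"
  where "paratingent_cone M x =
    {v. \<exists>(xs :: nat \<Rightarrow> annulus) ys t.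
       (\<forall>n. xs n \<in> M \<and> ys n \<in> M \<and> (t n :: real) > 0) \<and>
       xs \<longlonglongrightarrow> x \<and> ys \<longlonglongrightarrow> x \<and> t \<longlonglongrightarrow> 0 \<and>
       (\<lambda>n. annulus_diff (xs n) (ys n) /\<^sub>R t n) \<longlonglongrightarrow> v}"

definition C1_regular_at :: "annulus set \<Rightarrow> annulus \<Rightarrow> bool"
  where "C1_regular_at M x \<longleftrightarrow>
    (\<exists>D. subspace D \<and> dim D = 1 \<and> paratingent_cone M x \<subseteq> D)"

end

theory Submission
  imports Defs
begin

text \<open>
  Let \<open>M\<close> be the Aubry-Mather set that carries \<open>\<mu>\<close>. By minimality \<open>M\<close> is the support of \<open>\<mu>\<close>, and since its rotation
  number is irrational it is infinite and has no isolated points.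

  The twist condition tilts a vertical vector to one side under \<open>f\<close> and to the other side under the inverse, so
  points of \<open>M\<close> lying almost vertically above each other would change their order (\<open>vertical_not_in_P\<close>). Hence the
  cone \<open>P\<^sub>M(x)\<close> is described by a nonempty compact set of slopes, with extremal elements \<open>smin x\<close> and \<open>smax x\<close>, and \<open>M\<close> is
  regular at \<open>x\<close> exactly when \<open>gap x = smax x - smin x\<close> vanishes (\<open>C1_regular_iff_gap\<close>). The derivative maps cones to
  cones and preserves the order of slopes, so the extremal slopes are two invariant fields. Let \<open>lmin \<le> lmax\<close> be
  the factors by which first coordinates are stretched along them; they are positive because order is
  preserved, and they differ exactly where the gap is positive. Exactness makes \<open>f\<close> area preserving
  (\<open>exact_symplectic_det\<close>), which gives \<open>gap (f x) * (lmin x * lmax x) = gap x\<close>. Let \<open>\<chi>min\<close> and \<open>\<chi>max\<close> be the integrals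
  of \<open>ln lmin\<close> and \<open>ln lmax\<close>.

  The dynamics on \<open>M\<close> is that of an irrational circle homeomorphism, for which averages of Lipschitz functions
  along orbits converge uniformly (\<open>uniform_averages\<close>). The extremal slopes are semicontinuous, so \<open>\<chi>max\<close> is still
  a uniform upper bound for the growth of all vectors of the cones, and \<open>\<chi>min\<close> a uniform lower bound. If \<open>\<chi>max\<close> were
  negative, an iterate of \<open>f\<close> would contract the distances between nearby points of \<open>M\<close>, and the infinite compact
  set \<open>M\<close> could not be its own image (\<open>no_contraction\<close>). Together with the same argument for the inverse this
  yields \<open>\<chi>min \<le> 0 \<le> \<chi>max\<close>. Uniform averages also show that the gap either vanishes almost everywhere or is positive
  almost everywhere (\<open>gap_dichotomy\<close>).

  If the gap vanishes almost everywhere, then \<open>\<chi>min = \<chi>max\<close>, so both are 0 and every point of \<open>M\<close> has a vector with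
  exponent 0 (\<open>zero_exponent_everywhere\<close>). If the gap is positive almost everywhere, then \<open>\<chi>min < \<chi>max\<close>, while
  \<open>\<chi>min + \<chi>max \<le> 0\<close> because \<open>ln lmin + ln lmax\<close> is a coboundary; so \<open>\<chi>min < 0\<close>. But a vector with exponent 0 spans a
  constant area with the vectors of slope \<open>smin\<close>, or is one of them, and either way it would force \<open>\<chi>min \<ge> 0\<close>
  (\<open>\<chi>min_nonneg\<close>). So 0 is not an exponent.
\<close>

section \<open>The covering of the annulus and lifts of maps\<close>

lemma dist_to_circle_le: "dist (to_circle s) (to_circle t) \<le> \<bar>s - t\<bar>"
  using circle_diff_minimal[of s t 0] by (simp add: dist_circle_def)

lemma continuous_on_to_circle: "continuous_on UNIV to_circle"
  unfolding continuous_on_iff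
  by (metis dist_to_circle_le dist_real_def le_less_trans)

lemma continuous_on_to_annulus: "continuous_on UNIV to_annulus"
  unfolding to_annulus_def
  by (intro continuous_intros continuous_on_compose2[OF continuous_on_to_circle]) auto

lemma to_annulus_surj: "\<exists>z. x = to_annulus z"
  by (metis to_annulus_def to_circle_surj fst_conv snd_conv prod.collapse)

lemma to_annulus_eq_iff:
  "to_annulus z = to_annulus w \<longleftrightarrow> (\<exists>k::int. z = w + (of_int k, 0))"
proof -
  have "to_annulus z = to_annulus w \<longleftrightarrow> fst z - fst w \<in> \<int> \<and> snd z = snd w"
    by (auto simp: to_annulus_def to_circle_eq_iff)
  also have "\<dots> \<longleftrightarrow> (\<exists>k::int. z = w + (of_int k, 0))"
    by (auto simp: prod_eq_iff Ints_def algebra_simps)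
  finally show ?thesis .
qed

lemma to_annulus_shift [simp]: "to_annulus (z + (of_int k, 0)) = to_annulus z"
  using to_annulus_eq_iff by blast

lemma circle_diff_to_circle: "\<bar>s - t\<bar> < 1/2 \<Longrightarrow> circle_diff (to_circle s) (to_circle t) = s - t"
proof -
  assume "\<bar>s - t\<bar> < 1/2"
  then have "\<lfloor>(s - t) + 1/2\<rfloor> = 0" by linarith
  then show ?thesis by (simp add: circle_diff.abs_eq)
qed

lemma annulus_diff_to_annulus:
  "\<bar>fst z - fst w\<bar> < 1/2 \<Longrightarrow> annulus_diff (to_annulus z) (to_annulus w) = z - w"
  by (simp add: annulus_diff_def to_annulus_def circle_diff_to_circle prod_eq_iff)

text \<open>A local section of the covering, through which convergence in the annulus is lifted to the plane.\<close>

lemma to_annulus_add_diff: "to_annulus (z + annulus_diff x (to_annulus z)) = x"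
proof -
  obtain w where w: "x = to_annulus w" using to_annulus_surj by blast
  obtain k where "circle_diff (to_circle (fst w)) (to_circle (fst z)) = fst w - fst z + of_int k"
    using circle_diff_attained by blast
  then have "z + annulus_diff x (to_annulus z) = w + (of_int k, 0)"
    by (simp add: w annulus_diff_def to_annulus_def prod_eq_iff)
  then show ?thesis by (simp add: w)
qed

lemma norm_annulus_diff: "norm (annulus_diff x y) = dist x y"
  by (simp add: annulus_diff_def norm_Pair dist_prod_def dist_circle_def dist_real_def)

lemma tendsto_lift:
  assumes "xs \<longlonglongrightarrow> to_annulus z"
  obtains zs where "\<And>n. to_annulus (zs n) = xs n" "zs \<longlonglongrightarrow> z"
proof
  let ?zs = "\<lambda>n. z + annulus_diff (xs n) (to_annulus z)"
  show "\<And>n. to_annulus (?zs n) = xs n" by (rule to_annulus_add_diff)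
  have "(\<lambda>n. norm (annulus_diff (xs n) (to_annulus z))) \<longlonglongrightarrow> 0"
    unfolding norm_annulus_diff using assms by (rule tendsto_dist_iff[THEN iffD1])
  then have "(\<lambda>n. annulus_diff (xs n) (to_annulus z)) \<longlonglongrightarrow> 0"
    by (rule tendsto_norm_zero_cancel)
  then show "?zs \<longlonglongrightarrow> z"
    using tendsto_add[OF tendsto_const, of _ 0 sequentially z] by simp
qed

lemma eventually_annulus_diff_lift:
  assumes "zs \<longlonglongrightarrow> z" "ws \<longlonglongrightarrow> z"
  shows "\<forall>\<^sub>F n in sequentially. annulus_diff (to_annulus (zs n)) (to_annulus (ws n)) = zs n - ws n"
proof -
  have "(\<lambda>n. \<bar>fst (zs n) - fst (ws n)\<bar>) \<longlonglongrightarrow> \<bar>fst z - fst z\<bar>"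
    by (intro tendsto_intros assms)
  then have "\<forall>\<^sub>F n in sequentially. \<bar>fst (zs n) - fst (ws n)\<bar> < 1/2"
    by (rule order_tendstoD) simp
  then show ?thesis by eventually_elim (rule annulus_diff_to_annulus)
qed

lemma continuous_on_annulusI:
  fixes g :: "annulus \<Rightarrow> 'b::topological_space"
  assumes "continuous_on UNIV (\<lambda>z. g (to_annulus z))"
  shows "continuous_on UNIV g"
proof (rule continuous_on_sequentiallyI)
  fix u and a :: annulus assume u: "u \<longlonglongrightarrow> a"
  obtain z where z: "a = to_annulus z" using to_annulus_surj by blast
  obtain zs where zs: "\<And>n. to_annulus (zs n) = u n" "zs \<longlonglongrightarrow> z"
    using tendsto_lift u z by metis
  have "(\<lambda>n. g (to_annulus (zs n))) \<longlonglongrightarrow> g (to_annulus z)"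
    using continuous_on_tendsto_compose[OF assms zs(2)] by simp
  then show "(\<lambda>n. g (u n)) \<longlonglongrightarrow> g a" by (simp add: zs(1) z)
qed

text \<open>The fibres of the covering are discrete and the plane is connected.\<close>

lemma continuous_same_fibre_const:
  fixes A B :: "real \<times> real \<Rightarrow> real \<times> real"
  assumes "continuous_on UNIV A" "continuous_on UNIV B"
    and eq: "\<And>z. to_annulus (A z) = to_annulus (B z)"
  obtains k :: int where "\<And>z. A z = B z + (of_int k, 0)"
proof -
  have ex: "\<exists>k::int. A z = B z + (of_int k, 0)" for z
    using eq to_annulus_eq_iff by blast
  have "continuous_on UNIV (\<lambda>z. fst (A z - B z))"
    by (intro continuous_intros assms)
  moreover have "fst (A z - B z) \<in> \<int>" for z
    using ex[of z] by auto
  ultimately obtain c where c: "\<And>z. fst (A z - B z) = c"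
    using continuous_discrete_range_constant[of UNIV "\<lambda>z. fst (A z - B z)"]
  proof -
    assume a: "continuous_on UNIV (\<lambda>z. fst (A z - B z))" "\<And>z. fst (A z - B z) \<in> \<int>"
      and th: "\<And>c. (\<And>z. fst (A z - B z) = c) \<Longrightarrow> thesis"
    have "(\<lambda>z. fst (A z - B z)) constant_on UNIV"
    proof (rule continuous_discrete_range_constant[OF _ a(1)])
      fix x :: "real \<times> real"
      have "1 \<le> norm (fst (A y - B y) - fst (A x - B x))"
        if "fst (A y - B y) \<noteq> fst (A x - B x)" for y
      proof -
        obtain m l :: int where m: "fst (A y - B y) = of_int m" "fst (A x - B x) = of_int l"
          using a(2) by (metis Ints_cases)
        then have "m \<noteq> l" using that by auto
        then have "1 \<le> \<bar>m - l\<bar>" by linarith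
        then have "1 \<le> \<bar>real_of_int (m - l)\<bar>" by linarith
        then show ?thesis unfolding m by simp
      qed
      then show "\<exists>e>0. \<forall>y. y \<in> UNIV \<and> fst (A y - B y) \<noteq> fst (A x - B x) \<longrightarrow>
          e \<le> norm (fst (A y - B y) - fst (A x - B x))"
        by (intro exI[of _ 1]) auto
    qed (rule connected_UNIV)
    then show thesis using th by (auto simp: constant_on_def)
  qed
  obtain k :: int where k: "c = of_int k"
    using ex[of 0] c[of 0] by auto
  have "A z = B z + (of_int k, 0)" for z
    using ex[of z] c[of z] k by auto
  then show thesis using that by blast
qed

definition C1_lift where
  "C1_lift F F' f \<longleftrightarrow> is_lift F f \<and>
    (\<forall>z. (F has_derivative blinfun_apply (F' z)) (at z)) \<and> continuous_on UNIV F'"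

lemma C1_map_iff: "C1_map f \<longleftrightarrow> (\<exists>F F'. C1_lift F F' f)"
  by (simp add: C1_map_def C1_lift_def)

lemma C1_liftD:
  assumes "C1_lift F F' f"
  shows "continuous_on UNIV F" "\<And>z. to_annulus (F z) = f (to_annulus z)"
    "\<And>z. (F has_derivative blinfun_apply (F' z)) (at z)" "continuous_on UNIV F'"
  using assms by (auto simp: C1_lift_def is_lift_def)

lemma is_lift_unique:
  assumes "is_lift F f" "is_lift G f"
  obtains k :: int where "\<And>z. F z = G z + (of_int k, 0)"
  by (rule continuous_same_fibre_const[of F G]) (use assms in \<open>simp_all add: is_lift_def del: split_paired_All\<close>)

lemma is_lift_shift:
  assumes "is_lift F f"
  shows "is_lift (\<lambda>z. F (z + (of_int k, 0))) f"
proof -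
  have "continuous_on UNIV (\<lambda>z. z + (real_of_int k, 0::real))" by (intro continuous_intros)
  then have "continuous_on UNIV (\<lambda>z. F (z + (of_int k, 0)))"
    using assms continuous_on_compose2[of UNIV F] unfolding is_lift_def by blast
  then show ?thesis
    using assms unfolding is_lift_def by (simp del: split_paired_All)
qed

text \<open>Two lifts, and the translates of a lift by deck transformations, differ by constants. So all of them have
  the same derivative over a point, and the definite description in the tangent map is met.\<close>

lemma tangent_map_eq:
  assumes "C1_lift F F' f"
  shows "tangent_map f (to_annulus z) = blinfun_apply (F' z)"
  unfolding tangent_map_def
proof (rule the_equality)
  show "\<exists>G w. is_lift G f \<and> to_annulus w = to_annulus z \<and> (G has_derivative blinfun_apply (F' z)) (at w)"
    using assms C1_lift_def by blast
next
  fix A assume "\<exists>G w. is_lift G f \<and> to_annulus w = to_annulus z \<and> (G has_derivative A) (at w)"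
  then obtain G w where G: "is_lift G f" "to_annulus w = to_annulus z" "(G has_derivative A) (at w)"
    by blast
  obtain k :: int where k: "w = z + (of_int k, 0)" using G(2) to_annulus_eq_iff by blast
  obtain m :: int where m: "\<And>y. G (y + (of_int k, 0)) = F y + (of_int m, 0)"
    using is_lift_unique[OF is_lift_shift[OF G(1), of k]] assms C1_lift_def by metis
  have "((\<lambda>y. G (y + (of_int k, 0))) has_derivative A) (at z)"
  proof (rule has_derivative_compose[of "\<lambda>y. y + (of_int k, 0)" "\<lambda>y. y" z UNIV G A])
    show "((\<lambda>y. y + (of_int k, 0)) has_derivative (\<lambda>y. y)) (at z)"
      using has_derivative_add[OF has_derivative_ident has_derivative_const] by simp
  qed (use G(3) k in simp)
  then have "((\<lambda>y. F y + (of_int m, 0)) has_derivative A) (at z)" by (simp add: m)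
  then have "((\<lambda>y. (F y + (of_int m, 0)) - (of_int m, 0)) has_derivative (\<lambda>h. A h - 0)) (at z)"
    by (intro has_derivative_diff has_derivative_const)
  then have "(F has_derivative A) (at z)" by simp
  then show "A = blinfun_apply (F' z)"
    using C1_liftD(3)[OF assms] has_derivative_unique by blast
qed

lemma continuous_on_C1_map: "C1_map f \<Longrightarrow> continuous_on UNIV f"
proof -
  assume "C1_map f"
  then obtain F F' where F: "C1_lift F F' f" using C1_map_iff by blast
  have "continuous_on UNIV (\<lambda>z. to_annulus (F z))"
    by (rule continuous_on_compose2[OF continuous_on_to_annulus C1_liftD(1)[OF F]]) auto
  then show ?thesis using continuous_on_annulusI C1_liftD(2)[OF F] by simp
qed

lemma continuous_on_tangent_map:
  assumes "C1_map f" shows "continuous_on UNIV (\<lambda>x. tangent_map f x v)"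
proof -
  obtain F F' where F: "C1_lift F F' f" using C1_map_iff assms by blast
  have "continuous_on UNIV (\<lambda>z. blinfun_apply (F' z) v)"
    by (intro continuous_intros C1_liftD(4)[OF F])
  then show ?thesis by (intro continuous_on_annulusI) (simp add: tangent_map_eq[OF F])
qed

lemma linear_tangent_map: "C1_map f \<Longrightarrow> linear (tangent_map f x)"
  by (metis C1_map_iff to_annulus_surj tangent_map_eq blinfun.bounded_linear_right bounded_linear.linear)

lemma C1_lift_compose:
  assumes F: "C1_lift F F' f" and G: "C1_lift G G' g"
  shows "C1_lift (F \<circ> G) (\<lambda>z. F' (G z) o\<^sub>L G' z) (f \<circ> g)"
  unfolding C1_lift_def is_lift_def
proof (intro conjI allI)
  show "continuous_on UNIV (F \<circ> G)"
    by (intro continuous_on_compose C1_liftD(1)[OF G] continuous_on_subset[OF C1_liftD(1)[OF F]]) auto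
  show "to_annulus ((F \<circ> G) z) = (f \<circ> g) (to_annulus z)" for z
    by (simp add: C1_liftD(2)[OF F] C1_liftD(2)[OF G])
  show "((F \<circ> G) has_derivative blinfun_apply (F' (G z) o\<^sub>L G' z)) (at z)" for z
    using has_derivative_compose[OF C1_liftD(3)[OF G] C1_liftD(3)[OF F], of z]
    by (simp add: o_def blinfun_compose.rep_eq)
  show "continuous_on UNIV (\<lambda>z. F' (G z) o\<^sub>L G' z)"
    by (intro continuous_intros continuous_on_compose2[OF C1_liftD(4)[OF F] C1_liftD(1)[OF G]]
        C1_liftD(4)[OF G]) auto
qed

lemma C1_map_compose: "C1_map f \<Longrightarrow> C1_map g \<Longrightarrow> C1_map (f \<circ> g)"
  using C1_lift_compose unfolding C1_map_iff by blast

lemma tangent_map_compose: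
  assumes "C1_map f" "C1_map g"
  shows "tangent_map (f \<circ> g) x v = tangent_map f (g x) (tangent_map g x v)"
proof -
  obtain F F' G G' where F: "C1_lift F F' f" and G: "C1_lift G G' g"
    using assms C1_map_iff by metis
  obtain z where z: "x = to_annulus z" using to_annulus_surj by blast
  show ?thesis
    using tangent_map_eq[OF F, of "G z"] tangent_map_eq[OF G, of z]
      tangent_map_eq[OF C1_lift_compose[OF F G], of z]
    by (simp add: z C1_liftD(2)[OF G] blinfun_compose.rep_eq)
qed

lemma C1_lift_id: "C1_lift (\<lambda>z. z) (\<lambda>z. id_blinfun) (\<lambda>x. x)"
  by (auto simp: C1_lift_def is_lift_def intro!: derivative_eq_intros)

lemma C1_map_id: "C1_map (\<lambda>x. x)"
  using C1_lift_id C1_map_iff by blast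

lemma tangent_map_id [simp]: "tangent_map (\<lambda>x. x) x v = v"
  using tangent_map_eq[OF C1_lift_id] to_annulus_surj by (metis id_blinfun.rep_eq)

lemma C1_map_funpow: "C1_map f \<Longrightarrow> C1_map (f ^^ n)"
proof (induction n)
  case 0
  then show ?case using C1_map_id by (simp add: id_def)
next
  case (Suc n)
  then show ?case using C1_map_compose[of f "f ^^ n"] unfolding funpow.simps by blast
qed

lemma tangent_map_funpow_0 [simp]: "tangent_map id x v = v"
  by (simp add: id_def)

lemma tangent_map_funpow_Suc:
  "C1_map f \<Longrightarrow> tangent_map (f ^^ Suc n) x v = tangent_map f ((f ^^ n) x) (tangent_map (f ^^ n) x v)"
  using tangent_map_compose[of f "f ^^ n"] C1_map_funpow by simp

text \<open>Strict differentiability of \<open>C\<^sup>1\<close> maps: the map minus its linear part at \<open>z\<close> has, by continuity of the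
  derivative, an arbitrarily small Lipschitz constant near \<open>z\<close>.\<close>

lemma difference_quotient_lift:
  assumes F: "C1_lift F F' f" and zs: "zs \<longlonglongrightarrow> z" and ws: "ws \<longlonglongrightarrow> z"
    and q: "(\<lambda>n. (zs n - ws n) /\<^sub>R t n) \<longlonglongrightarrow> v"
  shows "(\<lambda>n. (F (zs n) - F (ws n)) /\<^sub>R t n) \<longlonglongrightarrow> blinfun_apply (F' z) v"
proof -
  let ?A = "blinfun_apply (F' z)"
  let ?q = "\<lambda>n. (zs n - ws n) /\<^sub>R t n"
  let ?e = "\<lambda>n. (F (zs n) - F (ws n) - ?A (zs n - ws n)) /\<^sub>R t n"
  have bq: "Bseq ?q" using q convergent_def convergent_imp_Bseq by blast
  then obtain K where K: "K > 0" "\<And>n. norm (?q n) \<le> K" by (auto elim: BseqE)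
  have "?e \<longlonglongrightarrow> 0"
  proof (rule LIMSEQ_I)
    fix r :: real assume r: "r > 0"
    have "isCont F' z" using C1_liftD(4)[OF F] by (simp add: continuous_on_eq_continuous_at del: split_paired_All)
    then obtain d where d: "d > 0" "\<And>y. dist y z < d \<Longrightarrow> dist (F' y) (F' z) < r / (2 * K)"
      unfolding continuous_at_eps_delta using r K(1) by (metis divide_pos_pos mult_pos_pos zero_less_numeral)
    have "\<forall>\<^sub>F n in sequentially. dist (zs n) z < d" "\<forall>\<^sub>F n in sequentially. dist (ws n) z < d"
      using zs ws d(1) by (auto simp: tendsto_iff)
    then have "\<forall>\<^sub>F n in sequentially. norm (?e n) < r"
    proof eventually_elim
      case (elim n)
      have "norm (F (zs n) - F (ws n) - ?A (zs n - ws n)) \<le> norm (zs n - ws n) * (r / (2 * K))"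
      proof (rule differentiable_bound_linearization[where S="ball z d" and f'="\<lambda>y. blinfun_apply (F' y)"])
        fix s :: real assume "s \<in> {0..1}"
        then have "ws n + s *\<^sub>R (zs n - ws n) \<in> closed_segment (ws n) (zs n)"
          by (auto simp: closed_segment_def algebra_simps intro!: exI[of _ s])
        moreover have "closed_segment (ws n) (zs n) \<subseteq> ball z d"
          using elim by (intro closed_segment_subset) (auto simp: dist_commute)
        ultimately show "ws n + s *\<^sub>R (zs n - ws n) \<in> ball z d" by blast
      next
        show "(F has_derivative blinfun_apply (F' x)) (at x within ball z d)" for x
          using C1_liftD(3)[OF F] has_derivative_at_withinI by blast
      next
        fix x assume "x \<in> ball z d"
        then have "norm (F' x - F' z) < r / (2 * K)"
          using d(2)[of x] by (simp add: dist_commute dist_norm)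
        then show "onorm (blinfun_apply (F' x) - ?A) \<le> r / (2 * K)"
          by (simp add: norm_blinfun.rep_eq minus_blinfun.rep_eq fun_diff_def)
      qed (use d(1) in auto)
      then have "\<bar>inverse (t n)\<bar> * norm (F (zs n) - F (ws n) - ?A (zs n - ws n))
          \<le> \<bar>inverse (t n)\<bar> * (norm (zs n - ws n) * (r / (2 * K)))"
        by (intro mult_left_mono) auto
      then have "norm (?e n) \<le> norm (?q n) * (r / (2 * K))"
        by (simp only: norm_scaleR mult.assoc)
      also have "\<dots> \<le> K * (r / (2 * K))"
        using K r by (intro mult_right_mono) auto
      also have "\<dots> < r" using K(1) r by simp
      finally show ?case .
    qed
    then show "\<exists>no. \<forall>n\<ge>no. norm (?e n - 0) < r" by (simp add: eventually_sequentially)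
  qed
  moreover have "(\<lambda>n. ?A (?q n)) \<longlonglongrightarrow> ?A v"
    by (intro tendsto_intros q)
  ultimately have "(\<lambda>n. ?e n + ?A (?q n)) \<longlonglongrightarrow> 0 + ?A v" by (rule tendsto_add)
  then show ?thesis
    by (simp only: blinfun.scaleR_right scaleR_add_right[symmetric] diff_add_cancel add_0_left)
qed

lemma difference_quotient_annulus:
  assumes f: "C1_map f" and xs: "xs \<longlonglongrightarrow> x" and ys: "ys \<longlonglongrightarrow> x"
    and q: "(\<lambda>n. annulus_diff (xs n) (ys n) /\<^sub>R t n) \<longlonglongrightarrow> v"
  shows "(\<lambda>n. annulus_diff (f (xs n)) (f (ys n)) /\<^sub>R t n) \<longlonglongrightarrow> tangent_map f x v"
proof -
  obtain F F' where F: "C1_lift F F' f" using C1_map_iff f by blast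
  obtain z where z: "x = to_annulus z" using to_annulus_surj by blast
  obtain zs where zs: "\<And>n. to_annulus (zs n) = xs n" "zs \<longlonglongrightarrow> z"
    using tendsto_lift xs z by metis
  obtain ws where ws: "\<And>n. to_annulus (ws n) = ys n" "ws \<longlonglongrightarrow> z"
    using tendsto_lift ys z by metis
  have "(\<lambda>n. (zs n - ws n) /\<^sub>R t n) \<longlonglongrightarrow> v"
    by (rule Lim_transform_eventually[OF q])
      (use eventually_annulus_diff_lift[OF zs(2) ws(2)] in \<open>eventually_elim, simp add: zs(1) ws(1)\<close>)
  from difference_quotient_lift[OF F zs(2) ws(2) this]
  have *: "(\<lambda>n. (F (zs n) - F (ws n)) /\<^sub>R t n) \<longlonglongrightarrow> tangent_map f x v"
    by (simp add: tangent_map_eq[OF F] z)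
  have "(\<lambda>n. F (zs n)) \<longlonglongrightarrow> F z" "(\<lambda>n. F (ws n)) \<longlonglongrightarrow> F z"
    using continuous_on_tendsto_compose[OF C1_liftD(1)[OF F] zs(2)]
      continuous_on_tendsto_compose[OF C1_liftD(1)[OF F] ws(2)] by simp_all
  from eventually_annulus_diff_lift[OF this]
  have "\<forall>\<^sub>F n in sequentially. (F (zs n) - F (ws n)) /\<^sub>R t n = annulus_diff (f (xs n)) (f (ys n)) /\<^sub>R t n"
    by eventually_elim (metis C1_liftD(2)[OF F] zs(1) ws(1))
  then show ?thesis by (rule Lim_transform_eventually[OF *])
qed

section \<open>The paratingent cone\<close>

lemma abs_fst_le_norm: "\<bar>fst p\<bar> \<le> norm p" for p :: "real \<times> real"
  using norm_fst_le[of "fst p" "snd p"] by simp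

lemma abs_snd_le_norm: "\<bar>snd p\<bar> \<le> norm p" for p :: "real \<times> real"
  using norm_snd_le[of "snd p" "fst p"] by simp

lemma annulus_diff_uminus:
  assumes "dist x y < 1/2" shows "annulus_diff y x = - annulus_diff x y"
proof -
  obtain z where z: "x = to_annulus z" using to_annulus_surj by blast
  define w where "w = z + annulus_diff y x"
  have w: "to_annulus w = y" unfolding w_def z by (rule to_annulus_add_diff)
  have "\<bar>fst w - fst z\<bar> \<le> norm (w - z)" using abs_fst_le_norm[of "w - z"] by simp
  also have "\<dots> < 1/2" using assms by (simp add: w_def norm_annulus_diff dist_commute)
  finally have "\<bar>fst w - fst z\<bar> < 1/2" .
  then show ?thesis
    using annulus_diff_to_annulus[of w z] annulus_diff_to_annulus[of z w]
    by (simp add: w z abs_minus_commute)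
qed

lemma abs_fst_annulus_diff: "\<bar>fst (annulus_diff x y)\<bar> = dist (fst x) (fst y)"
  by (simp add: annulus_diff_def dist_circle_def)

lemma annulus_diff_self [simp]: "annulus_diff x x = 0"
  using norm_annulus_diff[of x x] by simp

lemma paratingent_coneI:
  assumes "\<And>n. xs n \<in> M" "\<And>n. ys n \<in> M" "\<And>n. t n > 0" "xs \<longlonglongrightarrow> x" "ys \<longlonglongrightarrow> x" "t \<longlonglongrightarrow> 0"
    and "(\<lambda>n. annulus_diff (xs n) (ys n) /\<^sub>R t n) \<longlonglongrightarrow> v"
  shows "v \<in> paratingent_cone M x"
  unfolding paratingent_cone_def mem_Collect_eq
  by (rule exI[of _ xs], rule exI[of _ ys], rule exI[of _ t]) (intro conjI allI assms)

lemma paratingent_coneE: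
  assumes "v \<in> paratingent_cone M x"
  obtains xs ys :: "nat \<Rightarrow> annulus" and t :: "nat \<Rightarrow> real"
    where "\<forall>n. xs n \<in> M" "\<forall>n. ys n \<in> M" "\<forall>n. t n > 0" "xs \<longlonglongrightarrow> x" "ys \<longlonglongrightarrow> x" "t \<longlonglongrightarrow> 0"
      "(\<lambda>n. annulus_diff (xs n) (ys n) /\<^sub>R t n) \<longlonglongrightarrow> v"
  using assms[unfolded paratingent_cone_def mem_Collect_eq]
proof (elim exE conjE)
  fix xs ys :: "nat \<Rightarrow> annulus" and t :: "nat \<Rightarrow> real"
  assume "\<forall>n. xs n \<in> M \<and> ys n \<in> M \<and> 0 < t n" "xs \<longlonglongrightarrow> x" "ys \<longlonglongrightarrow> x" "t \<longlonglongrightarrow> 0"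
      "(\<lambda>n. annulus_diff (xs n) (ys n) /\<^sub>R t n) \<longlonglongrightarrow> v"
  then show thesis by (intro that[of xs ys t]) simp_all
qed

text \<open>A description of the cone without sequences, from which it is immediate that the cones form a closed set.\<close>

lemma paratingent_cone_iff:
  "v \<in> paratingent_cone M x \<longleftrightarrow>
    (\<forall>e>0. \<exists>y\<in>M. \<exists>z\<in>M. \<exists>t>0. t < e \<and> dist y x < e \<and> dist z x < e \<and>
       dist (annulus_diff y z /\<^sub>R t) v < e)"
    (is "?L \<longleftrightarrow> ?R")
proof
  assume ?L
  then obtain xs ys :: "nat \<Rightarrow> annulus" and t :: "nat \<Rightarrow> real"
    where xy: "\<forall>n. xs n \<in> M" "\<forall>n. ys n \<in> M" "\<forall>n. t n > 0" "xs \<longlonglongrightarrow> x" "ys \<longlonglongrightarrow> x" "t \<longlonglongrightarrow> 0"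
      "(\<lambda>n. annulus_diff (xs n) (ys n) /\<^sub>R t n) \<longlonglongrightarrow> v"
    by (rule paratingent_coneE)
  show ?R
  proof (intro allI impI)
    fix e :: real assume e: "e > 0"
    have "\<forall>\<^sub>F n in sequentially. dist (xs n) x < e \<and> dist (ys n) x < e \<and> dist (t n) 0 < e \<and>
        dist (annulus_diff (xs n) (ys n) /\<^sub>R t n) v < e"
      using xy(4-) e by (simp add: tendsto_iff eventually_conj)
    then obtain n where "dist (xs n) x < e" "dist (ys n) x < e" "dist (t n) 0 < e"
        "dist (annulus_diff (xs n) (ys n) /\<^sub>R t n) v < e"
      using eventually_happens'[OF sequentially_bot] by blast
    then show "\<exists>y\<in>M. \<exists>z\<in>M. \<exists>t>0. t < e \<and> dist y x < e \<and> dist z x < e \<and>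
       dist (annulus_diff y z /\<^sub>R t) v < e"
      using xy(1,2,3) by (intro bexI[of _ "xs n"] bexI[of _ "ys n"] exI[of _ "t n"]) auto
  qed
next
  assume R: ?R
  have "\<exists>p. fst p \<in> M \<and> fst (snd p) \<in> M \<and> snd (snd p) > 0 \<and> snd (snd p) < e \<and>
      dist (fst p) x < e \<and> dist (fst (snd p)) x < e \<and>
      dist (annulus_diff (fst p) (fst (snd p)) /\<^sub>R snd (snd p)) v < e" if e: "e > 0" for e :: real
  proof -
    obtain y z t where "y \<in> M" "z \<in> M" "t > 0" "t < e" "dist y x < e" "dist z x < e"
        "dist (annulus_diff y z /\<^sub>R t) v < e"
      using R e by blast
    then show ?thesis by (intro exI[of _ "(y, z, t)"]) simp
  qed
  then have "\<forall>n. \<exists>p. fst p \<in> M \<and> fst (snd p) \<in> M \<and> snd (snd p) > 0 \<and> snd (snd p) < inverse (real (Suc n)) \<and>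
      dist (fst p) x < inverse (real (Suc n)) \<and> dist (fst (snd p)) x < inverse (real (Suc n)) \<and>
      dist (annulus_diff (fst p) (fst (snd p)) /\<^sub>R snd (snd p)) v < inverse (real (Suc n))"
    by (simp del: split_paired_Ex)
  from choice[OF this] obtain p :: "nat \<Rightarrow> annulus \<times> annulus \<times> real" where
    p: "\<And>n. fst (p n) \<in> M \<and> fst (snd (p n)) \<in> M \<and> snd (snd (p n)) > 0 \<and>
      snd (snd (p n)) < inverse (real (Suc n)) \<and> dist (fst (p n)) x < inverse (real (Suc n)) \<and>
      dist (fst (snd (p n))) x < inverse (real (Suc n)) \<and>
      dist (annulus_diff (fst (p n)) (fst (snd (p n))) /\<^sub>R snd (snd (p n))) v < inverse (real (Suc n))"
    by blast
  have lim: "u \<longlonglongrightarrow> l" if "\<And>n. dist (u n) l < inverse (real (Suc n))"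
    for u :: "nat \<Rightarrow> 'z::metric_space" and l
    by (rule metric_tendsto_imp_tendsto[OF LIMSEQ_inverse_real_of_nat])
      (use that in \<open>auto intro!: always_eventually less_imp_le simp: dist_real_def abs_if\<close>)
  have "(\<lambda>n. fst (p n)) \<longlonglongrightarrow> x" "(\<lambda>n. fst (snd (p n))) \<longlonglongrightarrow> x" "(\<lambda>n. snd (snd (p n))) \<longlonglongrightarrow> 0"
    "(\<lambda>n. annulus_diff (fst (p n)) (fst (snd (p n))) /\<^sub>R snd (snd (p n))) \<longlonglongrightarrow> v"
    using p by (intro lim; simp add: dist_real_def abs_of_pos)+
  with p show ?L by (intro paratingent_coneI) auto
qed

lemma paratingent_cone_closed_graph:
  assumes "xs \<longlonglongrightarrow> x" "vs \<longlonglongrightarrow> v" "\<And>n. vs n \<in> paratingent_cone M (xs n)"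
  shows "v \<in> paratingent_cone M x"
  unfolding paratingent_cone_iff
proof (intro allI impI)
  fix e :: real assume e: "e > 0"
  have "\<forall>\<^sub>F n in sequentially. dist (xs n) x < e/2 \<and> dist (vs n) v < e/2"
    using assms(1,2) half_gt_zero[OF e] unfolding tendsto_iff by (intro eventually_conj) blast+
  then obtain n where n: "dist (xs n) x < e/2" "dist (vs n) v < e/2"
    using eventually_happens'[OF sequentially_bot] by blast
  obtain y z t where "y \<in> M" "z \<in> M" "t > 0" "t < e/2" "dist y (xs n) < e/2" "dist z (xs n) < e/2"
      "dist (annulus_diff y z /\<^sub>R t) (vs n) < e/2"
    using assms(3)[of n] e unfolding paratingent_cone_iff by (meson half_gt_zero)
  with n show "\<exists>y\<in>M. \<exists>z\<in>M. \<exists>t>0. t < e \<and> dist y x < e \<and> dist z x < e \<and>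
       dist (annulus_diff y z /\<^sub>R t) v < e"
    by (intro bexI[of _ y] bexI[of _ z] exI[of _ t] conjI)
      (auto intro: dist_triangle_half_l simp: dist_commute elim: dist_triangle_half_r)
qed

lemma paratingent_cone_in_closure:
  assumes "v \<in> paratingent_cone M x" "closed M" shows "x \<in> M"
proof -
  have "\<exists>y\<in>M. dist y x < e" if "e > 0" for e
    using assms(1) that unfolding paratingent_cone_iff by blast
  then show ?thesis using closed_approachable[OF assms(2)] by blast
qed

lemma paratingent_cone_scaleR:
  assumes v: "v \<in> paratingent_cone M x" shows "c *\<^sub>R v \<in> paratingent_cone M x"
proof -
  obtain xs ys :: "nat \<Rightarrow> annulus" and t :: "nat \<Rightarrow> real"
    where xy: "\<forall>n. xs n \<in> M" "\<forall>n. ys n \<in> M" "\<forall>n. t n > 0" "xs \<longlonglongrightarrow> x" "ys \<longlonglongrightarrow> x" "t \<longlonglongrightarrow> 0"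
      "(\<lambda>n. annulus_diff (xs n) (ys n) /\<^sub>R t n) \<longlonglongrightarrow> v"
    using v by (rule paratingent_coneE)
  consider "c > 0" | "c = 0" | "c < 0" by linarith
  then show ?thesis
  proof cases
    case 1
    have "(\<lambda>n. annulus_diff (xs n) (ys n) /\<^sub>R (t n / c)) \<longlonglongrightarrow> c *\<^sub>R v"
      using tendsto_scaleR[OF tendsto_const[of c] xy(7)] by (simp add: mult.commute divide_inverse)
    moreover have "(\<lambda>n. t n / c) \<longlonglongrightarrow> 0" using xy(6) tendsto_divide_zero by blast
    ultimately show ?thesis
      using xy 1 by (intro paratingent_coneI[of xs M ys "\<lambda>n. t n / c"]) simp_all
  next
    case 2
    show ?thesis
      using xy 2 by (intro paratingent_coneI[of xs M xs t]) simp_all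
  next
    case 3
    have "(\<lambda>n. dist (xs n) (ys n)) \<longlonglongrightarrow> dist x x"
      by (intro tendsto_intros xy)
    then have "\<forall>\<^sub>F n in sequentially. dist (xs n) (ys n) < 1/2"
      by (rule order_tendstoD) simp
    then have ev: "\<forall>\<^sub>F n in sequentially. c *\<^sub>R (annulus_diff (xs n) (ys n) /\<^sub>R t n)
        = annulus_diff (ys n) (xs n) /\<^sub>R (t n / - c)"
    proof eventually_elim
      case (elim n)
      show ?case
        unfolding annulus_diff_uminus[OF elim] by (simp add: divide_inverse mult.commute)
    qed
    have "(\<lambda>n. annulus_diff (ys n) (xs n) /\<^sub>R (t n / - c)) \<longlonglongrightarrow> c *\<^sub>R v"
      by (rule Lim_transform_eventually[OF _ ev]) (intro tendsto_intros xy)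
    moreover have "(\<lambda>n. t n / - c) \<longlonglongrightarrow> 0" using xy(6) tendsto_divide_zero by blast
    moreover have "t n / - c > 0" for n using xy(3) 3 by (simp add: divide_pos_neg)
    ultimately show ?thesis
      using xy by (intro paratingent_coneI[of ys M xs "\<lambda>n. t n / - c"]) simp_all
  qed
qed

lemma paratingent_cone_image:
  assumes f: "C1_map f" and sub: "f ` M \<subseteq> N" and v: "v \<in> paratingent_cone M x"
  shows "tangent_map f x v \<in> paratingent_cone N (f x)"
proof -
  obtain xs ys :: "nat \<Rightarrow> annulus" and t :: "nat \<Rightarrow> real"
    where xy: "\<forall>n. xs n \<in> M" "\<forall>n. ys n \<in> M" "\<forall>n. t n > 0" "xs \<longlonglongrightarrow> x" "ys \<longlonglongrightarrow> x" "t \<longlonglongrightarrow> 0"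
      "(\<lambda>n. annulus_diff (xs n) (ys n) /\<^sub>R t n) \<longlonglongrightarrow> v"
    using v by (rule paratingent_coneE)
  have "(\<lambda>n. f (xs n)) \<longlonglongrightarrow> f x" "(\<lambda>n. f (ys n)) \<longlonglongrightarrow> f x"
    using continuous_on_tendsto_compose[OF continuous_on_C1_map[OF f] xy(4)]
      continuous_on_tendsto_compose[OF continuous_on_C1_map[OF f] xy(5)] by simp_all
  then show ?thesis
    using xy(1,2,3)[rule_format] xy(6) difference_quotient_annulus[OF f xy(4,5,7)] sub
    by (intro paratingent_coneI[of "\<lambda>n. f (xs n)" N "\<lambda>n. f (ys n)" t]) blast+
qed

text \<open>Normalise the differences and use compactness of the unit sphere. Uniform bounds on \<open>M\<close> are proved by
  applying this to pairs of points that violate them more and more.\<close>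

lemma paratingent_cone_limit_direction:
  assumes xy: "\<And>n. xs n \<in> M" "\<And>n. ys n \<in> M" "\<And>n. xs n \<noteq> ys n" "xs \<longlonglongrightarrow> x" "ys \<longlonglongrightarrow> x"
  obtains r :: "nat \<Rightarrow> nat" and v where "strict_mono r" "norm v = 1" "v \<in> paratingent_cone M x"
    "(\<lambda>n. annulus_diff (xs (r n)) (ys (r n)) /\<^sub>R dist (xs (r n)) (ys (r n))) \<longlonglongrightarrow> v"
proof -
  let ?q = "\<lambda>n. annulus_diff (xs n) (ys n) /\<^sub>R dist (xs n) (ys n)"
  have "?q n \<in> sphere 0 1" for n
    using xy(3)[of n] by (simp add: norm_annulus_diff)
  then have "\<forall>n. ?q n \<in> sphere 0 1" by blast
  then obtain v r where r: "v \<in> sphere 0 1" "strict_mono r" "(?q \<circ> r) \<longlonglongrightarrow> v"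
    by (rule seq_compactE[OF compact_imp_seq_compact[OF compact_sphere]])
  have x: "(\<lambda>n. xs (r n)) \<longlonglongrightarrow> x" "(\<lambda>n. ys (r n)) \<longlonglongrightarrow> x"
    using LIMSEQ_subseq_LIMSEQ[OF xy(4) r(2)] LIMSEQ_subseq_LIMSEQ[OF xy(5) r(2)]
    by (simp_all add: o_def)
  have "(\<lambda>n. dist (xs (r n)) (ys (r n))) \<longlonglongrightarrow> dist x x"
    by (intro tendsto_intros x)
  then have "v \<in> paratingent_cone M x"
    using x xy r(3)
    by (intro paratingent_coneI[of "\<lambda>n. xs (r n)" M "\<lambda>n. ys (r n)" "\<lambda>n. dist (xs (r n)) (ys (r n))"])
      (simp_all add: o_def)
  then show thesis using that r by (simp add: o_def)
qed

section \<open>Exactness and area\<close>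

text \<open>Here \<open>B\<close> is the derivative of \<open>w \<mapsto> U w\<close> at the point \<open>z\<close>. Both values of \<open>B\<close> are limits of the same
  second difference of \<open>u\<close> over a shrinking parallelogram, by the mean value theorem applied along one
  side or along the other.\<close>

lemma symmetric_second_derivative_at:
  fixes u :: "'a::real_normed_vector \<Rightarrow> real"
  assumes der: "\<And>w. (u has_derivative U w) (at w)"
    and Badd: "\<And>h k l. B (h + k) l = B h l + B k l"
    and Bscale: "\<And>c h l. B (c *\<^sub>R h) l = c * B h l"
    and appr: "\<And>e. e > 0 \<Longrightarrow> \<exists>d>0. \<forall>w. norm (w - z) < d \<longrightarrow>
       (\<forall>h. \<bar>U w h - B (w - z) h\<bar> \<le> e * norm (w - z) * norm h)"
    and e1: "norm e1 = 1" and e2: "norm e2 = 1"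
  shows "B e1 e2 = B e2 e1"
proof -
  have half: "\<bar>(u (z + s *\<^sub>R a + s *\<^sub>R b) - u (z + s *\<^sub>R b) - (u (z + s *\<^sub>R a) - u z)) - s\<^sup>2 * B a b\<bar>
      \<le> 3 * e * s\<^sup>2"
    if ab: "norm a = 1" "norm b = 1" and e: "e > 0" and d: "d > 0"
      and s: "s > 0" "2 * s < d"
      and D: "\<And>w h. norm (w - z) < d \<Longrightarrow> \<bar>U w h - B (w - z) h\<bar> \<le> e * norm (w - z) * norm h"
    for a b e d s
  proof -
    define p where "p = (\<lambda>t. u (z + s *\<^sub>R a + t *\<^sub>R b) - u (z + t *\<^sub>R b))"
    have "((\<lambda>t. u (y + t *\<^sub>R b)) has_derivative (\<lambda>h. U (y + t *\<^sub>R b) (h *\<^sub>R b))) (at t)" for y t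
      by (rule has_derivative_compose[OF _ der]) (auto intro!: derivative_eq_intros)
    moreover have "U (y + t *\<^sub>R b) (h *\<^sub>R b) = h * U (y + t *\<^sub>R b) b" for y t h
      using linear_scale[OF has_derivative_linear[OF der]] by (simp add: real_scaleR_def)
    ultimately have up: "((\<lambda>t. u (y + t *\<^sub>R b)) has_field_derivative U (y + t *\<^sub>R b) b) (at t)" for y t
      by (simp add: has_field_derivative_def mult_commute_abs)
    have "(p has_field_derivative (U (z + s *\<^sub>R a + t *\<^sub>R b) b - U (z + t *\<^sub>R b) b)) (at t)" for t
      unfolding p_def by (intro DERIV_diff up)
    then obtain t where t: "0 < t" "t < s"
      "p s - p 0 = (s - 0) * (U (z + s *\<^sub>R a + t *\<^sub>R b) b - U (z + t *\<^sub>R b) b)"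
      using MVT2[of 0 s p "\<lambda>t. U (z + s *\<^sub>R a + t *\<^sub>R b) b - U (z + t *\<^sub>R b) b"] s by blast
    have n1: "norm (s *\<^sub>R a + t *\<^sub>R b) \<le> 2 * s"
      using norm_triangle_ineq[of "s *\<^sub>R a" "t *\<^sub>R b"] t s ab by simp
    have n2: "norm (t *\<^sub>R b) \<le> s" using t ab by simp
    have "\<bar>U (z + s *\<^sub>R a + t *\<^sub>R b) b - B (s *\<^sub>R a + t *\<^sub>R b) b\<bar> \<le> e * (2 * s)"
      using D[of "z + s *\<^sub>R a + t *\<^sub>R b" b] n1 s ab e
      by (simp add: add.assoc) (meson mult_left_mono less_imp_le order_trans)
    moreover have "\<bar>U (z + t *\<^sub>R b) b - B (t *\<^sub>R b) b\<bar> \<le> e * s"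
      using D[of "z + t *\<^sub>R b" b] n2 s ab e
      by simp (meson mult_left_mono less_imp_le order_trans)
    moreover have "B (s *\<^sub>R a + t *\<^sub>R b) b = s * B a b + B (t *\<^sub>R b) b"
      by (simp add: Badd Bscale)
    ultimately have "\<bar>(U (z + s *\<^sub>R a + t *\<^sub>R b) b - U (z + t *\<^sub>R b) b) - s * B a b\<bar> \<le> 3 * e * s"
      by (simp add: algebra_simps)
    then have "s * \<bar>(U (z + s *\<^sub>R a + t *\<^sub>R b) b - U (z + t *\<^sub>R b) b) - s * B a b\<bar> \<le> s * (3 * e * s)"
      using s(1) by (intro mult_left_mono) auto
    moreover have "s * \<bar>(U (z + s *\<^sub>R a + t *\<^sub>R b) b - U (z + t *\<^sub>R b) b) - s * B a b\<bar>
        = \<bar>(p s - p 0) - s\<^sup>2 * B a b\<bar>"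
      using s(1) by (simp add: t(3) abs_mult_pos' power2_eq_square algebra_simps)
    ultimately show ?thesis
      by (simp add: p_def power2_eq_square algebra_simps)
  qed
  have "\<bar>B e1 e2 - B e2 e1\<bar> \<le> 0 + e" if e: "e > 0" for e :: real
  proof -
    obtain d where d: "d > 0"
      "\<And>w h. norm (w - z) < d \<Longrightarrow> \<bar>U w h - B (w - z) h\<bar> \<le> (e/6) * norm (w - z) * norm h"
      using appr[of "e/6"] e by auto
    define s where "s = d/3"
    have s: "s > 0" "2 * s < d" using d by (auto simp: s_def)
    have "\<bar>s\<^sup>2 * B e1 e2 - s\<^sup>2 * B e2 e1\<bar> \<le> s\<^sup>2 * e"
      using half[OF e1 e2 _ d(1) s d(2)] half[OF e2 e1 _ d(1) s d(2)] e
      by (simp add: algebra_simps abs_if split: if_splits)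
    then have "s\<^sup>2 * \<bar>B e1 e2 - B e2 e1\<bar> \<le> s\<^sup>2 * e"
      by (simp add: abs_mult flip: right_diff_distrib)
    then show ?thesis using s by simp
  qed
  then have "\<bar>B e1 e2 - B e2 e1\<bar> \<le> 0" by (rule field_le_epsilon)
  then show ?thesis by simp
qed

text \<open>For a map of class \<open>C\<^sup>1\<close> the form \<open>f\<^sup>*(r d\<theta>)\<close> is merely continuous, and its exterior derivative is replaced by
  a pointwise argument. A primitive \<open>S\<close> is corrected by multiples of \<open>F\<^sub>1\<close> and \<open>\<theta>\<close> so that its derivative becomes
  \<open>(F\<^sub>2 - F\<^sub>2(z)) dF\<^sub>1 - (r - r(z)) d\<theta>\<close>. This is differentiable at \<open>z\<close>, with derivative the bilinear form
  \<open>dF\<^sub>2 \<otimes> dF\<^sub>1 - dr \<otimes> d\<theta>\<close>, and the symmetry of that form says that the determinant is 1.\<close>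

lemma exact_symplectic_det:
  assumes f: "C1_map f" and ex: "exact_symplectic f"
  shows "fst (tangent_map f x (1, 0)) * snd (tangent_map f x (0, 1))
       - fst (tangent_map f x (0, 1)) * snd (tangent_map f x (1, 0)) = 1"
proof -
  obtain F F' where F: "C1_lift F F' f" using C1_map_iff f by blast
  obtain z where z: "x = to_annulus z" using to_annulus_surj by blast
  obtain S :: "annulus \<Rightarrow> real" where S: "\<And>w. ((\<lambda>w. S (to_annulus w)) has_derivative
      (\<lambda>v. snd (F w) * fst (F' w v) - snd w * fst v)) (at w)"
  proof -
    obtain S :: "annulus \<Rightarrow> real" where S: "\<And>w. ((\<lambda>w. S (to_annulus w)) has_derivative
      (\<lambda>v. pullback_form f r_d\<theta> (to_annulus w) v - r_d\<theta> (to_annulus w) v)) (at w)"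
      using ex unfolding exact_symplectic_def exact_form_def by blast
    have "(\<lambda>v. pullback_form f r_d\<theta> (to_annulus w) v - r_d\<theta> (to_annulus w) v) =
        (\<lambda>v. snd (F w) * fst (F' w v) - snd w * fst v)" for w
    proof -
      have "snd (f (to_annulus w)) = snd (F w)"
        by (subst C1_liftD(2)[OF F, symmetric]) (simp add: to_annulus_def)
      moreover have "snd (to_annulus w) = snd w" by (simp add: to_annulus_def)
      ultimately show ?thesis
        by (simp add: pullback_form_def r_d\<theta>_def tangent_map_eq[OF F])
    qed
    then show thesis using that[of S] S by presburger
  qed
  define A where "A = blinfun_apply (F' z)"
  define u where "u = (\<lambda>w. S (to_annulus w) - snd (F z) * fst (F w) + snd z * fst w)"
  define U where "U = (\<lambda>w v. (snd (F w) - snd (F z)) * fst (F' w v) - (snd w - snd z) * fst v)"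
  define B where "B = (\<lambda>h k :: real \<times> real. snd (A h) * fst (A k) - snd h * fst k)"
  have "B (1, 0) (0, 1) = B (0, 1) (1, 0)"
  proof (rule symmetric_second_derivative_at[where z = z and U = U and u = u])
    show "(u has_derivative U w) (at w)" for w
      unfolding u_def U_def
      by (rule derivative_eq_intros S C1_liftD(3)[OF F] refl | simp add: algebra_simps)+
    show "B (h + k) l = B h l + B k l" for h k l
      by (simp add: B_def A_def blinfun.add_right algebra_simps)
    show "B (c *\<^sub>R h) l = c * B h l" for c h l
      by (simp add: B_def A_def blinfun.scaleR_right algebra_simps)
  next
    fix e :: real assume e: "e > 0"
    define K where "K = norm (F' z) + 1"
    have K: "K \<ge> 1" by (simp add: K_def)
    define e' where "e' = min 1 (e / (2 * K))"
    have e': "e' > 0" "e' \<le> 1" "e' * (2 * K) \<le> e"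
      using e K by (auto simp: e'_def min_def field_simps)
    obtain d1 where d1: "d1 > 0" "\<And>w. norm (w - z) < d1 \<Longrightarrow>
        norm (F w - F z - A (w - z)) \<le> e' * norm (w - z)"
      using C1_liftD(3)[OF F, of z] e'(1) unfolding has_derivative_at_alt A_def by metis
    have "isCont F' z"
      using C1_liftD(4)[OF F] by (simp add: continuous_on_eq_continuous_at del: split_paired_All)
    then obtain d2 where d2: "d2 > 0" "\<And>w. norm (w - z) < d2 \<Longrightarrow> norm (F' w - F' z) < e'"
      using e'(1) unfolding continuous_at_eps_delta dist_norm by metis
    have "\<bar>U w h - B (w - z) h\<bar> \<le> e * norm (w - z) * norm h" if w: "norm (w - z) < min d1 d2" for w h
    proof -
      have 1: "\<bar>snd (F w) - snd (F z) - snd (A (w - z))\<bar> \<le> e' * norm (w - z)"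
        using d1(2)[of w] w abs_snd_le_norm[of "F w - F z - A (w - z)"] by simp
      have "norm (F' w) \<le> K"
        using d2(2)[of w] w e'(2) norm_triangle_ineq2[of "F' w" "F' z"] by (simp add: K_def)
      then have 2: "\<bar>fst (F' w h)\<bar> \<le> K * norm h"
        using abs_fst_le_norm[of "F' w h"] norm_blinfun[of "F' w" h]
          mult_right_mono[of "norm (F' w)" K "norm h"] by simp
      have "norm (A (w - z)) \<le> K * norm (w - z)"
        using norm_blinfun[of "F' z" "w - z"] mult_right_mono[of "norm (F' z)" K "norm (w - z)"]
        by (simp add: A_def K_def)
      then have 3: "\<bar>snd (A (w - z))\<bar> \<le> K * norm (w - z)"
        using abs_snd_le_norm[of "A (w - z)"] by simp
      have "norm ((F' w - F' z) h) \<le> e' * norm h"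
        using norm_blinfun[of "F' w - F' z" h] d2(2)[of w] w
          mult_right_mono[of "norm (F' w - F' z)" e' "norm h"] by simp
      then have 4: "\<bar>fst (F' w h) - fst (A h)\<bar> \<le> e' * norm h"
        using abs_fst_le_norm[of "(F' w - F' z) h"] by (simp add: A_def minus_blinfun.rep_eq)
      have "U w h - B (w - z) h = (snd (F w) - snd (F z) - snd (A (w - z))) * fst (F' w h)
          + snd (A (w - z)) * (fst (F' w h) - fst (A h))"
        by (simp add: U_def B_def algebra_simps)
      then have "\<bar>U w h - B (w - z) h\<bar> \<le> \<bar>snd (F w) - snd (F z) - snd (A (w - z))\<bar> * \<bar>fst (F' w h)\<bar>
          + \<bar>snd (A (w - z))\<bar> * \<bar>fst (F' w h) - fst (A h)\<bar>"
        by (metis abs_mult abs_triangle_ineq)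
      also have "\<dots> \<le> (e' * norm (w - z)) * (K * norm h) + (K * norm (w - z)) * (e' * norm h)"
        using 1 2 3 4 e' K by (intro add_mono mult_mono) auto
      also have "\<dots> = (e' * (2 * K)) * (norm (w - z) * norm h)" by (simp add: algebra_simps)
      also have "\<dots> \<le> e * (norm (w - z) * norm h)"
        using e'(3) by (intro mult_right_mono) auto
      finally show ?thesis by (simp add: mult.assoc)
    qed
    then show "\<exists>d>0. \<forall>w. norm (w - z) < d \<longrightarrow>
       (\<forall>h. \<bar>U w h - B (w - z) h\<bar> \<le> e * norm (w - z) * norm h)"
      using d1(1) d2(1) by (intro exI[of _ "min d1 d2"]) auto
  qed (simp_all add: norm_Pair)
  then show ?thesis
    by (simp add: B_def A_def z tangent_map_eq[OF F] algebra_simps)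
qed

section \<open>Circle dynamics\<close>

lemma sum_shift_diff:
  fixes g :: "nat \<Rightarrow> real"
  shows "(\<Sum>i<n. g (i + m) - g i) = (\<Sum>j<m. g (n + j) - g j)"
proof (induction n)
  case (Suc n)
  have "(\<Sum>j<m. g (Suc n + j) - g (n + j)) = g (n + m) - g n"
    using sum_lessThan_telescope[of "\<lambda>j. g (n + j)" m] by simp
  then show ?case using Suc by (simp add: sum_subtractf)
qed simp

locale monotone_degree_one =
  fixes H :: "real \<Rightarrow> real"
  assumes mono: "strict_mono H" and shift1: "H (t + 1) = H t + 1"
begin

lemma shift_nat: "H (t + real n) = H t + real n"
proof (induction n)
  case (Suc n)
  have "H (t + real (Suc n)) = H ((t + real n) + 1)" by (simp add: add_ac)
  then show ?case using Suc shift1[of "t + real n"] by simp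
qed simp

lemma shift: "H (t + of_int k) = H t + of_int k"
proof (cases "k \<ge> 0")
  case True
  then show ?thesis using shift_nat[of t "nat k"] by simp
next
  case False
  then show ?thesis using shift_nat[of "t + of_int k" "nat (-k)"] by simp
qed

lemma funpow: "monotone_degree_one (H ^^ n)"
proof
  show "strict_mono (H ^^ n)"
    by (induction n) (use mono in \<open>auto simp: strict_mono_def\<close>)
  show "(H ^^ n) (t + 1) = (H ^^ n) t + 1" for t
    by (induction n) (auto simp: shift1)
qed

lemma displacement_variation: "\<bar>(H t - t) - (H s - s)\<bar> \<le> 1"
proof -
  define k where "k = \<lfloor>t - s\<rfloor>"
  have k: "s + of_int k \<le> t" "t \<le> s + of_int (k + 1)"
    unfolding k_def by linarith+
  have "H (s + of_int k) \<le> H t" "H t \<le> H (s + of_int (k + 1))"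
    using k mono by (simp_all only: strict_mono_less_eq)
  then have "H s + of_int k \<le> H t" "H t \<le> H s + of_int (k + 1)"
    by (simp_all only: shift)
  then show ?thesis using k by simp
qed

text \<open>The displacement of a power of \<open>H\<close> being almost independent of the point, it is almost additive in the
  exponent.\<close>

lemma funpow_mult_displacement:
  "\<bar>(H ^^ (n * m)) t - t - real m * ((H ^^ n) s - s)\<bar> \<le> real m"
proof (induction m)
  case (Suc m)
  interpret n: monotone_degree_one "H ^^ n" by (rule funpow)
  have "(H ^^ (n * Suc m)) t = (H ^^ n) ((H ^^ (n * m)) t)"
    by (simp add: funpow_add)
  then show ?case
    using Suc n.displacement_variation[of "(H ^^ (n * m)) t" s] by (simp add: algebra_simps)
qed simp

text \<open>Almost additivity makes the mean displacements a Cauchy sequence, with error 1 for every iterate and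
  every starting point.\<close>

lemma rotation_exists:
  obtains \<rho> where "\<forall>n t. \<bar>(H ^^ n) t - t - real n * \<rho>\<bar> \<le> 1"
proof -
  define a where "a = (\<lambda>n. (H ^^ n) 0 / real n)"
  have ineq: "\<bar>real n * ((H ^^ m) t - t) - real m * ((H ^^ n) s - s)\<bar> \<le> real m + real n" for n m t s
    using funpow_mult_displacement[of n m 0 s] funpow_mult_displacement[of m n 0 t]
    by (simp add: mult.commute[of m n])
  have cross: "\<bar>((H ^^ m) t - t) / real m - ((H ^^ n) s - s) / real n\<bar> \<le> 1 / real n + 1 / real m"
    if "m > 0" "n > 0" for m n t s
  proof -
    have "\<bar>((H ^^ m) t - t) / real m - ((H ^^ n) s - s) / real n\<bar>
        = \<bar>real n * ((H ^^ m) t - t) - real m * ((H ^^ n) s - s)\<bar> / (real m * real n)"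
      using that by (simp add: diff_frac_eq abs_divide mult.commute)
    also have "\<dots> \<le> (real m + real n) / (real m * real n)"
      using ineq by (intro divide_right_mono) auto
    also have "\<dots> = 1 / real n + 1 / real m"
      using that by (simp add: field_simps)
    finally show ?thesis .
  qed
  have "Cauchy a"
  proof (rule metric_CauchyI)
    fix e :: real assume "e > 0"
    then obtain N where N: "N > 0" "1 / real N < e / 2"
      by (metis half_gt_zero nat_approx_posE zero_less_Suc)
    have "dist (a m) (a n) < e" if "m \<ge> N" "n \<ge> N" for m n
    proof -
      have "1 / real m \<le> 1 / real N" "1 / real n \<le> 1 / real N"
        using that N(1) by (simp_all add: frac_le)
      then show ?thesis
        using cross[of m n 0 0] that N by (simp add: a_def dist_real_def)
    qed
    then show "\<exists>N. \<forall>m\<ge>N. \<forall>n\<ge>N. dist (a m) (a n) < e" by blast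
  qed
  then obtain \<rho> where \<rho>: "a \<longlonglongrightarrow> \<rho>" using Cauchy_convergent_iff convergent_def by blast
  have "\<bar>(H ^^ n) t - t - real n * \<rho>\<bar> \<le> 1" for n t
  proof (cases "n = 0")
    case False
    have "(\<lambda>m. \<bar>a m - ((H ^^ n) t - t) / real n\<bar>) \<longlonglongrightarrow> \<bar>\<rho> - ((H ^^ n) t - t) / real n\<bar>"
      by (intro tendsto_intros \<rho>)
    moreover have "(\<lambda>m. 1 / real n + 1 / real m) \<longlonglongrightarrow> 1 / real n + 0"
      by (intro tendsto_intros lim_1_over_n)
    moreover have "\<forall>\<^sub>F m in sequentially. \<bar>a m - ((H ^^ n) t - t) / real n\<bar> \<le> 1 / real n + 1 / real m"
      using eventually_gt_at_top[of 0]
      by eventually_elim (use cross[of _ n 0 t] False in \<open>simp add: a_def\<close>)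
    ultimately have "\<bar>\<rho> - ((H ^^ n) t - t) / real n\<bar> \<le> 1 / real n + 0"
      by (intro tendsto_le[OF sequentially_bot])
    then have "real n * \<bar>\<rho> - ((H ^^ n) t - t) / real n\<bar> \<le> real n * (1 / real n)"
      by (intro mult_left_mono) auto
    moreover have "real n * \<bar>\<rho> - D / real n\<bar> = \<bar>real n * \<rho> - D\<bar>" for D
      using False by (simp add: abs_mult_pos' right_diff_distrib)
    ultimately have "\<bar>real n * \<rho> - ((H ^^ n) t - t)\<bar> \<le> 1"
      using False by simp
    then show ?thesis by linarith
  qed simp
  then show thesis using that by blast
qed

lemma rotation_tendsto:
  assumes "\<And>n. \<bar>(H ^^ n) t - t - real n * \<rho>\<bar> \<le> 1"
  shows "(\<lambda>n. (H ^^ n) t / real n) \<longlonglongrightarrow> \<rho>"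
proof -
  have "(\<lambda>n. (H ^^ n) t / real n - \<rho>) \<longlonglongrightarrow> 0"
  proof (rule Lim_null_comparison)
    show "\<forall>\<^sub>F n in sequentially. norm ((H ^^ n) t / real n - \<rho>) \<le> (1 + \<bar>t\<bar>) / real n"
      using eventually_gt_at_top[of 0]
    proof eventually_elim
      case (elim n)
      have "(H ^^ n) t / real n - \<rho> = ((H ^^ n) t - real n * \<rho>) / real n"
        using elim by (simp add: field_simps)
      moreover have "\<bar>(H ^^ n) t - real n * \<rho>\<bar> \<le> 1 + \<bar>t\<bar>" using assms[of n] by linarith
      ultimately show ?case by (simp add: divide_right_mono)
    qed
    show "(\<lambda>n. (1 + \<bar>t\<bar>) / real n) \<longlonglongrightarrow> 0" by (rule lim_const_over_n)
  qed
  then show ?thesis by (rule LIM_zero_cancel)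
qed

lemma translation_number_displacement:
  "\<bar>(H ^^ n) t - t - real n * translation_number H\<bar> \<le> 1"
proof -
  obtain \<rho> where \<rho>: "\<forall>n t. \<bar>(H ^^ n) t - t - real n * \<rho>\<bar> \<le> 1" by (rule rotation_exists)
  then have "translation_number H = \<rho>"
    unfolding translation_number_def by (intro limI rotation_tendsto) blast
  then show ?thesis using \<rho> by simp
qed

lemma translation_number_tendsto: "(\<lambda>n. (H ^^ n) t / real n) \<longlonglongrightarrow> translation_number H"
  by (intro rotation_tendsto translation_number_displacement)

text \<open>The iterate of order \<open>q m\<close> displaces \<open>t\<close> by exactly \<open>m p\<close>, and also by \<open>q m\<close> times the translation number up
  to an error of at most 1.\<close>

lemma rational_translation_number:
  assumes "(H ^^ q) t = t + of_int p" "q > 0"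
  shows "translation_number H \<in> \<rat>"
proof -
  interpret q: monotone_degree_one "H ^^ q" by (rule funpow)
  have it: "(H ^^ (q * m)) t = t + real m * of_int p" for m
  proof (induction m)
    case (Suc m)
    have "(H ^^ (q * Suc m)) t = (H ^^ q) (t + of_int (int m * p))"
      using Suc by (simp add: funpow_add)
    then show ?case using q.shift[of t "int m * p"] assms(1) by (simp add: algebra_simps)
  qed simp
  have bd: "real m * \<bar>of_int p - real q * translation_number H\<bar> \<le> 1" for m
  proof -
    have "real m * (of_int p - real q * translation_number H)
        = t + real m * of_int p - t - real (q * m) * translation_number H"
      by (simp add: algebra_simps)
    then show ?thesis
      using translation_number_displacement[of "q * m" t] unfolding it
      by (simp add: abs_mult_pos')
  qed
  have "\<bar>of_int p - real q * translation_number H\<bar> = 0"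
  proof (rule ccontr)
    assume "\<bar>of_int p - real q * translation_number H\<bar> \<noteq> 0"
    then have "\<bar>of_int p - real q * translation_number H\<bar> > 0" by simp
    then obtain m where "1 < real m * \<bar>of_int p - real q * translation_number H\<bar>"
      using reals_Archimedean3 by blast
    with bd[of m] show False by simp
  qed
  then have "translation_number H = of_int p / real q"
    using assms(2) by (simp add: field_simps)
  then show ?thesis by simp
qed

text \<open>Averages of Lipschitz functions along orbits become uniformly independent of the orbit. Let
  \<open>k \<rho> - p > 0\<close> be small. Every orbit enters the arc from \<open>s\<close> to its return \<open>H\<^sup>k s - p\<close> in bounded time, and
  from then on follows the orbit of \<open>s\<close> inside the images of that arc, whose lengths add up by
  telescoping to roughly \<open>n (k \<rho> - p)\<close>.\<close>

lemma uniform_averages: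
  assumes irr: "translation_number H \<notin> \<rat>"
    and K: "\<And>t. t \<in> K \<Longrightarrow> H t \<in> K" "\<And>t k. t \<in> K \<Longrightarrow> t + of_int k \<in> K"
    and per: "\<And>t k. t \<in> K \<Longrightarrow> \<psi> (t + of_int k) = \<psi> t"
    and L: "L > 0" "\<And>s t. s \<in> K \<Longrightarrow> t \<in> K \<Longrightarrow> \<bar>\<psi> s - \<psi> t\<bar> \<le> L * \<bar>s - t\<bar>"
    and e: "e > 0"
  shows "\<exists>N. \<forall>n\<ge>N. \<forall>s\<in>K. \<forall>t\<in>K.
    \<bar>(\<Sum>i<n. \<psi> ((H ^^ i) s)) - (\<Sum>i<n. \<psi> ((H ^^ i) t))\<bar> \<le> e * real n"
proof -
  define \<rho> where "\<rho> = translation_number H"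
  have disp: "\<bar>(H ^^ n) t - t - real n * \<rho>\<bar> \<le> 1" for n t
    unfolding \<rho>_def by (rule translation_number_displacement)
  have itshift: "(H ^^ n) (t + of_int c) = (H ^^ n) t + of_int c" for n t c
    using monotone_degree_one.shift[OF funpow] .
  have itmono: "(H ^^ n) s \<le> (H ^^ n) t \<longleftrightarrow> s \<le> t" for n s t
    using monotone_degree_one.mono[OF funpow] strict_mono_less_eq by blast
  have Kit: "(H ^^ n) t \<in> K" if "t \<in> K" for n t
    by (induction n) (use that K in auto)
  have osc: "\<bar>\<psi> s - \<psi> t\<bar> \<le> L" if st: "s \<in> K" "t \<in> K" for s t
  proof -
    have "\<bar>\<psi> s - \<psi> (t + of_int \<lfloor>s - t\<rfloor>)\<bar> \<le> L * \<bar>s - (t + of_int \<lfloor>s - t\<rfloor>)\<bar>"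
      using st K by (intro L) auto
    also have "\<dots> \<le> L * 1" using L(1) by (intro mult_left_mono) linarith+
    finally show ?thesis using per st by simp
  qed
  (* k \<rho> - h will lie between 0 and e / (2 L) *)
  obtain h k0 where k0: "k0 > 0" "\<bar>of_int k0 * \<rho> - of_int h - e / (4 * L)\<bar> < e / (4 * L)"
  proof (rule sequence_of_fractional_parts_is_dense[OF irr[folded \<rho>_def]])
    show "e / (4 * L) > 0" using e L(1) by simp
  qed
  define k where "k = nat k0"
  define \<kappa> where "\<kappa> = real k * \<rho> - of_int h"
  have \<kappa>: "\<kappa> > 0" "L * \<kappa> \<le> e / 2"
  proof -
    have "\<bar>\<kappa> - e / (4 * L)\<bar> < e / (4 * L)"
      using k0 by (simp add: \<kappa>_def k_def)
    then have "0 < \<kappa>" "\<kappa> < e / (2 * L)" by (auto simp: abs_if split: if_splits)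
    then show "\<kappa> > 0" "L * \<kappa> \<le> e / 2" using L(1) by (auto simp: field_simps)
  qed
  (* Q lifts a power of the same circle map as H, and its translation number is the small number \<kappa> *)
  define Q where "Q = (\<lambda>t. (H ^^ k) t - of_int h)"
  have Qit: "(Q ^^ m) t = (H ^^ (k * m)) t - real m * of_int h" for m t
  proof (induction m)
    case (Suc m)
    have "(Q ^^ Suc m) t = (H ^^ k) ((H ^^ (k * m)) t + of_int (- (int m * h))) - of_int h"
      using Suc by (simp add: Q_def)
    also have "\<dots> = (H ^^ k) ((H ^^ (k * m)) t) + of_int (- (int m * h)) - of_int h"
      by (simp only: itshift)
    finally show ?case by (simp add: funpow_add algebra_simps)
  qed simp
  have Qdisp: "\<bar>(Q ^^ m) t - t - real m * \<kappa>\<bar> \<le> 1" for m t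
    using disp[of "k * m" t] by (simp add: Qit \<kappa>_def algebra_simps)
  (* J iterates of Q move every point forward by at least 1, since J \<kappa> - 1 \<ge> 1 *)
  define J where "J = nat \<lceil>2 / \<kappa>\<rceil>"
  have J: "real J * \<kappa> \<ge> 2"
  proof -
    have "2 / \<kappa> \<le> real J" unfolding J_def by linarith
    then show ?thesis using \<kappa>(1) by (simp add: field_simps)
  qed
  define C where "C = L * (real k + real k * real J)"
  define N where "N = nat \<lceil>2 * C / e\<rceil>"
  have "\<bar>(\<Sum>i<n. \<psi> ((H ^^ i) s)) - (\<Sum>i<n. \<psi> ((H ^^ i) t))\<bar> \<le> e * real n"
    if n: "n \<ge> N" and s: "s \<in> K" and t: "t \<in> K" for n s t
  proof -
    define t' where "t' = t + of_int \<lfloor>s - t\<rfloor>"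
    have t': "t' \<in> K" "t' \<le> s" "s \<le> t' + 1"
      using K t unfolding t'_def by (auto, linarith+)
    have "(Q ^^ J) t' \<ge> s" using Qdisp[of J t'] J t'(3) by linarith
    then obtain j where j: "(Q ^^ j) t' \<ge> s" "\<And>i. i < j \<Longrightarrow> \<not> (Q ^^ i) t' \<ge> s" "j \<le> J"
      using LeastI[of "\<lambda>j. (Q ^^ j) t' \<ge> s" J] not_less_Least[of _ "\<lambda>j. (Q ^^ j) t' \<ge> s"]
        Least_le[of "\<lambda>j. (Q ^^ j) t' \<ge> s" J] by blast
    define y where "y = (Q ^^ j) t'"
    have Qs: "s \<le> Q s"
    proof (rule ccontr)
      assume "\<not> s \<le> Q s"
      have dec: "(Q ^^ m) s \<le> s" for m
      proof (induction m)
        case (Suc m)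
        then have "Q ((Q ^^ m) s) \<le> Q s" by (simp add: Q_def itmono)
        then show ?case using \<open>\<not> s \<le> Q s\<close> by simp
      qed simp
      obtain m where "1 < real m * \<kappa>" using reals_Archimedean3[OF \<kappa>(1)] by blast
      then show False using Qdisp[of m s] dec[of m] by linarith
    qed
    have y: "s \<le> y" "y \<le> Q s"
    proof -
      show "s \<le> y" unfolding y_def by (rule j)
      show "y \<le> Q s"
      proof (cases j)
        case 0
        then show ?thesis using t' Qs by (simp add: y_def)
      next
        case (Suc i)
        then have "(Q ^^ i) t' \<le> s" using j(2)[of i] by simp
        then have "Q ((Q ^^ i) t') \<le> Q s" by (simp add: Q_def itmono)
        then show ?thesis by (simp add: y_def Suc)
      qed
    qed
    have yeq: "y = (H ^^ (k * j)) t' + of_int (- (int j * h))"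
      by (simp add: y_def Qit)
    have yK: "y \<in> K" unfolding yeq by (intro K Kit t')
    have "(\<Sum>i<n. \<psi> ((H ^^ i) t)) = (\<Sum>i<n. \<psi> ((H ^^ i) t'))"
      using per Kit t by (simp add: t'_def itshift)
    moreover have "\<bar>(\<Sum>i<n. \<psi> ((H ^^ i) t')) - (\<Sum>i<n. \<psi> ((H ^^ i) y))\<bar> \<le> L * (real k * real J)"
    proof -
      have "(\<Sum>i<n. \<psi> ((H ^^ i) y)) = (\<Sum>i<n. \<psi> ((H ^^ (i + k * j)) t'))"
        by (simp only: yeq itshift per[OF Kit[OF Kit[OF t'(1)]]] funpow_add o_apply)
      then have "\<bar>(\<Sum>i<n. \<psi> ((H ^^ i) t')) - (\<Sum>i<n. \<psi> ((H ^^ i) y))\<bar>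
          = \<bar>\<Sum>i<k * j. \<psi> ((H ^^ (n + i)) t') - \<psi> ((H ^^ i) t')\<bar>"
        using sum_shift_diff[of "\<lambda>i. \<psi> ((H ^^ i) t')" "k * j" n]
        by (simp add: sum_subtractf abs_minus_commute)
      also have "\<dots> \<le> (\<Sum>i<k * j. \<bar>\<psi> ((H ^^ (n + i)) t') - \<psi> ((H ^^ i) t')\<bar>)"
        by (rule sum_abs)
      also have "\<dots> \<le> (\<Sum>i<k * j. L)"
        by (intro sum_mono osc Kit t')
      also have "\<dots> = L * (real k * real j)" by simp
      also have "\<dots> \<le> L * (real k * real J)"
        using L(1) j(3) by (intro mult_left_mono) auto
      finally show ?thesis .
    qed
    moreover have "\<bar>(\<Sum>i<n. \<psi> ((H ^^ i) s)) - (\<Sum>i<n. \<psi> ((H ^^ i) y))\<bar> \<le> L * (real n * \<kappa> + real k)"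
    proof -
      have "\<bar>(\<Sum>i<n. \<psi> ((H ^^ i) s)) - (\<Sum>i<n. \<psi> ((H ^^ i) y))\<bar>
          \<le> (\<Sum>i<n. \<bar>\<psi> ((H ^^ i) s) - \<psi> ((H ^^ i) y)\<bar>)"
        by (simp add: sum_abs sum_subtractf[symmetric])
      also have "\<dots> \<le> (\<Sum>i<n. L * ((H ^^ (i + k)) s - (H ^^ i) s - of_int h))"
      proof (rule sum_mono)
        fix i
        have 1: "(H ^^ i) s \<le> (H ^^ i) y" using y by (simp add: itmono)
        have "(H ^^ i) y \<le> (H ^^ i) ((H ^^ k) s + of_int (- h))"
          using y by (simp add: itmono Q_def)
        also have "\<dots> = (H ^^ (i + k)) s - of_int h"
          by (simp only: itshift funpow_add) simp
        finally have 2: "(H ^^ i) y \<le> (H ^^ (i + k)) s - of_int h" .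
        have "\<bar>\<psi> ((H ^^ i) s) - \<psi> ((H ^^ i) y)\<bar> \<le> L * \<bar>(H ^^ i) s - (H ^^ i) y\<bar>"
          by (intro L Kit s yK)
        also have "\<dots> \<le> L * ((H ^^ (i + k)) s - (H ^^ i) s - of_int h)"
          using 1 2 L(1) by (intro mult_left_mono) auto
        finally show "\<bar>\<psi> ((H ^^ i) s) - \<psi> ((H ^^ i) y)\<bar>
            \<le> L * ((H ^^ (i + k)) s - (H ^^ i) s - of_int h)" .
      qed
      also have "\<dots> = L * ((\<Sum>i<n. (H ^^ (i + k)) s - (H ^^ i) s) - real n * of_int h)"
        by (simp add: sum_distrib_left[symmetric] sum_subtractf)
      also have "(\<Sum>i<n. (H ^^ (i + k)) s - (H ^^ i) s) = (\<Sum>j<k. (H ^^ (n + j)) s - (H ^^ j) s)"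
        by (rule sum_shift_diff)
      also have "\<dots> \<le> (\<Sum>j<k. real n * \<rho> + 1)"
      proof (rule sum_mono)
        fix j
        show "(H ^^ (n + j)) s - (H ^^ j) s \<le> real n * \<rho> + 1"
          using disp[of n "(H ^^ j) s"] by (simp add: funpow_add)
      qed
      finally have "\<bar>(\<Sum>i<n. \<psi> ((H ^^ i) s)) - (\<Sum>i<n. \<psi> ((H ^^ i) y))\<bar>
          \<le> L * ((\<Sum>j<k. real n * \<rho> + 1) - real n * of_int h)"
        using L(1) by simp
      then show ?thesis by (simp add: \<kappa>_def algebra_simps)
    qed
    ultimately have "\<bar>(\<Sum>i<n. \<psi> ((H ^^ i) s)) - (\<Sum>i<n. \<psi> ((H ^^ i) t))\<bar>
        \<le> real n * (L * \<kappa>) + C"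
      by (simp add: C_def algebra_simps)
    also have "\<dots> \<le> real n * (e / 2) + e / 2 * real n"
    proof (intro add_mono mult_left_mono \<kappa>)
      have "2 * C / e \<le> real n" using n unfolding N_def by linarith
      then show "C \<le> e / 2 * real n" using e by (simp add: field_simps)
    qed auto
    finally show ?thesis by simp
  qed
  then show ?thesis by blast
qed

end

section \<open>Ordered invariant sets of twist maps\<close>

lemma choice_pair: "\<forall>n. \<exists>x y. Q n x y \<Longrightarrow> \<exists>xs ys. \<forall>n. Q n (xs n) (ys n)"
  by metis

text \<open>The derivative of a lift is periodic in the angle, hence bounded on horizontal strips, and these are convex.\<close>

lemma lift_lipschitz_on_strip:
  assumes F: "C1_lift F F' f"
  obtains K where "K > 0"
    "\<And>z w. \<bar>snd z\<bar> \<le> B \<Longrightarrow> \<bar>snd w\<bar> \<le> B \<Longrightarrow> norm (F z - F w) \<le> K * norm (z - w)"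
proof -
  have per: "F' (z + (of_int k, 0)) = F' z" for z k
    by (rule blinfun_eqI) (metis tangent_map_eq[OF F] to_annulus_shift)
  have "compact (F' ` ({0..1} \<times> {-B..B}))"
    by (intro compact_continuous_image compact_Times compact_Icc continuous_on_subset[OF C1_liftD(4)[OF F]]) auto
  then obtain K where K: "K > 0" "\<And>z. z \<in> {0..1} \<times> {-B..B} \<Longrightarrow> norm (F' z) \<le> K"
    by (metis bounded_pos compact_imp_bounded imageI)
  have bound: "norm (F' z) \<le> K" if "\<bar>snd z\<bar> \<le> B" for z
  proof -
    have "z + (of_int (- \<lfloor>fst z\<rfloor>), 0) \<in> {0..1} \<times> {-B..B}"
      using that by (cases z) (auto, linarith+)
    then show ?thesis using K(2) per by metis
  qed
  have "norm (F z - F w) \<le> K * norm (z - w)" if zw: "\<bar>snd z\<bar> \<le> B" "\<bar>snd w\<bar> \<le> B" for z w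
  proof (rule differentiable_bound[of "UNIV \<times> {-B..B}"])
    show "convex ((UNIV :: real set) \<times> {-B..B})" by (intro convex_Times convex_UNIV convex_real_interval)
    show "(F has_derivative blinfun_apply (F' x)) (at x within UNIV \<times> {-B..B})" for x
      using C1_liftD(3)[OF F] has_derivative_at_withinI by blast
    show "onorm (blinfun_apply (F' x)) \<le> K" if "x \<in> UNIV \<times> {-B..B}" for x
      using bound[of x] that by (auto simp: norm_blinfun.rep_eq[symmetric] mem_Times_iff)
  qed (use zw in \<open>auto simp: mem_Times_iff\<close>)
  with K(1) show thesis using that by blast
qed

text \<open>A minimal ordered set \<open>M\<close> of an area preserving twist map \<open>f\<close> with inverse \<open>g\<close>, seen through lifts \<open>F\<close> and \<open>G\<close>
  that are inverse to each other. The number \<open>\<sigma>\<close> is the sign of the twist, so that positive and negative twist maps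
  are treated together.\<close>

locale ordered_twist =
  fixes f g :: "annulus \<Rightarrow> annulus" and F G :: "real \<times> real \<Rightarrow> real \<times> real"
    and F' G' :: "real \<times> real \<Rightarrow> (real \<times> real) \<Rightarrow>\<^sub>L (real \<times> real)"
    and M :: "annulus set" and \<sigma> :: real
  assumes liftF: "C1_lift F F' f" and liftG: "C1_lift G G' g"
    and GF [simp]: "G (F z) = z" and FG [simp]: "F (G z) = z"
    and shiftF: "F (z + (of_int k, 0)) = F z + (of_int k, 0)"
    and det: "fst (tangent_map f x (1, 0)) * snd (tangent_map f x (0, 1))
       - fst (tangent_map f x (0, 1)) * snd (tangent_map f x (1, 0)) = 1"
    and sigma: "\<bar>\<sigma>\<bar> = 1" and twist: "\<sigma> * fst (tangent_map f x (0, 1)) > 0"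
    and inj_fibre: "fst z = fst w \<Longrightarrow> fst (F z) = fst (F w) \<Longrightarrow> z = w"
    and compactM: "compact M" and nonemptyM: "M \<noteq> {}" and fM: "f ` M = M"
    and orderF: "to_annulus z \<in> M \<Longrightarrow> to_annulus w \<in> M \<Longrightarrow> fst z < fst w \<longleftrightarrow> fst (F z) < fst (F w)"
    and minimalM: "N \<subseteq> M \<Longrightarrow> closed N \<Longrightarrow> N \<noteq> {} \<Longrightarrow> f ` N = N \<Longrightarrow> N = M"
begin

lemma C1f: "C1_map f" and C1g: "C1_map g"
  using liftF liftG C1_map_iff by blast+

lemma gf [simp]: "g (f x) = x"
proof -
  obtain z where z: "x = to_annulus z" using to_annulus_surj by blast
  show ?thesis
    using C1_liftD(2)[OF liftF, of z] C1_liftD(2)[OF liftG, of "F z"] by (simp add: z)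
qed

lemma fg [simp]: "f (g x) = x"
proof -
  obtain z where z: "x = to_annulus z" using to_annulus_surj by blast
  show ?thesis
    using C1_liftD(2)[OF liftG, of z] C1_liftD(2)[OF liftF, of "G z"] by (simp add: z)
qed

lemma fM_iff [simp]: "f x \<in> M \<longleftrightarrow> x \<in> M"
  using fM by (metis gf image_iff)

lemma gM_iff [simp]: "g x \<in> M \<longleftrightarrow> x \<in> M"
  by (metis fM_iff fg)

lemma gM: "g ` M = M"
proof -
  have "g ` (f ` M) = M" by (simp add: image_image)
  then show ?thesis by (simp add: fM)
qed

lemma closedM: "closed M"
  using compactM compact_imp_closed by blast

lemma FM_iff [simp]: "to_annulus (F z) \<in> M \<longleftrightarrow> to_annulus z \<in> M"
  by (simp add: C1_liftD(2)[OF liftF])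

lemma GM_iff [simp]: "to_annulus (G z) \<in> M \<longleftrightarrow> to_annulus z \<in> M"
  by (simp add: C1_liftD(2)[OF liftG])

lemma graph: "to_annulus z \<in> M \<Longrightarrow> to_annulus w \<in> M \<Longrightarrow> fst z = fst w \<Longrightarrow> z = w"
  using orderF[of z w] orderF[of w z] inj_fibre[of z w] by linarith

lemma inj_on_fst: "inj_on fst M"
proof (rule inj_onI)
  fix x y assume xy: "x \<in> M" "y \<in> M" "fst x = fst y"
  obtain z w where zw: "x = to_annulus z" "y = to_annulus w" using to_annulus_surj by metis
  obtain k where "fst z - fst w = of_int k"
    using xy(3) by (auto simp: zw to_annulus_def to_circle_eq_iff elim: Ints_cases)
  then have "z = w + (of_int k, 0)"
    using xy by (intro graph) (simp_all add: zw)
  then show "x = y" by (simp add: zw)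
qed

abbreviation Df where "Df x \<equiv> tangent_map f x"
abbreviation Dg where "Dg x \<equiv> tangent_map g x"

text \<open>The entries of the Jacobian matrix, with \<open>b\<close> the entry that carries the twist.\<close>

definition a where "a x = fst (Df x (1, 0))"
definition b where "b x = fst (Df x (0, 1))"
definition c where "c x = snd (Df x (1, 0))"
definition d where "d x = snd (Df x (0, 1))"

lemma Df_eq: "Df x v = (a x * fst v + b x * snd v, c x * fst v + d x * snd v)"
proof -
  have "v = fst v *\<^sub>R (1, 0) + snd v *\<^sub>R (0, 1)" by (simp add: prod_eq_iff)
  then have "Df x v = Df x (fst v *\<^sub>R (1, 0) + snd v *\<^sub>R (0, 1))" by simp
  also have "\<dots> = fst v *\<^sub>R Df x (1, 0) + snd v *\<^sub>R Df x (0, 1)"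
    using linear_tangent_map[OF C1f, of x] by (simp only: linear_add linear_scale)
  finally have "Df x v = fst v *\<^sub>R Df x (1, 0) + snd v *\<^sub>R Df x (0, 1)" .
  then show ?thesis by (simp add: a_def b_def c_def d_def prod_eq_iff algebra_simps)
qed

lemma det1: "a x * d x - b x * c x = 1"
  using det[of x] by (simp add: a_def b_def c_def d_def)

lemma b_sign: "\<sigma> * b x > 0"
  using twist by (simp add: b_def)

lemma continuous_coeffs: "continuous_on UNIV a" "continuous_on UNIV b"
  "continuous_on UNIV c" "continuous_on UNIV d"
  using continuous_on_tangent_map[OF C1f] unfolding a_def b_def c_def d_def
  by (auto intro!: continuous_intros)

lemma continuous_f: "continuous_on S f" and continuous_g: "continuous_on S g"
  using continuous_on_C1_map[OF C1f] continuous_on_C1_map[OF C1g] continuous_on_subset by blast+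

lemma tendsto_f: "xs \<longlonglongrightarrow> x \<Longrightarrow> (\<lambda>n. f (xs n)) \<longlonglongrightarrow> f x"
  using continuous_on_tendsto_compose[OF continuous_f[of UNIV]] by simp

lemma tendsto_g: "xs \<longlonglongrightarrow> x \<Longrightarrow> (\<lambda>n. g (xs n)) \<longlonglongrightarrow> g x"
  using continuous_on_tendsto_compose[OF continuous_g[of UNIV]] by simp

lemma Dg_Df: "Dg (f x) (Df x v) = v"
proof -
  have "tangent_map (g \<circ> f) x v = Dg (f x) (Df x v)"
    by (rule tangent_map_compose[OF C1g C1f])
  moreover have "g \<circ> f = (\<lambda>x. x)" by (simp add: fun_eq_iff)
  ultimately show ?thesis by (simp add: tangent_map_id)
qed

lemma Df_Dg: "Df (g x) (Dg x v) = v"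
proof -
  have "tangent_map (f \<circ> g) x v = Df (g x) (Dg x v)"
    by (rule tangent_map_compose[OF C1f C1g])
  moreover have "f \<circ> g = (\<lambda>x. x)" by (simp add: fun_eq_iff)
  ultimately show ?thesis by (simp add: tangent_map_id)
qed

lemma fst_Dg: "fst (Dg x v) = d (g x) * fst v - b (g x) * snd v"
proof -
  obtain p q where pq: "Dg x v = (p, q)" by fastforce
  have v: "v = (a (g x) * p + b (g x) * q, c (g x) * p + d (g x) * q)"
    using Df_Dg[of x v] by (simp add: pq Df_eq)
  have "d (g x) * fst v - b (g x) * snd v = (a (g x) * d (g x) - b (g x) * c (g x)) * p"
    by (simp add: v algebra_simps)
  then show ?thesis by (simp add: pq det1)
qed

abbreviation P where "P \<equiv> paratingent_cone M"

lemma P_f: "v \<in> P x \<Longrightarrow> Df x v \<in> P (f x)"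
  using paratingent_cone_image[OF C1f, of M M] fM by blast

lemma P_g: "v \<in> P x \<Longrightarrow> Dg x v \<in> P (g x)"
  using paratingent_cone_image[OF C1g, of M M] gM by blast

lemma eventually_order:
  assumes "\<And>n. xs n \<in> M" "\<And>n. ys n \<in> M" "xs \<longlonglongrightarrow> x" "ys \<longlonglongrightarrow> x"
  shows "\<forall>\<^sub>F n in sequentially. 0 < fst (annulus_diff (xs n) (ys n)) \<longleftrightarrow>
    0 < fst (annulus_diff (f (xs n)) (f (ys n)))"
proof -
  obtain z where z: "x = to_annulus z" using to_annulus_surj by blast
  obtain zs where zs: "\<And>n. to_annulus (zs n) = xs n" "zs \<longlonglongrightarrow> z"
    using tendsto_lift assms(3) z by metis
  obtain ws where ws: "\<And>n. to_annulus (ws n) = ys n" "ws \<longlonglongrightarrow> z"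
    using tendsto_lift assms(4) z by metis
  have F: "(\<lambda>n. F (zs n)) \<longlonglongrightarrow> F z" "(\<lambda>n. F (ws n)) \<longlonglongrightarrow> F z"
    using continuous_on_tendsto_compose[OF C1_liftD(1)[OF liftF] zs(2)]
      continuous_on_tendsto_compose[OF C1_liftD(1)[OF liftF] ws(2)] by simp_all
  have zsM: "to_annulus (zs n) \<in> M" "to_annulus (ws n) \<in> M" for n
    using assms zs ws by simp_all
  from eventually_annulus_diff_lift[OF zs(2) ws(2)] eventually_annulus_diff_lift[OF F]
  show ?thesis
  proof eventually_elim
    case (elim n)
    have "annulus_diff (xs n) (ys n) = zs n - ws n"
      using elim(1) zs(1) ws(1) by simp
    moreover have "annulus_diff (f (xs n)) (f (ys n)) = F (zs n) - F (ws n)"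
      using elim(2) zs(1) ws(1) C1_liftD(2)[OF liftF] by metis
    ultimately show ?case using orderF[OF zsM(2,1), of n n] by simp
  qed
qed

text \<open>The twist condition tilts a vertical vector to one side under \<open>f\<close> and to the other side under the
  inverse of \<open>f\<close>. Points of \<open>M\<close> separated almost vertically would therefore change their order.\<close>

lemma vertical_not_in_P:
  assumes v: "v \<in> P x" and "fst v = 0" shows "v = 0"
proof (rule ccontr)
  have impossible: False if u: "u \<in> P x" "fst u = 0" and s: "\<sigma> * snd u > 0" for u
  proof -
    obtain xs ys :: "nat \<Rightarrow> annulus" and t :: "nat \<Rightarrow> real"
      where xy: "\<forall>n. xs n \<in> M" "\<forall>n. ys n \<in> M" "\<forall>n. t n > 0" "xs \<longlonglongrightarrow> x" "ys \<longlonglongrightarrow> x" "t \<longlonglongrightarrow> 0"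
        "(\<lambda>n. annulus_diff (xs n) (ys n) /\<^sub>R t n) \<longlonglongrightarrow> u"
      using u(1) by (rule paratingent_coneE)
    have pos: "b y * snd u > 0" for y
    proof -
      have "(\<sigma> * b y) * (\<sigma> * snd u) > 0" using b_sign s by simp
      moreover have "\<sigma> * \<sigma> = 1" using sigma by (metis abs_mult_self_eq mult_1)
      ultimately show ?thesis by (metis mult.assoc mult.commute mult_1)
    qed
    have "(\<lambda>n. fst (annulus_diff (f (xs n)) (f (ys n)) /\<^sub>R t n)) \<longlonglongrightarrow> fst (Df x u)"
      by (intro tendsto_intros difference_quotient_annulus[OF C1f xy(4,5,7)])
    then have "\<forall>\<^sub>F n in sequentially. 0 < fst (annulus_diff (f (xs n)) (f (ys n)) /\<^sub>R t n)"
      by (rule order_tendstoD) (use pos u in \<open>simp add: Df_eq\<close>)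
    moreover have "(\<lambda>n. fst (annulus_diff (g (xs n)) (g (ys n)) /\<^sub>R t n)) \<longlonglongrightarrow> fst (Dg x u)"
      by (intro tendsto_intros difference_quotient_annulus[OF C1g xy(4,5,7)])
    then have "\<forall>\<^sub>F n in sequentially. fst (annulus_diff (g (xs n)) (g (ys n)) /\<^sub>R t n) < 0"
      by (rule order_tendstoD) (use pos u in \<open>simp add: fst_Dg\<close>)
    moreover note eventually_order[OF xy(1,2)[rule_format] xy(4,5)]
    moreover have "\<forall>\<^sub>F n in sequentially. 0 < fst (annulus_diff (g (xs n)) (g (ys n))) \<longleftrightarrow>
        0 < fst (annulus_diff (f (g (xs n))) (f (g (ys n))))"
      by (rule eventually_order[OF _ _ tendsto_g[OF xy(4)] tendsto_g[OF xy(5)]]) (use xy in simp_all)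
    ultimately have "\<forall>\<^sub>F n in sequentially. False"
    proof eventually_elim
      case (elim n)
      then show False using xy(3)[rule_format, of n]
        by (simp add: zero_less_mult_iff mult_less_0_iff)
    qed
    then show False by simp
  qed
  assume "v \<noteq> 0"
  then have s: "snd v \<noteq> 0" using assms(2) by (simp add: prod_eq_iff)
  have "\<sigma> * snd v > 0 \<or> \<sigma> * snd (- v) > 0"
    using s sigma by (auto simp: zero_less_mult_iff mult_less_0_iff)
  moreover have "- v \<in> P x" using paratingent_cone_scaleR[OF v, of "-1"] by simp
  ultimately show False using impossible v assms(2) by (metis fst_uminus neg_0_equal_iff_equal)
qed

text \<open>The unit vectors of the cones over \<open>M\<close> form a compact set that avoids the vertical direction.\<close>

lemma P_lipschitz:
  obtains C where "C > 0" "\<And>x v. v \<in> P x \<Longrightarrow> \<bar>snd v\<bar> \<le> C * \<bar>fst v\<bar>"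
proof -
  have "\<exists>C>0. \<forall>x v. v \<in> P x \<longrightarrow> \<bar>snd v\<bar> \<le> C * \<bar>fst v\<bar>"
  proof (rule ccontr)
    assume neg: "\<not> ?thesis"
    let ?Q = "\<lambda>n x v. v \<in> P x \<and> norm v = 1 \<and> real (Suc n) * \<bar>fst v\<bar> < \<bar>snd v\<bar>"
    have "\<exists>x v. ?Q n x v" for n
    proof -
      obtain x v where xv: "v \<in> P x" "real (Suc n) * \<bar>fst v\<bar> < \<bar>snd v\<bar>"
        using neg by (metis not_less of_nat_0_less_iff zero_less_Suc)
      then have "v \<noteq> 0" by auto
      define u where "u = (1 / norm v) *\<^sub>R v"
      have "norm u = 1" using \<open>v \<noteq> 0\<close> by (simp add: u_def)
      moreover have "u \<in> P x" unfolding u_def by (intro paratingent_cone_scaleR xv)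
      moreover have "real (Suc n) * \<bar>fst u\<bar> < \<bar>snd u\<bar>"
        using xv(2) \<open>v \<noteq> 0\<close> by (simp add: u_def divide_strict_right_mono)
      ultimately show ?thesis by blast
    qed
    then have "\<forall>n. \<exists>x v. ?Q n x v" by blast
    from choice_pair[OF this] obtain xs vs where "\<forall>n. ?Q n (xs n) (vs n)" by blast
    then have xv: "\<And>n. vs n \<in> P (xs n)" "\<And>n. norm (vs n) = 1"
      "\<And>n. real (Suc n) * \<bar>fst (vs n)\<bar> < \<bar>snd (vs n)\<bar>"
      by simp_all
    have xM: "xs n \<in> M" for n using paratingent_cone_in_closure[OF xv(1) closedM] .
    have "compact (M \<times> sphere (0 :: real \<times> real) 1)" by (intro compact_Times compactM compact_sphere)
    moreover have "\<forall>n. (xs n, vs n) \<in> M \<times> sphere 0 1" using xM xv(2) by simp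
    ultimately obtain l r where l: "l \<in> M \<times> sphere 0 1" "strict_mono r" "((\<lambda>n. (xs n, vs n)) \<circ> r) \<longlonglongrightarrow> l"
      by (rule seq_compactE[OF compact_imp_seq_compact])
    have lim: "(\<lambda>n. xs (r n)) \<longlonglongrightarrow> fst l" "(\<lambda>n. vs (r n)) \<longlonglongrightarrow> snd l"
      using tendsto_fst[OF l(3)] tendsto_snd[OF l(3)] by (simp_all add: o_def)
    have "snd l \<in> P (fst l)"
      by (rule paratingent_cone_closed_graph[OF lim]) (rule xv)
    moreover have "fst (snd l) = 0"
    proof -
      have "(\<lambda>n. \<bar>fst (vs (r n))\<bar>) \<longlonglongrightarrow> 0"
      proof (rule tendsto_sandwich[OF _ _ tendsto_const LIMSEQ_inverse_real_of_nat])
        have "\<bar>fst (vs (r n))\<bar> \<le> inverse (real (Suc n))" for n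
        proof -
          have "real (Suc n) * \<bar>fst (vs (r n))\<bar> \<le> real (Suc (r n)) * \<bar>fst (vs (r n))\<bar>"
            using seq_suble[OF l(2), of n] by (intro mult_right_mono) auto
          also have "\<dots> \<le> 1"
            using xv(3)[of "r n"] abs_snd_le_norm[of "vs (r n)"] xv(2)[of "r n"] by linarith
          finally show ?thesis by (simp add: field_simps)
        qed
        then show "\<forall>\<^sub>F n in sequentially. \<bar>fst (vs (r n))\<bar> \<le> inverse (real (Suc n))"
          by (intro always_eventually) blast
      qed auto
      moreover have "(\<lambda>n. \<bar>fst (vs (r n))\<bar>) \<longlonglongrightarrow> \<bar>fst (snd l)\<bar>"
        by (intro tendsto_intros lim)
      ultimately show ?thesis using LIMSEQ_unique by fastforce
    qed
    ultimately have "snd l = 0" using vertical_not_in_P by blast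
    then show False using l(1) by (auto simp: mem_Times_iff)
  qed
  then show thesis using that by blast
qed

text \<open>Nearby points keep their order, which gives the weak inequality. Equality would put a vertical vector into
  the cone at the image point.\<close>

lemma fst_Df_pos:
  assumes v: "v \<in> P x" and pos: "fst v > 0" shows "fst (Df x v) > 0"
proof -
  obtain xs ys :: "nat \<Rightarrow> annulus" and t :: "nat \<Rightarrow> real"
    where xy: "\<forall>n. xs n \<in> M" "\<forall>n. ys n \<in> M" "\<forall>n. t n > 0" "xs \<longlonglongrightarrow> x" "ys \<longlonglongrightarrow> x" "t \<longlonglongrightarrow> 0"
      "(\<lambda>n. annulus_diff (xs n) (ys n) /\<^sub>R t n) \<longlonglongrightarrow> v"
    using v by (rule paratingent_coneE)
  have "(\<lambda>n. fst (annulus_diff (xs n) (ys n) /\<^sub>R t n)) \<longlonglongrightarrow> fst v"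
    by (intro tendsto_intros xy)
  then have "\<forall>\<^sub>F n in sequentially. 0 < fst (annulus_diff (xs n) (ys n) /\<^sub>R t n)"
    by (rule order_tendstoD) (rule pos)
  then have "\<forall>\<^sub>F n in sequentially. 0 \<le> fst (annulus_diff (f (xs n)) (f (ys n)) /\<^sub>R t n)"
    using eventually_order[OF xy(1,2)[rule_format] xy(4,5)]
  proof eventually_elim
    case (elim n)
    then show ?case using xy(3)[rule_format, of n] by (simp add: zero_less_mult_iff)
  qed
  moreover have "(\<lambda>n. fst (annulus_diff (f (xs n)) (f (ys n)) /\<^sub>R t n)) \<longlonglongrightarrow> fst (Df x v)"
    by (intro tendsto_intros difference_quotient_annulus[OF C1f xy(4,5,7)])
  ultimately have "0 \<le> fst (Df x v)"
    by (intro tendsto_lowerbound[OF _ _ sequentially_bot])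
  moreover have "fst (Df x v) \<noteq> 0"
  proof
    assume "fst (Df x v) = 0"
    then have "Df x v = 0" using vertical_not_in_P P_f[OF v] by blast
    then have "Dg (f x) 0 = v" using Dg_Df by metis
    then have "v = 0" using linear_0[OF linear_tangent_map[OF C1g]] by metis
    then show False using pos by simp
  qed
  ultimately show ?thesis by simp
qed

lemma fst_Dg_pos:
  assumes v: "v \<in> P x" and pos: "fst v > 0" shows "fst (Dg x v) > 0"
proof (rule ccontr)
  assume "\<not> ?thesis"
  then consider "fst (Dg x v) = 0" | "fst (- Dg x v) > 0" by fastforce
  then show False
  proof cases
    case 1
    then have "Dg x v = 0" using vertical_not_in_P P_g[OF v] by blast
    then have "v = 0" using Df_Dg[of x v] linear_0[OF linear_tangent_map[OF C1f]] by metis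
    then show False using pos by simp
  next
    case 2
    have "- Dg x v \<in> P (g x)" using paratingent_cone_scaleR[OF P_g[OF v], of "-1"] by simp
    then have "fst (Df (g x) (- Dg x v)) > 0" using 2 by (rule fst_Df_pos)
    then have "fst (- v) > 0"
      using linear_neg[OF linear_tangent_map[OF C1f]] Df_Dg by metis
    then show False using pos by simp
  qed
qed

lemma snd_bounded:
  obtains B where "\<And>z. to_annulus z \<in> M \<Longrightarrow> \<bar>snd z\<bar> \<le> B"
proof -
  have "compact (snd ` M)"
    by (intro compact_continuous_image compactM continuous_intros)
  then obtain B where "\<And>x. x \<in> M \<Longrightarrow> \<bar>snd x\<bar> \<le> B"
    by (metis bounded_iff compact_imp_bounded imageI real_norm_def)
  then have "\<bar>snd z\<bar> \<le> B" if "to_annulus z \<in> M" for z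
    using that by (fastforce simp: to_annulus_def)
  then show thesis using that by blast
qed

text \<open>Distinct points of \<open>M\<close> with asymptotically equal projections are asymptotically equal, by compactness and
  the graph property, and so they determine a unit vector of the cone.\<close>

lemma close_pairs_direction:
  assumes xy: "\<And>n. xs n \<in> M" "\<And>n. ys n \<in> M" "\<And>n. xs n \<noteq> ys n"
    and close: "\<And>n. dist (fst (xs n)) (fst (ys n)) \<le> K * inverse (real (Suc n))"
  obtains r :: "nat \<Rightarrow> nat" and z v where "strict_mono r" "(\<lambda>n. xs (r n)) \<longlonglongrightarrow> z" "(\<lambda>n. ys (r n)) \<longlonglongrightarrow> z"
    "norm v = 1" "v \<in> P z"
    "(\<lambda>n. annulus_diff (xs (r n)) (ys (r n)) /\<^sub>R dist (xs (r n)) (ys (r n))) \<longlonglongrightarrow> v"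
proof -
  have "\<forall>n. (xs n, ys n) \<in> M \<times> M" using xy by simp
  then obtain l s where l: "l \<in> M \<times> M" "strict_mono s" "((\<lambda>n. (xs n, ys n)) \<circ> s) \<longlonglongrightarrow> l"
    by (rule seq_compactE[OF compact_imp_seq_compact[OF compact_Times[OF compactM compactM]]])
  have lim: "(\<lambda>n. xs (s n)) \<longlonglongrightarrow> fst l" "(\<lambda>n. ys (s n)) \<longlonglongrightarrow> snd l"
    using tendsto_fst[OF l(3)] tendsto_snd[OF l(3)] by (simp_all add: o_def)
  have "(\<lambda>n. dist (fst (xs n)) (fst (ys n))) \<longlonglongrightarrow> 0"
  proof (rule tendsto_sandwich[OF _ _ tendsto_const])
    show "(\<lambda>n. K * inverse (real (Suc n))) \<longlonglongrightarrow> 0"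
      using tendsto_mult[OF tendsto_const LIMSEQ_inverse_real_of_nat, of K] by simp
  qed (use close in \<open>auto intro: always_eventually\<close>)
  then have "(\<lambda>n. dist (fst (xs (s n))) (fst (ys (s n)))) \<longlonglongrightarrow> 0"
    using LIMSEQ_subseq_LIMSEQ[OF _ l(2)] by (fastforce simp: o_def)
  moreover have "(\<lambda>n. dist (fst (xs (s n))) (fst (ys (s n)))) \<longlonglongrightarrow> dist (fst (fst l)) (fst (snd l))"
    by (intro tendsto_intros lim)
  ultimately have "fst (fst l) = fst (snd l)" using LIMSEQ_unique by fastforce
  then have eq: "snd l = fst l"
    using inj_on_fst l(1) by (auto simp: mem_Times_iff inj_on_def)
  obtain t :: "nat \<Rightarrow> nat" and v where v: "strict_mono t" "norm v = 1" "v \<in> P (fst l)"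
    "(\<lambda>n. annulus_diff (xs (s (t n))) (ys (s (t n))) /\<^sub>R dist (xs (s (t n))) (ys (s (t n)))) \<longlonglongrightarrow> v"
  proof (rule paratingent_cone_limit_direction[of "\<lambda>n. xs (s n)" M "\<lambda>n. ys (s n)" "fst l"])
    show "(\<lambda>n. ys (s n)) \<longlonglongrightarrow> fst l" using lim(2) eq by simp
  qed (use xy lim in simp_all)
  show thesis
  proof (rule that[of "\<lambda>n. s (t n)"])
    show "strict_mono (\<lambda>n. s (t n))" using l(2) v(1) by (simp add: strict_mono_def)
    show "(\<lambda>n. xs (s (t n))) \<longlonglongrightarrow> fst l" "(\<lambda>n. ys (s (t n))) \<longlonglongrightarrow> fst l"
      using LIMSEQ_subseq_LIMSEQ[OF lim(1) v(1)] LIMSEQ_subseq_LIMSEQ[OF lim(2) v(1)] eq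
      by (simp_all add: o_def)
  qed (use v in simp_all)
qed

text \<open>The absence of vertical directions in the cone makes the set a Lipschitz graph, first locally and
  then, the height of the set being bounded, globally on the lift.\<close>

lemma lipschitz_graph:
  obtains L where "L > 0" "\<And>z w. to_annulus z \<in> M \<Longrightarrow> to_annulus w \<in> M \<Longrightarrow>
    \<bar>snd z - snd w\<bar> \<le> L * \<bar>fst z - fst w\<bar>"
proof -
  obtain B where B: "\<And>z. to_annulus z \<in> M \<Longrightarrow> \<bar>snd z\<bar> \<le> B" by (rule snd_bounded) blast
  have "\<exists>L>0. \<forall>z w. to_annulus z \<in> M \<longrightarrow> to_annulus w \<in> M \<longrightarrow> \<bar>snd z - snd w\<bar> \<le> L * \<bar>fst z - fst w\<bar>"
  proof (rule ccontr)
    assume neg: "\<not> ?thesis"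
    have "\<forall>n. \<exists>z w. to_annulus z \<in> M \<and> to_annulus w \<in> M \<and> real (Suc n) * \<bar>fst z - fst w\<bar> < \<bar>snd z - snd w\<bar>"
      using neg by (metis not_less of_nat_0_less_iff zero_less_Suc)
    from choice_pair[OF this] obtain zs ws where
      "\<forall>n. to_annulus (zs n) \<in> M \<and> to_annulus (ws n) \<in> M \<and>
        real (Suc n) * \<bar>fst (zs n) - fst (ws n)\<bar> < \<bar>snd (zs n) - snd (ws n)\<bar>" by blast
    then have zw: "\<And>n. to_annulus (zs n) \<in> M" "\<And>n. to_annulus (ws n) \<in> M"
      "\<And>n. real (Suc n) * \<bar>fst (zs n) - fst (ws n)\<bar> < \<bar>snd (zs n) - snd (ws n)\<bar>"
      by simp_all
    have d0: "\<bar>fst (zs n) - fst (ws n)\<bar> \<le> 2 * B * inverse (real (Suc n))" for n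
    proof -
      have "real (Suc n) * \<bar>fst (zs n) - fst (ws n)\<bar> \<le> 2 * B"
        using zw(3)[of n] B[OF zw(1)[of n]] B[OF zw(2)[of n]] by linarith
      then show ?thesis by (simp add: field_simps)
    qed
    define xs where "xs = (\<lambda>n. to_annulus (zs n))"
    define ys where "ys = (\<lambda>n. to_annulus (ws n))"
    have ne: "xs n \<noteq> ys n" for n
    proof
      assume "xs n = ys n"
      then have "snd (zs n) = snd (ws n)" by (simp add: xs_def ys_def to_annulus_def)
      then show False using zw(3)[of n] by simp (metis abs_ge_zero mult_nonneg_nonneg not_less of_nat_0_le_iff of_nat_Suc)
    qed
    have close: "dist (fst (xs n)) (fst (ys n)) \<le> 2 * B * inverse (real (Suc n))" for n
      using d0[of n] dist_to_circle_le[of "fst (zs n)" "fst (ws n)"]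
      by (simp add: xs_def ys_def to_annulus_def)
    have xyM: "xs n \<in> M" "ys n \<in> M" for n using zw by (simp_all add: xs_def ys_def)
    obtain r :: "nat \<Rightarrow> nat" and z v where r: "strict_mono r" "norm v = 1" "v \<in> P z"
      "(\<lambda>n. annulus_diff (xs (r n)) (ys (r n)) /\<^sub>R dist (xs (r n)) (ys (r n))) \<longlonglongrightarrow> v"
      by (rule close_pairs_direction[OF xyM ne close]) blast
    define u where "u = (\<lambda>n. annulus_diff (xs (r n)) (ys (r n)) /\<^sub>R dist (xs (r n)) (ys (r n)))"
    have "(\<lambda>n. 2 * B * inverse (real (Suc n))) \<longlonglongrightarrow> 0"
      using tendsto_mult[OF tendsto_const LIMSEQ_inverse_real_of_nat, of "2 * B"] by simp
    from LIMSEQ_subseq_LIMSEQ[OF this r(1)]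
    have "(\<lambda>n. 2 * B * inverse (real (Suc (r n)))) \<longlonglongrightarrow> 0" by (simp only: o_def)
    then have "\<forall>\<^sub>F n in sequentially. 2 * B * inverse (real (Suc (r n))) < 1/2"
      by (rule order_tendstoD) simp
    then have "\<forall>\<^sub>F n in sequentially. \<bar>fst (u n)\<bar> \<le> inverse (real (Suc n))"
    proof eventually_elim
      case (elim n)
      let ?m = "r n"
      have df: "annulus_diff (xs ?m) (ys ?m) = zs ?m - ws ?m"
        using annulus_diff_to_annulus[of "zs ?m" "ws ?m"] d0[of ?m] elim by (simp add: xs_def ys_def)
      have "real (Suc n) * \<bar>fst (zs ?m - ws ?m)\<bar> \<le> real (Suc ?m) * \<bar>fst (zs ?m - ws ?m)\<bar>"
        using seq_suble[OF r(1), of n] by (intro mult_right_mono) auto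
      also have "\<dots> \<le> \<bar>snd (zs ?m - ws ?m)\<bar>" using zw(3)[of ?m] by simp
      also have "\<dots> \<le> dist (xs ?m) (ys ?m)"
        using abs_snd_le_norm[of "zs ?m - ws ?m"] norm_annulus_diff[of "xs ?m" "ys ?m"] by (simp add: df)
      finally have "real (Suc n) * \<bar>fst (u n)\<bar> \<le> 1"
        using ne[of ?m] by (simp add: u_def df abs_mult divide_simps)
      then show ?case by (simp add: field_simps)
    qed
    then have "(\<lambda>n. \<bar>fst (u n)\<bar>) \<longlonglongrightarrow> 0"
      by (intro tendsto_sandwich[OF _ _ tendsto_const LIMSEQ_inverse_real_of_nat]) auto
    moreover have "(\<lambda>n. \<bar>fst (u n)\<bar>) \<longlonglongrightarrow> \<bar>fst v\<bar>"
      unfolding u_def by (intro tendsto_rabs tendsto_fst r)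
    ultimately have "fst v = 0" using LIMSEQ_unique by fastforce
    then show False using vertical_not_in_P r by fastforce
  qed
  then show thesis using that by blast
qed

lemma lipschitz_projection:
  assumes A: "C1_lift A A' p"
  obtains K where "K > 0"
    "\<And>z w. to_annulus z \<in> M \<Longrightarrow> to_annulus w \<in> M \<Longrightarrow> \<bar>fst (A z) - fst (A w)\<bar> \<le> K * \<bar>fst z - fst w\<bar>"
proof -
  obtain B where B: "\<And>z. to_annulus z \<in> M \<Longrightarrow> \<bar>snd z\<bar> \<le> B" by (rule snd_bounded) blast
  obtain L where L: "L > 0" "\<And>z w. to_annulus z \<in> M \<Longrightarrow> to_annulus w \<in> M \<Longrightarrow>
    \<bar>snd z - snd w\<bar> \<le> L * \<bar>fst z - fst w\<bar>" by (rule lipschitz_graph) blast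
  obtain K where K: "K > 0" "\<And>z w. \<bar>snd z\<bar> \<le> B \<Longrightarrow> \<bar>snd w\<bar> \<le> B \<Longrightarrow> norm (A z - A w) \<le> K * norm (z - w)"
    by (rule lift_lipschitz_on_strip[OF A]) blast
  have "\<bar>fst (A z) - fst (A w)\<bar> \<le> K * (1 + L) * \<bar>fst z - fst w\<bar>"
    if zw: "to_annulus z \<in> M" "to_annulus w \<in> M" for z w
  proof -
    have "norm (z - w) \<le> \<bar>fst (z - w)\<bar> + \<bar>snd (z - w)\<bar>"
      by (cases "z - w") (simp add: norm_Pair sqrt_sum_squares_le_sum_abs)
    then have nm: "norm (z - w) \<le> (1 + L) * \<bar>fst z - fst w\<bar>"
      using L(2)[OF zw] by (simp add: algebra_simps)
    have "\<bar>fst (A z) - fst (A w)\<bar> \<le> norm (A z - A w)" using abs_fst_le_norm[of "A z - A w"] by simp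
    also have "\<dots> \<le> K * norm (z - w)" using zw B by (intro K) auto
    also have "\<dots> \<le> K * ((1 + L) * \<bar>fst z - fst w\<bar>)" using nm K by (intro mult_left_mono) auto
    finally show ?thesis by (simp add: mult.assoc)
  qed
  moreover have "K * (1 + L) > 0" using K(1) L(1) by simp
  ultimately show thesis using that by blast
qed

lemma bilipschitz_projection:
  obtains \<beta> where "\<beta> \<ge> 1"
    "\<And>z w. to_annulus z \<in> M \<Longrightarrow> to_annulus w \<in> M \<Longrightarrow> \<bar>fst (F z) - fst (F w)\<bar> \<le> \<beta> * \<bar>fst z - fst w\<bar>"
    "\<And>z w. to_annulus z \<in> M \<Longrightarrow> to_annulus w \<in> M \<Longrightarrow> \<bar>fst z - fst w\<bar> \<le> \<beta> * \<bar>fst (F z) - fst (F w)\<bar>"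
proof -
  obtain K1 where K1: "K1 > 0" "\<And>z w. to_annulus z \<in> M \<Longrightarrow> to_annulus w \<in> M \<Longrightarrow>
    \<bar>fst (F z) - fst (F w)\<bar> \<le> K1 * \<bar>fst z - fst w\<bar>" by (rule lipschitz_projection[OF liftF]) blast
  obtain K2 where K2: "K2 > 0" "\<And>z w. to_annulus z \<in> M \<Longrightarrow> to_annulus w \<in> M \<Longrightarrow>
    \<bar>fst (G z) - fst (G w)\<bar> \<le> K2 * \<bar>fst z - fst w\<bar>" by (rule lipschitz_projection[OF liftG]) blast
  have mono: "K * t \<le> (1 + K1 + K2) * t" if "K \<in> {K1, K2}" "0 \<le> t" for K t
    using that K1(1) K2(1) by (intro mult_right_mono) auto
  show thesis
  proof (rule that[of "1 + K1 + K2"])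
    fix z w assume zw: "to_annulus z \<in> M" "to_annulus w \<in> M"
    show "\<bar>fst (F z) - fst (F w)\<bar> \<le> (1 + K1 + K2) * \<bar>fst z - fst w\<bar>"
      using K1(2)[OF zw] mono[of K1 "\<bar>fst z - fst w\<bar>"] by simp
    show "\<bar>fst z - fst w\<bar> \<le> (1 + K1 + K2) * \<bar>fst (F z) - fst (F w)\<bar>"
      using K2(2)[of "F z" "F w"] zw mono[of K2 "\<bar>fst (F z) - fst (F w)\<bar>"] by simp
  qed (use K1 K2 in simp)
qed

end

section \<open>The rotation number of an ordered set\<close>

text \<open>McShane's formula. An infimum of functions with difference quotients in \<open>[\<alpha>, \<beta>]\<close> has difference
  quotients in \<open>[\<alpha>, \<beta>]\<close>, so bi-Lipschitz bounds survive the extension.\<close>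

lemma slope_bounded_extension:
  fixes \<tau> \<phi> :: "'a \<Rightarrow> real" and \<alpha> \<beta> :: real
  assumes Z: "Z \<noteq> {}" and ab: "\<alpha> \<le> \<beta>" "0 < \<alpha>"
    and up: "\<And>z w. z \<in> Z \<Longrightarrow> w \<in> Z \<Longrightarrow> \<tau> w \<le> \<tau> z \<Longrightarrow> \<phi> z - \<phi> w \<le> \<beta> * (\<tau> z - \<tau> w)"
    and low: "\<And>z w. z \<in> Z \<Longrightarrow> w \<in> Z \<Longrightarrow> \<tau> w \<le> \<tau> z \<Longrightarrow> \<alpha> * (\<tau> z - \<tau> w) \<le> \<phi> z - \<phi> w"
    and T: "T ` Z = Z" "\<And>z. z \<in> Z \<Longrightarrow> \<tau> (T z) = \<tau> z + 1" "\<And>z. z \<in> Z \<Longrightarrow> \<phi> (T z) = \<phi> z + 1"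
  shows "\<exists>H. (\<forall>z\<in>Z. H (\<tau> z) = \<phi> z) \<and> (\<forall>t. H (t + 1) = H t + 1) \<and>
    (\<forall>s t. s \<le> t \<longrightarrow> H t - H s \<le> \<beta> * (t - s) \<and> \<alpha> * (t - s) \<le> H t - H s)"
proof -
  (* slope \<alpha> to the left of 0 and slope \<beta> to the right of 0 *)
  define w where "w = (\<lambda>s. \<alpha> * s + (\<beta> - \<alpha>) * max s 0)"
  have w1: "w t - w s \<le> \<beta> * (t - s)" if "s \<le> t" for s t
  proof -
    have "(\<beta> - \<alpha>) * (max t 0 - max s 0) \<le> (\<beta> - \<alpha>) * (t - s)"
      using ab that by (intro mult_left_mono) auto
    then show ?thesis by (simp add: w_def algebra_simps)
  qed
  have w2: "\<alpha> * (t - s) \<le> w t - w s" if "s \<le> t" for s t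
  proof -
    have "0 \<le> (\<beta> - \<alpha>) * (max t 0 - max s 0)"
      using ab that by (intro mult_nonneg_nonneg) auto
    then show ?thesis by (simp add: w_def algebra_simps)
  qed
  have key: "\<phi> z - \<phi> v \<le> w (\<tau> z - \<tau> v)" if "z \<in> Z" "v \<in> Z" for z v
  proof (cases "\<tau> v \<le> \<tau> z")
    case True
    then have "w (\<tau> z - \<tau> v) = \<beta> * (\<tau> z - \<tau> v)" by (simp add: w_def algebra_simps)
    then show ?thesis using up[of z v] that True by simp
  next
    case False
    then show ?thesis using low[of v z] that by (simp add: w_def max_def algebra_simps)
  qed
  define H where "H = (\<lambda>t. INF z\<in>Z. \<phi> z + w (t - \<tau> z))"
  obtain z0 where z0: "z0 \<in> Z" using Z by blast
  have bdd: "bdd_below ((\<lambda>z. \<phi> z + w (t - \<tau> z)) ` Z)" for t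
  proof (rule bdd_belowI2)
    fix z assume z: "z \<in> Z"
    have "w (\<tau> z0 - \<tau> z) - w (t - \<tau> z) \<le> \<beta> * \<bar>t - \<tau> z0\<bar>"
    proof (cases "t \<le> \<tau> z0")
      case True
      then show ?thesis using w1[of "t - \<tau> z" "\<tau> z0 - \<tau> z"] by simp
    next
      case False
      then have "0 \<le> \<alpha> * (t - \<tau> z0)" using ab by simp
      moreover have "0 \<le> \<beta> * \<bar>t - \<tau> z0\<bar>" using ab by simp
      ultimately show ?thesis using False w2[of "\<tau> z0 - \<tau> z" "t - \<tau> z"] by simp
    qed
    then show "\<phi> z0 - \<beta> * \<bar>t - \<tau> z0\<bar> \<le> \<phi> z + w (t - \<tau> z)"
      using key[OF z0 z] by simp
  qed
  show ?thesis
  proof (intro exI[of _ H] conjI ballI allI impI)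
    fix z assume z: "z \<in> Z"
    show "H (\<tau> z) = \<phi> z"
    proof (rule antisym)
      have "H (\<tau> z) \<le> \<phi> z + w (\<tau> z - \<tau> z)"
        unfolding H_def by (rule cINF_lower[OF bdd z])
      then show "H (\<tau> z) \<le> \<phi> z" by (simp add: w_def)
      show "\<phi> z \<le> H (\<tau> z)"
        unfolding H_def using Z key[OF z] by (intro cINF_greatest) (auto simp: algebra_simps)
    qed
  next
    fix t
    have "(\<lambda>z. \<phi> z + w (t + 1 - \<tau> z)) ` Z = (\<lambda>z. \<phi> z + w (t + 1 - \<tau> z)) ` (T ` Z)"
      by (simp add: T(1))
    also have "\<dots> = (\<lambda>z. 1 + (\<phi> z + w (t - \<tau> z))) ` Z"
      unfolding image_image by (rule image_cong) (simp_all add: T)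
    finally have "H (t + 1) = (INF z\<in>Z. 1 + (\<phi> z + w (t - \<tau> z)))"
      by (simp add: H_def)
    also have "\<dots> = 1 + H t"
    proof (rule antisym)
      have bdd1: "bdd_below ((\<lambda>z. 1 + (\<phi> z + w (t - \<tau> z))) ` Z)"
        using bdd[of t] by (auto simp: bdd_below_def) (metis add_left_mono)
      have "(INF z\<in>Z. 1 + (\<phi> z + w (t - \<tau> z))) - 1 \<le> H t"
        unfolding H_def
      proof (rule cINF_greatest[OF Z])
        fix z assume "z \<in> Z"
        then show "(INF z\<in>Z. 1 + (\<phi> z + w (t - \<tau> z))) - 1 \<le> \<phi> z + w (t - \<tau> z)"
          using cINF_lower[OF bdd1] by fastforce
      qed
      then show "(INF z\<in>Z. 1 + (\<phi> z + w (t - \<tau> z))) \<le> 1 + H t" by simp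
      show "1 + H t \<le> (INF z\<in>Z. 1 + (\<phi> z + w (t - \<tau> z)))"
      proof (rule cINF_greatest[OF Z])
        fix z assume "z \<in> Z"
        then show "1 + H t \<le> 1 + (\<phi> z + w (t - \<tau> z))"
          unfolding H_def using cINF_lower[OF bdd] by fastforce
      qed
    qed
    finally show "H (t + 1) = H t + 1" by simp
  next
    fix s t :: real assume st: "s \<le> t"
    have "H t - \<beta> * (t - s) \<le> H s"
      unfolding H_def[THEN fun_cong, of s]
    proof (rule cINF_greatest[OF Z])
      fix z assume z: "z \<in> Z"
      have "H t \<le> \<phi> z + w (t - \<tau> z)" unfolding H_def by (rule cINF_lower[OF bdd z])
      then show "H t - \<beta> * (t - s) \<le> \<phi> z + w (s - \<tau> z)"
        using w1[of "s - \<tau> z" "t - \<tau> z"] st by simp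
    qed
    then show "H t - H s \<le> \<beta> * (t - s)" by simp
  next
    fix s t :: real assume st: "s \<le> t"
    have "H s + \<alpha> * (t - s) \<le> H t"
      unfolding H_def[THEN fun_cong, of t]
    proof (rule cINF_greatest[OF Z])
      fix z assume z: "z \<in> Z"
      have "H s \<le> \<phi> z + w (s - \<tau> z)" unfolding H_def by (rule cINF_lower[OF bdd z])
      then show "H s + \<alpha> * (t - s) \<le> \<phi> z + w (t - \<tau> z)"
        using w2[of "s - \<tau> z" "t - \<tau> z"] st by simp
    qed
    then show "\<alpha> * (t - s) \<le> H t - H s" by simp
  qed
qed

lemma is_circle_lift_unique:
  assumes "is_circle_lift H h" "is_circle_lift H1 h"
  obtains k :: int where "\<And>t. H1 t = H t + of_int k"
proof -
  show thesis
  proof (rule continuous_same_fibre_const)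
    show "continuous_on UNIV (\<lambda>z :: real \<times> real. (H1 (fst z), 0 :: real))"
      "continuous_on UNIV (\<lambda>z :: real \<times> real. (H (fst z), 0 :: real))"
      using assms unfolding is_circle_lift_def
      by (auto intro!: continuous_intros continuous_on_compose2[of UNIV _ UNIV fst])
    show "to_annulus (H1 (fst z), 0) = to_annulus (H (fst z), 0)" for z :: "real \<times> real"
      using assms by (simp add: to_annulus_def is_circle_lift_def)
  next
    fix k :: int
    assume k: "\<And>z :: real \<times> real. (H1 (fst z), 0 :: real) = (H (fst z), 0) + (of_int k, 0)"
    have "H1 t = H t + of_int k" for t using k[of "(t, 0)"] by simp
    then show thesis by (rule that)
  qed
qed

lemma is_circle_lift_degree_one:
  assumes H: "is_circle_lift H h" and t: "H (t + 1) = H t + 1"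
  shows "H (s + 1) = H s + 1"
proof -
  have "continuous_on UNIV (\<lambda>s. H (s + 1))"
    using H unfolding is_circle_lift_def by (auto intro!: continuous_intros continuous_on_compose2[of UNIV H])
  moreover have "to_circle (s + 1) = to_circle s" for s by (simp add: to_circle_eq_iff)
  ultimately have "is_circle_lift (\<lambda>s. H (s + 1)) h"
    using H by (simp add: is_circle_lift_def)
  then obtain k :: int where k: "\<And>s. H (s + 1) = H s + of_int k"
    using is_circle_lift_unique[OF H] by blast
  then show ?thesis using t by simp
qed

lemma dist_to_circle_attained: "\<exists>k::int. dist (to_circle s) (to_circle t) = \<bar>(s + of_int k) - t\<bar>"
proof -
  obtain k where "circle_diff (to_circle s) (to_circle t) = s - t + of_int k"
    using circle_diff_attained by blast
  then show ?thesis by (intro exI[of _ k]) (simp add: dist_circle_def algebra_simps)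
qed

lemma circle_homeo_of_bilipschitz_lift:
  fixes \<alpha> \<beta> :: real
  assumes \<alpha>: "0 < \<alpha>" and deg: "\<And>t. H (t + 1) = H t + 1"
    and up: "\<And>s t. s \<le> t \<Longrightarrow> H t - H s \<le> \<beta> * (t - s)"
    and low: "\<And>s t. s \<le> t \<Longrightarrow> \<alpha> * (t - s) \<le> H t - H s"
  obtains h where "bilipschitz_circle_homeo h" "orientation_preserving h" "is_circle_lift H h"
proof -
  have mono: "strict_mono H"
  proof (rule strict_monoI)
    fix s t :: real assume "s < t"
    then have "0 < \<alpha> * (t - s)" using \<alpha> by simp
    then show "H s < H t" using low[of s t] \<open>s < t\<close> by simp
  qed
  interpret monotone_degree_one H by unfold_locales (rule mono, rule deg)
  have up': "\<bar>H t - H s\<bar> \<le> \<beta> * \<bar>t - s\<bar>" for s t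
    using up[of s t] up[of t s] mono by (cases "s \<le> t") (auto simp: strict_mono_less_eq abs_if strict_mono_less)
  have low': "\<alpha> * \<bar>t - s\<bar> \<le> \<bar>H t - H s\<bar>" for s t
    using low[of s t] low[of t s] by (cases "s \<le> t") auto
  have \<beta>: "0 \<le> \<beta>" using up'[of 1 0] by simp
  have "\<beta>-lipschitz_on UNIV H"
    using up' \<beta> by (intro lipschitz_onI) (auto simp: dist_real_def)
  then have cont: "continuous_on UNIV H" by (rule lipschitz_on_continuous_on)
  define h where "h = (\<lambda>x. to_circle (H (rep_circle x)))"
  have h: "h (to_circle t) = to_circle (H t)" for t
  proof -
    have "rep_circle (to_circle t) - t \<in> \<int>"
      using to_circle_eq_iff Quotient3_abs_rep[OF Quotient3_circle] by metis
    then obtain k where "rep_circle (to_circle t) = t + of_int k"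
      by (metis Ints_cases add.commute diff_add_cancel)
    then show ?thesis by (simp add: h_def shift to_circle_eq_iff)
  qed
  have lift: "is_circle_lift H h" by (simp add: is_circle_lift_def cont h)
  have lip: "dist (h x) (h y) \<le> \<beta> * dist x y" for x y
  proof -
    obtain s t where st: "x = to_circle s" "y = to_circle t" using to_circle_surj by metis
    obtain k :: int where k: "dist x y = \<bar>(s + of_int k) - t\<bar>" using dist_to_circle_attained st by blast
    have "x = to_circle (s + of_int k)" by (simp add: st to_circle_eq_iff)
    then have "dist (h x) (h y) \<le> \<bar>H (s + of_int k) - H t\<bar>"
      using dist_to_circle_le by (simp add: h st(2))
    also have "\<dots> \<le> \<beta> * \<bar>(s + of_int k) - t\<bar>" by (rule up')
    finally show ?thesis by (simp add: k)
  qed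
  have colip: "dist x y \<le> (1 / \<alpha>) * dist (h x) (h y)" for x y
  proof -
    obtain s t where st: "x = to_circle s" "y = to_circle t" using to_circle_surj by metis
    obtain k :: int where k: "dist (h x) (h y) = \<bar>(H s + of_int k) - H t\<bar>"
      using dist_to_circle_attained[of "H s" "H t"] by (auto simp: st h)
    have "x = to_circle (s + of_int k)" by (simp add: st to_circle_eq_iff)
    then have "dist x y \<le> \<bar>(s + of_int k) - t\<bar>" using dist_to_circle_le st(2) by simp
    also have "\<dots> \<le> (1 / \<alpha>) * \<bar>H (s + of_int k) - H t\<bar>"
      using low'[of "s + of_int k" t] \<alpha> by (simp add: field_simps)
    finally show ?thesis by (simp add: k shift)
  qed
  have inj: "inj h"
  proof (rule injI)
    fix x y assume "h x = h y"
    then have "dist x y \<le> 0" using colip[of x y] by simp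
    then show "x = y" by simp
  qed
  have "surj h"
  proof -
    have "\<exists>x. h x = y" for y
    proof -
      obtain t where t: "y = to_circle t" using to_circle_surj by blast
      define r where "r = \<bar>t - H 0\<bar> / \<alpha>"
      have r: "r \<ge> 0" "\<alpha> * r = \<bar>t - H 0\<bar>" using \<alpha> by (auto simp: r_def)
      have "H (- r) \<le> t" "t \<le> H r"
        using low[of "-r" 0] low[of 0 r] r by (auto simp: abs_le_iff)
      then obtain s where "H s = t"
        using IVT'[of H "-r" t r] r(1) cont continuous_on_subset by fastforce
      then show ?thesis using h t by blast
    qed
    then show ?thesis by (metis surjI)
  qed
  with inj have bij: "bij h" by (simp add: bij_def)
  have "bilipschitz_circle_homeo h"
    unfolding bilipschitz_circle_homeo_def
  proof (intro conjI exI)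
    show "\<beta>-lipschitz_on UNIV h" using lip \<beta> by (intro lipschitz_onI) auto
    show "(1 / \<alpha>)-lipschitz_on UNIV (inv h)"
    proof (rule lipschitz_onI)
      fix x y
      show "dist (inv h x) (inv h y) \<le> 1 / \<alpha> * dist x y"
        using colip[of "inv h x" "inv h y"] \<open>surj h\<close> by (simp add: surj_f_inv_f)
    qed (use \<alpha> in simp)
  qed (rule bij)
  moreover have "orientation_preserving h"
    unfolding orientation_preserving_def
  proof (intro allI impI)
    fix H1 assume "is_circle_lift H1 h"
    then obtain k :: int where "\<And>t. H1 t = H t + of_int k"
      using is_circle_lift_unique[OF lift] by blast
    then show "strict_mono H1" using mono by (simp add: strict_mono_def)
  qed
  ultimately show thesis using that lift by blast
qed

context ordered_twist
begin

lemma shift1_F: "F (z + (1, 0)) = F z + (1, 0)"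
  using shiftF[of z 1] by simp

text \<open>Any two extensions of the projected dynamics agree along the orbits in \<open>M\<close>, so they have the same translation
  number. This makes the rotation number of \<open>M\<close> well defined, once one extension is known to exist.\<close>

lemma rotation_number_extension:
  obtains H where "monotone_degree_one H" "\<And>z. to_annulus z \<in> M \<Longrightarrow> H (fst z) = fst (F z)"
    "rotation_number f M F = translation_number H"
proof -
  obtain \<beta> where \<beta>: "\<beta> \<ge> 1"
    "\<And>z w. to_annulus z \<in> M \<Longrightarrow> to_annulus w \<in> M \<Longrightarrow> \<bar>fst (F z) - fst (F w)\<bar> \<le> \<beta> * \<bar>fst z - fst w\<bar>"
    "\<And>z w. to_annulus z \<in> M \<Longrightarrow> to_annulus w \<in> M \<Longrightarrow> \<bar>fst z - fst w\<bar> \<le> \<beta> * \<bar>fst (F z) - fst (F w)\<bar>"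
    by (rule bilipschitz_projection) blast
  have monoF: "fst (F w) \<le> fst (F z)" if "to_annulus z \<in> M" "to_annulus w \<in> M" "fst w \<le> fst z" for z w
    using orderF[of z w] that by linarith
  obtain x0 where "x0 \<in> M" using nonemptyM by blast
  then obtain z0 where z0: "to_annulus z0 \<in> M" using to_annulus_surj by metis
  have "\<exists>H. (\<forall>z\<in>to_annulus -` M. H (fst z) = fst (F z)) \<and> (\<forall>t. H (t + 1) = H t + 1) \<and>
    (\<forall>s t. s \<le> t \<longrightarrow> H t - H s \<le> \<beta> * (t - s) \<and> (1 / \<beta>) * (t - s) \<le> H t - H s)"
  proof (rule slope_bounded_extension[of "to_annulus -` M" "1 / \<beta>" \<beta> fst "\<lambda>z. fst (F z)" "\<lambda>z. z + (1, 0)"])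
    show "to_annulus -` M \<noteq> {}" using z0 by blast
    show "0 < 1 / \<beta>" using \<beta>(1) by simp
    show "1 / \<beta> \<le> \<beta>" using \<beta>(1) mult_mono[of 1 \<beta> 1 \<beta>] by (simp add: field_simps)
    show "(\<lambda>z. z + (1, 0)) ` (to_annulus -` M) = to_annulus -` M"
    proof (intro set_eqI iffI)
      fix z assume "z \<in> to_annulus -` M"
      then have "z + (of_int (-1), 0) \<in> to_annulus -` M" by (metis to_annulus_shift vimage_eq)
      moreover have "z = (z + (of_int (-1), 0)) + (1, 0)" by (simp add: prod_eq_iff)
      ultimately show "z \<in> (\<lambda>z. z + (1, 0)) ` (to_annulus -` M)" by (metis imageI)
    next
      fix z assume "z \<in> (\<lambda>z. z + (1, 0)) ` (to_annulus -` M)"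
      then show "z \<in> to_annulus -` M" using to_annulus_shift[of _ 1] by auto
    qed
  next
    fix z w assume zw: "z \<in> to_annulus -` M" "w \<in> to_annulus -` M" "fst w \<le> fst z"
    show "fst (F z) - fst (F w) \<le> \<beta> * (fst z - fst w)"
      using \<beta>(2)[of z w] zw monoF[of z w] by simp
    have "fst z - fst w \<le> \<beta> * (fst (F z) - fst (F w))"
      using \<beta>(3)[of z w] zw monoF[of z w] by simp
    then show "1 / \<beta> * (fst z - fst w) \<le> fst (F z) - fst (F w)"
      using \<beta>(1) by (simp add: field_simps)
  next
    fix z show "fst (F (z + (1, 0))) = fst (F z) + 1" using shift1_F by simp
  qed auto
  then obtain H where H': "\<forall>z\<in>to_annulus -` M. H (fst z) = fst (F z)" "\<forall>t. H (t + 1) = H t + 1"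
    "\<forall>s t. s \<le> t \<longrightarrow> H t - H s \<le> \<beta> * (t - s) \<and> (1 / \<beta>) * (t - s) \<le> H t - H s" by blast
  then have H: "\<And>z. to_annulus z \<in> M \<Longrightarrow> H (fst z) = fst (F z)" "\<And>t. H (t + 1) = H t + 1"
    "\<And>s t. s \<le> t \<Longrightarrow> H t - H s \<le> \<beta> * (t - s)" "\<And>s t. s \<le> t \<Longrightarrow> (1 / \<beta>) * (t - s) \<le> H t - H s"
    by blast+
  have "0 < 1 / \<beta>" using \<beta>(1) by simp
  then obtain h where h: "bilipschitz_circle_homeo h" "orientation_preserving h" "is_circle_lift H h"
    using circle_homeo_of_bilipschitz_lift H(2,3,4) by metis
  have mono: "monotone_degree_one H"
    using h(2,3) H(2) by unfold_locales (auto simp: orientation_preserving_def)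
  have hM: "fst (f x) = h (fst x)" if "x \<in> M" for x
  proof -
    obtain z where z: "x = to_annulus z" using to_annulus_surj by blast
    have "h (fst x) = to_circle (H (fst z))"
      using h(3) by (simp add: z to_annulus_def is_circle_lift_def)
    also have "\<dots> = fst (to_annulus (F z))" using H(1)[of z] that z by (simp add: to_annulus_def)
    finally show ?thesis by (simp add: C1_liftD(2)[OF liftF] z)
  qed
  have "rotation_number f M F = translation_number H"
    unfolding rotation_number_def
  proof (rule the_equality)
    show "\<exists>h H'. bilipschitz_circle_homeo h \<and> orientation_preserving h \<and>
       (\<forall>x \<in> M. fst (f x) = h (fst x)) \<and> is_circle_lift H' h \<and>
       (\<forall>z \<in> to_annulus -` M. H' (fst z) = fst (F z)) \<and> translation_number H = translation_number H'"
      using h hM H(1) by (intro exI[of _ h] exI[of _ H]) auto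
  next
    fix \<rho> assume "\<exists>h H'. bilipschitz_circle_homeo h \<and> orientation_preserving h \<and>
       (\<forall>x \<in> M. fst (f x) = h (fst x)) \<and> is_circle_lift H' h \<and>
       (\<forall>z \<in> to_annulus -` M. H' (fst z) = fst (F z)) \<and> \<rho> = translation_number H'"
    then obtain h' H' where h'': "orientation_preserving h'" "is_circle_lift H' h'"
      "\<forall>z \<in> to_annulus -` M. H' (fst z) = fst (F z)" "\<rho> = translation_number H'"
      by blast
    then have h': "orientation_preserving h'" "is_circle_lift H' h'"
      "\<And>z. to_annulus z \<in> M \<Longrightarrow> H' (fst z) = fst (F z)" "\<rho> = translation_number H'"
      by simp_all
    have z1: "to_annulus (z0 + (1, 0)) \<in> M" using z0 to_annulus_shift[of z0 1] by simp
    have "H' (fst z0 + 1) = H' (fst z0) + 1"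
      using h'(3)[OF z0] h'(3)[OF z1] shift1_F[of z0] by simp
    then have "H' (t + 1) = H' t + 1" for t
      using is_circle_lift_degree_one[OF h'(2)] by blast
    then have mono': "monotone_degree_one H'"
      using h'(1,2) by unfold_locales (auto simp: orientation_preserving_def)
    have FM: "to_annulus ((F ^^ n) z0) \<in> M" for n by (induction n) (use z0 in auto)
    have "(H ^^ n) (fst z0) = fst ((F ^^ n) z0) \<and> (H' ^^ n) (fst z0) = fst ((F ^^ n) z0)" for n
      by (induction n) (use FM H(1) h'(3) in auto)
    then have "(\<lambda>n. (H ^^ n) (fst z0) / real n) = (\<lambda>n. (H' ^^ n) (fst z0) / real n)" by simp
    then show "\<rho> = translation_number H"
      using monotone_degree_one.translation_number_tendsto[OF mono, of "fst z0"]
        monotone_degree_one.translation_number_tendsto[OF mono', of "fst z0"] h'(4)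
      by (metis LIMSEQ_unique)
  qed
  then show thesis using that mono H(1) by blast
qed

end

section \<open>Irrational ordered sets\<close>

locale irrational_ordered_twist = ordered_twist +
  assumes irrational: "rotation_number f M F \<notin> \<rat>"
begin

lemma irrational_extension:
  obtains H where "monotone_degree_one H" "\<And>z. to_annulus z \<in> M \<Longrightarrow> H (fst z) = fst (F z)"
    "translation_number H \<notin> \<rat>"
  using rotation_number_extension irrational by metis

lemma funpow_f_M [simp]: "(f ^^ n) x \<in> M \<longleftrightarrow> x \<in> M"
  by (induction n) auto

lemma funpow_F_M [simp]: "to_annulus ((F ^^ n) z) \<in> M \<longleftrightarrow> to_annulus z \<in> M"
  by (induction n) auto

lemma to_annulus_funpow_F: "to_annulus ((F ^^ n) z) = (f ^^ n) (to_annulus z)"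
  by (induction n) (simp_all add: C1_liftD(2)[OF liftF])

lemma funpow_extension:
  assumes "\<And>z. to_annulus z \<in> M \<Longrightarrow> H (fst z) = fst (F z)" "to_annulus z \<in> M"
  shows "(H ^^ n) (fst z) = fst ((F ^^ n) z)"
  by (induction n) (use assms in auto)

lemma no_periodic_point:
  assumes "x \<in> M" "n > 0" shows "(f ^^ n) x \<noteq> x"
proof
  assume per: "(f ^^ n) x = x"
  obtain H where H: "monotone_degree_one H" "\<And>z. to_annulus z \<in> M \<Longrightarrow> H (fst z) = fst (F z)"
    "translation_number H \<notin> \<rat>" by (rule irrational_extension) blast
  obtain z where z: "x = to_annulus z" using to_annulus_surj by blast
  have "to_annulus ((F ^^ n) z) = to_annulus z" using per by (simp add: to_annulus_funpow_F z)
  then obtain k :: int where "(F ^^ n) z = z + (of_int k, 0)" using to_annulus_eq_iff by blast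
  then have "(H ^^ n) (fst z) = fst z + of_int k"
    using funpow_extension[OF H(2)] assms z by simp
  then show False using monotone_degree_one.rational_translation_number[OF H(1)] assms(2) H(3) by blast
qed

lemma infinite_M: "infinite M"
proof
  assume fin: "finite M"
  obtain x where x: "x \<in> M" using nonemptyM by blast
  have "\<not> inj (\<lambda>n. (f ^^ n) x)"
    using finite_subset[OF _ fin, of "range (\<lambda>n. (f ^^ n) x)"] x
    by (meson finite_imageD image_subsetI infinite_UNIV_nat funpow_f_M)
  then obtain i j where ij: "(f ^^ i) x = (f ^^ j) x" "i < j"
    unfolding inj_def by (metis linorder_neqE_nat)
  have "(f ^^ (j - i)) ((f ^^ i) x) = (f ^^ i) x"
    using ij by (metis add_diff_inverse_nat funpow_add less_imp_not_less o_apply add.commute)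
  then show False using no_periodic_point[of "(f ^^ i) x" "j - i"] ij(2) x by simp
qed

text \<open>The set of limit points of \<open>M\<close> is closed and invariant, and it is not empty because \<open>M\<close> is infinite and
  compact. Minimality does the rest.\<close>

lemma islimpt_M: assumes "x \<in> M" shows "x islimpt M"
proof -
  define N where "N = {x. x islimpt M}"
  have sub: "N \<subseteq> M" using closedM by (auto simp: N_def closed_limpt simp del: split_paired_All)
  have "N \<noteq> {}"
    using compactM infinite_M unfolding compact_eq_Bolzano_Weierstrass N_def by blast
  moreover have "closed N" unfolding N_def by (rule closed_limpts)
  moreover have "f ` N = N"
  proof -
    have 1: "f x \<in> N" if xN: "x \<in> N" for x
    proof -
      obtain u where u: "\<forall>n. u n \<in> M - {x}" "u \<longlonglongrightarrow> x"
        using xN unfolding N_def mem_Collect_eq islimpt_sequential by blast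
      have "f (u n) \<in> M - {f x}" for n using u(1) by (metis DiffD1 DiffD2 DiffI fM_iff gf singletonD singletonI)
      then show ?thesis using tendsto_f[OF u(2)] unfolding N_def mem_Collect_eq islimpt_sequential
        by (intro exI[of _ "\<lambda>n. f (u n)"]) blast
    qed
    have 2: "g x \<in> N" if xN: "x \<in> N" for x
    proof -
      obtain u where u: "\<forall>n. u n \<in> M - {x}" "u \<longlonglongrightarrow> x"
        using xN unfolding N_def mem_Collect_eq islimpt_sequential by blast
      have "g (u n) \<in> M - {g x}" for n using u(1) by (metis DiffD1 DiffD2 DiffI gM_iff fg singletonD singletonI)
      then show ?thesis using tendsto_g[OF u(2)] unfolding N_def mem_Collect_eq islimpt_sequential
        by (intro exI[of _ "\<lambda>n. g (u n)"]) blast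
    qed
    show ?thesis
    proof (intro set_eqI iffI)
      fix x assume "x \<in> N"
      then have "f (g x) \<in> f ` N" by (intro imageI 2)
      then show "x \<in> f ` N" by simp
    qed (use 1 in blast)
  qed
  ultimately have "N = M" using minimalM sub by blast
  then show ?thesis using assms by (auto simp: N_def)
qed

lemma P_nonvertical: assumes "x \<in> M" shows "\<exists>s. (1, s) \<in> P x"
proof -
  obtain u where u: "\<forall>n. u n \<in> M - {x}" "u \<longlonglongrightarrow> x"
    using islimpt_M[OF assms] unfolding islimpt_sequential by blast
  obtain r :: "nat \<Rightarrow> nat" and v where v: "norm v = 1" "v \<in> P x"
    by (rule paratingent_cone_limit_direction[of u M "\<lambda>_. x" x]) (use u assms in auto)
  then have "fst v \<noteq> 0" using vertical_not_in_P by fastforce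
  moreover have "(1 / fst v) *\<^sub>R v \<in> P x" by (intro paratingent_cone_scaleR v)
  ultimately have "(1, snd v / fst v) \<in> P x"
    by (simp add: scaleR_prod_def)
  then show ?thesis by blast
qed

lemma dist_to_annulus_le: "dist (to_annulus z) (to_annulus w) \<le> \<bar>fst z - fst w\<bar> + \<bar>snd z - snd w\<bar>"
proof -
  have "dist (to_annulus z) (to_annulus w) \<le> dist (to_circle (fst z)) (to_circle (fst w)) + \<bar>snd z - snd w\<bar>"
    by (simp add: to_annulus_def dist_Pair_Pair dist_real_def)
      (metis abs_ge_zero sqrt_sum_squares_le_sum zero_le_dist power2_abs)
  then show ?thesis using dist_to_circle_le[of "fst z" "fst w"] by linarith
qed

text \<open>Along the Lipschitz graph \<open>M\<close>, a Lipschitz function on the annulus becomes a Lipschitz function of the angle.\<close>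

lemma uniform_averages_M:
  fixes \<phi> :: "annulus \<Rightarrow> real"
  assumes K: "K > 0" "\<And>x y. x \<in> M \<Longrightarrow> y \<in> M \<Longrightarrow> \<bar>\<phi> x - \<phi> y\<bar> \<le> K * dist x y" and e: "e > 0"
  shows "\<exists>N. \<forall>n\<ge>N. \<forall>x\<in>M. \<forall>y\<in>M.
    \<bar>(\<Sum>i<n. \<phi> ((f ^^ i) x)) - (\<Sum>i<n. \<phi> ((f ^^ i) y))\<bar> \<le> e * real n"
proof -
  obtain H where H: "monotone_degree_one H" "\<And>z. to_annulus z \<in> M \<Longrightarrow> H (fst z) = fst (F z)"
    "translation_number H \<notin> \<rat>" by (rule irrational_extension) blast
  obtain L where L: "L > 0" "\<And>z w. to_annulus z \<in> M \<Longrightarrow> to_annulus w \<in> M \<Longrightarrow>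
    \<bar>snd z - snd w\<bar> \<le> L * \<bar>fst z - fst w\<bar>" by (rule lipschitz_graph) blast
  define A where "A = fst ` (to_annulus -` M)"
  define \<psi> where "\<psi> = (\<lambda>t. \<phi> (to_annulus (SOME z. to_annulus z \<in> M \<and> fst z = t)))"
  have \<psi>: "\<psi> (fst z) = \<phi> (to_annulus z)" if "to_annulus z \<in> M" for z
  proof -
    let ?w = "SOME w. to_annulus w \<in> M \<and> fst w = fst z"
    have "to_annulus ?w \<in> M \<and> fst ?w = fst z" by (rule someI[of _ z]) (simp add: that)
    then have "?w = z" using graph that by blast
    then show ?thesis by (simp add: \<psi>_def)
  qed
  have "\<exists>N. \<forall>n\<ge>N. \<forall>s\<in>A. \<forall>t\<in>A.
    \<bar>(\<Sum>i<n. \<psi> ((H ^^ i) s)) - (\<Sum>i<n. \<psi> ((H ^^ i) t))\<bar> \<le> e * real n"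
  proof (rule monotone_degree_one.uniform_averages[OF H(1) H(3), where L = "K * (1 + L)"])
    fix t assume "t \<in> A"
    then obtain z where z: "to_annulus z \<in> M" "t = fst z" unfolding A_def by blast
    have "H t = fst (F z)" "to_annulus (F z) \<in> M" using z H(2) by simp_all
    then show "H t \<in> A" unfolding A_def by blast
    fix k :: int
    have zk: "to_annulus (z + (of_int k, 0)) \<in> M" "t + of_int k = fst (z + (of_int k, 0))"
      using z by simp_all
    then show "t + of_int k \<in> A" unfolding A_def by blast
    show "\<psi> (t + of_int k) = \<psi> t"
      unfolding zk(2) \<psi>[OF zk(1)] using \<psi> z by simp
  next
    fix s t assume "s \<in> A" "t \<in> A"
    then obtain z w where zw: "to_annulus z \<in> M" "s = fst z" "to_annulus w \<in> M" "t = fst w"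
      unfolding A_def by blast
    have "\<bar>\<psi> s - \<psi> t\<bar> \<le> K * dist (to_annulus z) (to_annulus w)"
      using K(2) zw by (simp add: \<psi>)
    also have "\<dots> \<le> K * ((1 + L) * \<bar>fst z - fst w\<bar>)"
      using dist_to_annulus_le[of z w] L(2)[OF zw(1,3)] K(1)
      by (intro mult_left_mono) (auto simp: algebra_simps)
    finally show "\<bar>\<psi> s - \<psi> t\<bar> \<le> (K * (1 + L)) * \<bar>s - t\<bar>" by (simp add: zw mult.assoc)
  qed (use K(1) L(1) e in auto)
  then obtain N where N: "\<And>n s t. n \<ge> N \<Longrightarrow> s \<in> A \<Longrightarrow> t \<in> A \<Longrightarrow>
    \<bar>(\<Sum>i<n. \<psi> ((H ^^ i) s)) - (\<Sum>i<n. \<psi> ((H ^^ i) t))\<bar> \<le> e * real n"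
    by blast
  have sums: "(\<Sum>i<n. \<phi> ((f ^^ i) (to_annulus z))) = (\<Sum>i<n. \<psi> ((H ^^ i) (fst z)))"
    if "to_annulus z \<in> M" for z n
    using that by (intro sum.cong) (simp_all add: funpow_extension[OF H(2)] \<psi> to_annulus_funpow_F)
  have "\<bar>(\<Sum>i<n. \<phi> ((f ^^ i) x)) - (\<Sum>i<n. \<phi> ((f ^^ i) y))\<bar> \<le> e * real n"
    if n: "n \<ge> N" "x \<in> M" "y \<in> M" for n x y
  proof -
    obtain z w where zw: "x = to_annulus z" "y = to_annulus w" using to_annulus_surj by metis
    have "fst z \<in> A" "fst w \<in> A" using n zw unfolding A_def by blast+
    then show ?thesis using N[OF n(1)] n zw by (simp add: sums)
  qed
  then show ?thesis by blast
qed

end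

lemma funpow_image:
  assumes "p ` A = A" shows "(p ^^ n) ` A = A"
proof (induction n)
  case (Suc n)
  have "(p ^^ Suc n) ` A = p ` ((p ^^ n) ` A)" by (simp add: image_comp)
  then show ?case using Suc assms by simp
qed simp

context irrational_ordered_twist
begin

text \<open>Otherwise there are pairs of points, closer and closer together, that violate the bound with the factor \<open>2/3\<close>.
  Their limit direction then violates the bound with the factor \<open>1/2\<close>.\<close>

lemma local_contraction:
  assumes p: "C1_map p"
    and contr: "\<And>x v. v \<in> P x \<Longrightarrow> \<bar>fst (tangent_map p x v)\<bar> \<le> 1/2 * \<bar>fst v\<bar>"
  shows "\<exists>\<eta>>0. \<forall>x\<in>M. \<forall>y\<in>M. dist (fst x) (fst y) < \<eta> \<longrightarrow>
    dist (fst (p x)) (fst (p y)) \<le> 2/3 * dist (fst x) (fst y)"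
proof (rule ccontr)
  assume neg: "\<not> ?thesis"
  have "\<forall>n. \<exists>x y. x \<in> M \<and> y \<in> M \<and> dist (fst x) (fst y) < inverse (real (Suc n)) \<and>
     2/3 * dist (fst x) (fst y) < dist (fst (p x)) (fst (p y))"
    using neg by (metis inverse_positive_iff_positive not_less of_nat_0_less_iff zero_less_Suc)
  from choice_pair[OF this] obtain xs ys where
    "\<forall>n. xs n \<in> M \<and> ys n \<in> M \<and> dist (fst (xs n)) (fst (ys n)) < inverse (real (Suc n)) \<and>
     2/3 * dist (fst (xs n)) (fst (ys n)) < dist (fst (p (xs n))) (fst (p (ys n)))" by blast
  then have xy: "\<And>n. xs n \<in> M" "\<And>n. ys n \<in> M" "\<And>n. dist (fst (xs n)) (fst (ys n)) \<le> 1 * inverse (real (Suc n))"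
     "\<And>n. 2/3 * dist (fst (xs n)) (fst (ys n)) < dist (fst (p (xs n))) (fst (p (ys n)))"
    by (simp_all add: less_imp_le)
  have ne: "xs n \<noteq> ys n" for n using xy(4)[of n] by auto
  obtain r :: "nat \<Rightarrow> nat" and z v where
    v: "(\<lambda>n. xs (r n)) \<longlonglongrightarrow> z" "(\<lambda>n. ys (r n)) \<longlonglongrightarrow> z" "norm v = 1" "v \<in> P z"
      "(\<lambda>n. annulus_diff (xs (r n)) (ys (r n)) /\<^sub>R dist (xs (r n)) (ys (r n))) \<longlonglongrightarrow> v"
    by (rule close_pairs_direction[OF xy(1,2) ne xy(3)]) blast
  let ?t = "\<lambda>n. dist (xs (r n)) (ys (r n))"
  have "(\<lambda>n. annulus_diff (p (xs (r n))) (p (ys (r n))) /\<^sub>R ?t n) \<longlonglongrightarrow> tangent_map p z v"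
    by (rule difference_quotient_annulus[OF p v(1,2,5)])
  then have "(\<lambda>n. \<bar>fst (annulus_diff (p (xs (r n))) (p (ys (r n))) /\<^sub>R ?t n)\<bar>) \<longlonglongrightarrow> \<bar>fst (tangent_map p z v)\<bar>"
    by (intro tendsto_intros)
  moreover have "(\<lambda>n. 2/3 * \<bar>fst (annulus_diff (xs (r n)) (ys (r n)) /\<^sub>R ?t n)\<bar>) \<longlonglongrightarrow> 2/3 * \<bar>fst v\<bar>"
    by (intro tendsto_intros v)
  moreover have "2/3 * \<bar>fst (annulus_diff (xs (r n)) (ys (r n)) /\<^sub>R ?t n)\<bar>
      \<le> \<bar>fst (annulus_diff (p (xs (r n))) (p (ys (r n))) /\<^sub>R ?t n)\<bar>" for n
  proof -
    have "inverse (?t n) * (2/3 * dist (fst (xs (r n))) (fst (ys (r n))))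
        \<le> inverse (?t n) * dist (fst (p (xs (r n)))) (fst (p (ys (r n))))"
      using xy(4)[of "r n"] by (intro mult_left_mono) auto
    then show ?thesis by (simp add: abs_mult abs_fst_annulus_diff)
  qed
  ultimately have "2/3 * \<bar>fst v\<bar> \<le> \<bar>fst (tangent_map p z v)\<bar>"
    by (intro tendsto_le[OF sequentially_bot]) (auto intro: always_eventually)
  then have "fst v = 0" using contr[OF v(4)] by simp
  then show False using vertical_not_in_P v by fastforce
qed

text \<open>An infinitesimal contraction of \<open>M\<close> contracts nearby points at a definite scale. A finite net at that
  scale then bounds the number of points of \<open>M\<close>, since \<open>M\<close> is the image of itself under all
  iterates.\<close>

lemma no_contraction:
  assumes p: "C1_map p" and pM: "p ` M = M"
    and contr: "\<And>x v. v \<in> P x \<Longrightarrow> \<bar>fst (tangent_map p x v)\<bar> \<le> 1/2 * \<bar>fst v\<bar>"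
  shows False
proof -
  obtain \<eta> where \<eta>: "\<eta> > 0" "\<And>x y. x \<in> M \<Longrightarrow> y \<in> M \<Longrightarrow> dist (fst x) (fst y) < \<eta> \<Longrightarrow>
    dist (fst (p x)) (fst (p y)) \<le> 2/3 * dist (fst x) (fst y)"
    using local_contraction[OF p contr] by blast
  have pkM: "(p ^^ k) ` M = M" for k by (rule funpow_image[OF pM])
  have it: "dist (fst ((p ^^ k) x)) (fst ((p ^^ k) y)) \<le> (2/3) ^ k * dist (fst x) (fst y)"
    if xy: "x \<in> M" "y \<in> M" "dist (fst x) (fst y) < \<eta>" for k x y
  proof (induction k)
    case (Suc k)
    have M: "(p ^^ k) x \<in> M" "(p ^^ k) y \<in> M" using pkM xy by blast+
    have "(2/3 :: real) ^ k * dist (fst x) (fst y) \<le> 1 * dist (fst x) (fst y)"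
      by (intro mult_right_mono power_le_one) auto
    then have "dist (fst ((p ^^ k) x)) (fst ((p ^^ k) y)) < \<eta>" using Suc xy(3) by linarith
    then show ?case using \<eta>(2)[OF M] Suc by simp
  qed simp
  have "compact (fst ` M)" by (intro compact_continuous_image compactM continuous_intros)
  then obtain C where C: "finite C" "C \<subseteq> fst ` M" "fst ` M \<subseteq> (\<Union>c\<in>C. ball c (\<eta>/2))"
    using seq_compact_imp_totally_bounded[OF compact_imp_seq_compact] half_gt_zero[OF \<eta>(1)] by metis
  obtain Q where Q: "finite Q" "card Q = Suc (card C)" "Q \<subseteq> M"
    using infinite_arbitrarily_large[OF infinite_M] by blast
  obtain e where e: "e > 0" "\<And>x y. x \<in> Q \<Longrightarrow> y \<in> Q \<Longrightarrow> x \<noteq> y \<Longrightarrow> e \<le> dist (fst x) (fst y)"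
  proof -
    (* the element 1 only makes the set nonempty *)
    define E where "E = insert 1 ((\<lambda>z. dist (fst (fst z)) (fst (snd z))) ` (Q \<times> Q) - {0})"
    have E: "finite E" "E \<noteq> {}" using Q(1) by (auto simp: E_def)
    have "\<forall>u\<in>E. u > 0" by (auto simp: E_def)
    then have "Min E > 0" using Min_in[OF E] by blast
    moreover have "Min E \<le> dist (fst x) (fst y)" if "x \<in> Q" "y \<in> Q" "x \<noteq> y" for x y
    proof -
      have "fst x \<noteq> fst y" using that Q(3) inj_on_fst by (meson inj_on_def subset_iff)
      then have "dist (fst x) (fst y) \<in> E"
        using that unfolding E_def by (intro insertI2 DiffI image_eqI[of _ _ "(x, y)"]) auto
      then show ?thesis by (rule Min_le[OF E(1)])
    qed
    ultimately show thesis using that by blast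
  qed
  have "(\<lambda>k. (2/3 :: real) ^ k * \<eta>) \<longlonglongrightarrow> 0 * \<eta>"
    by (intro tendsto_intros LIMSEQ_power_zero) auto
  then have "\<forall>\<^sub>F k in sequentially. (2/3 :: real) ^ k * \<eta> < e"
    by (rule order_tendstoD) (use e in simp)
  then obtain k where k: "(2/3 :: real) ^ k * \<eta> < e"
    using eventually_happens'[OF sequentially_bot] by blast
  have "\<forall>x\<in>Q. \<exists>y. y \<in> M \<and> (p ^^ k) y = x" using pkM[of k] Q(3) by (metis imageE subsetD)
  then obtain q where q: "\<And>x. x \<in> Q \<Longrightarrow> q x \<in> M \<and> (p ^^ k) (q x) = x" by metis
  have "\<forall>x\<in>Q. \<exists>c. c \<in> C \<and> fst (q x) \<in> ball c (\<eta>/2)" using q C(3) by blast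
  then obtain cc where cc: "\<And>x. x \<in> Q \<Longrightarrow> cc x \<in> C \<and> fst (q x) \<in> ball (cc x) (\<eta>/2)" by metis
  have "\<not> inj_on cc Q"
  proof
    assume "inj_on cc Q"
    then have "card Q \<le> card C" using cc C(1) by (intro card_inj_on_le[of cc]) auto
    then show False using Q(2) by simp
  qed
  then obtain x y where xy: "x \<in> Q" "y \<in> Q" "x \<noteq> y" "cc x = cc y" by (metis inj_onI)
  have "dist (fst (q x)) (fst (q y)) < \<eta>"
    using cc[OF xy(1)] cc[OF xy(2)] xy(4) dist_triangle_half_r[of "cc x" "fst (q x)" \<eta> "fst (q y)"] by simp
  then have "dist (fst x) (fst y) \<le> (2/3) ^ k * dist (fst (q x)) (fst (q y))"
    using it[of "q x" "q y" k] q xy by metis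
  also have "\<dots> \<le> (2/3) ^ k * \<eta>"
    using \<open>dist (fst (q x)) (fst (q y)) < \<eta>\<close> by (intro mult_left_mono) auto
  finally show False using e(2)[OF xy(1,2,3)] k by linarith
qed

section \<open>The extremal invariant slopes\<close>

text \<open>The sign \<open>\<sigma>\<close> is built into the slopes, so that the derivative of a map with either direction of twist
  stretches steeper vectors more.\<close>

definition slopes where "slopes x = {s. (1, \<sigma> * s) \<in> P x}"

definition stretch where "stretch x s = a x + \<sigma> * b x * s"

text \<open>The derivative acts on slopes by a Moebius transformation.\<close>

definition push where "push x s = (\<sigma> * c x + d x * s) / stretch x s"

lemma sigma_sq [simp]: "\<sigma> * \<sigma> = 1" "\<sigma> * (\<sigma> * s) = s"
proof -
  show "\<sigma> * \<sigma> = 1" using sigma by (metis abs_mult_self_eq mult_1)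
  then show "\<sigma> * (\<sigma> * s) = s" by (metis mult.assoc mult_1)
qed

lemma P_eq_slopes:
  assumes "v \<in> P x"
  obtains s where "fst v \<noteq> 0 \<Longrightarrow> s \<in> slopes x" "v = fst v *\<^sub>R (1, \<sigma> * s)"
proof (cases "fst v = 0")
  case True
  then have "v = 0" using vertical_not_in_P assms by blast
  then show thesis using that[of 0] by (simp add: zero_prod_def)
next
  case False
  define s where "s = \<sigma> * (snd v / fst v)"
  have s: "\<sigma> * s = snd v / fst v" by (simp only: s_def sigma_sq)
  have "(1 / fst v) *\<^sub>R v = (1, \<sigma> * s)"
    unfolding s using False by (simp add: prod_eq_iff)
  moreover have "(1 / fst v) *\<^sub>R v \<in> P x" by (intro paratingent_cone_scaleR assms)
  ultimately have "s \<in> slopes x" by (simp add: slopes_def)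
  moreover have "v = fst v *\<^sub>R (1, \<sigma> * s)"
    unfolding s using False by (simp add: prod_eq_iff)
  ultimately show thesis using that by blast
qed

lemma fst_Df_slope: "fst (Df x (1, \<sigma> * s)) = stretch x s"
  by (simp add: Df_eq stretch_def)

lemma stretch_pos: "s \<in> slopes x \<Longrightarrow> stretch x s > 0"
  using fst_Df_pos[of "(1, \<sigma> * s)" x] fst_Df_slope by (simp add: slopes_def)

lemma Df_slope:
  assumes "stretch x s \<noteq> 0"
  shows "Df x (1, \<sigma> * s) = stretch x s *\<^sub>R (1, \<sigma> * push x s)"
proof -
  have "\<sigma> * (stretch x s * push x s) = \<sigma> * (\<sigma> * c x + d x * s)"
    using assms by (simp add: push_def)
  also have "\<dots> = c x + d x * (\<sigma> * s)" by (simp add: algebra_simps)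
  finally have "stretch x s * (\<sigma> * push x s) = c x + d x * (\<sigma> * s)"
    by (simp add: mult.left_commute)
  then show ?thesis by (simp add: Df_eq stretch_def)
qed

lemma push_slopes:
  assumes "s \<in> slopes x" shows "push x s \<in> slopes (f x)"
proof -
  have l: "stretch x s > 0" using assms by (rule stretch_pos)
  have "Df x (1, \<sigma> * s) \<in> P (f x)" using assms P_f by (simp add: slopes_def)
  then have "(1 / stretch x s) *\<^sub>R Df x (1, \<sigma> * s) \<in> P (f x)" by (rule paratingent_cone_scaleR)
  then show ?thesis using l by (simp add: Df_slope slopes_def)
qed

lemma push_slopes_surj:
  assumes s': "s' \<in> slopes (f x)" obtains s where "s \<in> slopes x" "push x s = s'"
proof -
  define v where "v = Dg (f x) (1, \<sigma> * s')"
  have vP: "v \<in> P x" using P_g[of "(1, \<sigma> * s')" "f x"] s' by (simp add: v_def slopes_def)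
  have v0: "fst v > 0" using fst_Dg_pos[of "(1, \<sigma> * s')" "f x"] s' by (simp add: v_def slopes_def)
  obtain s where s: "s \<in> slopes x" "v = fst v *\<^sub>R (1, \<sigma> * s)"
    using P_eq_slopes[OF vP] v0 by (metis less_irrefl)
  have "Df x v = (1, \<sigma> * s')" using Df_Dg[of "f x" "(1, \<sigma> * s')"] by (simp add: v_def)
  moreover have "Df x v = fst v *\<^sub>R Df x (1, \<sigma> * s)"
    using s(2) linear_scale[OF linear_tangent_map[OF C1f]] by metis
  moreover have "Df x (1, \<sigma> * s) = stretch x s *\<^sub>R (1, \<sigma> * push x s)"
    using stretch_pos[OF s(1)] by (intro Df_slope) simp
  ultimately have "(1, \<sigma> * s') = (fst v * stretch x s) *\<^sub>R (1 :: real, \<sigma> * push x s)"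
    by (metis scaleR_scaleR)
  then have "fst v * stretch x s = 1" "\<sigma> * s' = (fst v * stretch x s) * (\<sigma> * push x s)"
    by (simp_all only: scaleR_Pair real_scaleR_def prod.inject mult_1_right)
  then have "\<sigma> * push x s = \<sigma> * s'" by (metis mult_1)
  then have "push x s = s'" by (metis sigma_sq(2))
  then show thesis using that s(1) by simp
qed

text \<open>The difference formula for Moebius transformations of determinant 1; in particular the action on slopes is
  increasing.\<close>

lemma push_diff:
  assumes "s \<in> slopes x" "t \<in> slopes x"
  shows "push x t - push x s = (t - s) / (stretch x s * stretch x t)"
proof -
  have l: "stretch x s > 0" "stretch x t > 0" using assms stretch_pos by blast+
  have "(\<sigma> * c x + d x * t) * stretch x s - (\<sigma> * c x + d x * s) * stretch x t
      = (a x * d x - (\<sigma> * \<sigma>) * (b x * c x)) * (t - s)"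
    unfolding stretch_def by (simp only: algebra_simps)
  also have "\<dots> = t - s" by (simp add: det1)
  finally show ?thesis using l by (simp add: push_def field_simps)
qed

definition slope_bound where "slope_bound = (SOME C. C > 0 \<and> (\<forall>x. \<forall>v\<in>P x. \<bar>snd v\<bar> \<le> C * \<bar>fst v\<bar>))"

lemma slope_bound: "slope_bound > 0" "v \<in> P x \<Longrightarrow> \<bar>snd v\<bar> \<le> slope_bound * \<bar>fst v\<bar>"
proof -
  have "\<exists>C. C > 0 \<and> (\<forall>x. \<forall>v\<in>P x. \<bar>snd v\<bar> \<le> C * \<bar>fst v\<bar>)"
    by (rule P_lipschitz) blast
  from someI_ex[OF this, folded slope_bound_def]
  show "slope_bound > 0" "v \<in> P x \<Longrightarrow> \<bar>snd v\<bar> \<le> slope_bound * \<bar>fst v\<bar>" by blast+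
qed

lemma slopes_bounded: "s \<in> slopes x \<Longrightarrow> \<bar>s\<bar> \<le> slope_bound"
  using slope_bound(2)[of "(1, \<sigma> * s)" x] sigma by (simp add: slopes_def abs_mult)

lemma slopes_closed_graph:
  assumes "xs \<longlonglongrightarrow> x" "ss \<longlonglongrightarrow> s" "\<And>n. ss n \<in> slopes (xs n)"
  shows "s \<in> slopes x"
proof -
  have "(\<lambda>n. (1, \<sigma> * ss n)) \<longlonglongrightarrow> (1, \<sigma> * s)" by (intro tendsto_intros assms)
  then have "(1, \<sigma> * s) \<in> P x"
    by (rule paratingent_cone_closed_graph[OF assms(1)]) (use assms(3) in \<open>simp add: slopes_def\<close>)
  then show ?thesis by (simp add: slopes_def)
qed

lemma slopes_nonempty: "x \<in> M \<Longrightarrow> slopes x \<noteq> {}"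
proof -
  assume "x \<in> M"
  then obtain s where "(1, s) \<in> P x" using P_nonvertical by blast
  then have "\<sigma> * s \<in> slopes x" by (simp add: slopes_def)
  then show ?thesis by blast
qed

lemma slopes_in_M: "s \<in> slopes x \<Longrightarrow> x \<in> M"
  using paratingent_cone_in_closure[OF _ closedM] by (auto simp: slopes_def)

lemma closed_slopes: "closed (slopes x)"
  unfolding closed_sequential_limits using slopes_closed_graph[of "\<lambda>_. x" x] by blast

lemma bdd_slopes: "bdd_above (slopes x)" "bdd_below (slopes x)"
proof -
  have "s \<le> slope_bound" "- slope_bound \<le> s" if "s \<in> slopes x" for s
    using slopes_bounded[OF that] by linarith+
  then show "bdd_above (slopes x)" "bdd_below (slopes x)"
    unfolding bdd_above_def bdd_below_def by blast+
qed

definition smax where "smax x = Sup (slopes x)"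
definition smin where "smin x = Inf (slopes x)"

lemma smax_in: "x \<in> M \<Longrightarrow> smax x \<in> slopes x" and smin_in: "x \<in> M \<Longrightarrow> smin x \<in> slopes x"
  unfolding smax_def smin_def
  by (intro closed_contains_Sup closed_contains_Inf slopes_nonempty bdd_slopes closed_slopes; assumption)+

lemma slopes_le: "s \<in> slopes x \<Longrightarrow> s \<le> smax x" "s \<in> slopes x \<Longrightarrow> smin x \<le> s"
  unfolding smax_def smin_def by (intro cSup_upper cInf_lower bdd_slopes; assumption)+

lemma smin_le_smax: "x \<in> M \<Longrightarrow> smin x \<le> smax x"
  using slopes_le smax_in by blast

lemma push_mono:
  assumes "s \<in> slopes x" "t \<in> slopes x" "s \<le> t" shows "push x s \<le> push x t"
proof -
  have "0 \<le> (t - s) / (stretch x s * stretch x t)"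
    using stretch_pos[OF assms(1)] stretch_pos[OF assms(2)] assms(3) by simp
  then show ?thesis using push_diff[OF assms(1,2)] by simp
qed

text \<open>An increasing bijection between the two sets of slopes matches their greatest elements.\<close>

lemma push_smax: assumes "x \<in> M" shows "push x (smax x) = smax (f x)"
proof (rule antisym)
  show "push x (smax x) \<le> smax (f x)" by (intro slopes_le push_slopes smax_in assms)
  obtain s where s: "s \<in> slopes x" "push x s = smax (f x)"
    using push_slopes_surj[OF smax_in[of "f x"]] assms by auto
  then show "smax (f x) \<le> push x (smax x)"
    using push_mono[OF s(1) smax_in[OF assms] slopes_le(1)[OF s(1)]] by simp
qed

lemma push_smin: assumes "x \<in> M" shows "push x (smin x) = smin (f x)"
proof (rule antisym)
  show "smin (f x) \<le> push x (smin x)" by (intro slopes_le push_slopes smin_in assms)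
  obtain s where s: "s \<in> slopes x" "push x s = smin (f x)"
    using push_slopes_surj[OF smin_in[of "f x"]] assms by auto
  then show "push x (smin x) \<le> smin (f x)"
    using push_mono[OF smin_in[OF assms] s(1) slopes_le(2)[OF s(1)]] by simp
qed

definition lmax where "lmax x = stretch x (smax x)"
definition lmin where "lmin x = stretch x (smin x)"

lemma stretch_mono: "s \<le> t \<Longrightarrow> stretch x s \<le> stretch x t"
  using b_sign[of x] by (simp add: stretch_def mult_left_mono)

lemma stretch_strict_mono: "s < t \<Longrightarrow> stretch x s < stretch x t"
  using b_sign[of x] by (simp add: stretch_def mult_strict_left_mono)

lemma lmin_pos: "x \<in> M \<Longrightarrow> 0 < lmin x" and lmax_pos: "x \<in> M \<Longrightarrow> 0 < lmax x"
  unfolding lmin_def lmax_def by (intro stretch_pos smin_in smax_in; assumption)+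

lemma lmin_le_lmax: "x \<in> M \<Longrightarrow> lmin x \<le> lmax x"
  unfolding lmin_def lmax_def by (intro stretch_mono smin_le_smax)

definition gap where "gap x = smax x - smin x"

lemma gap_nonneg: "x \<in> M \<Longrightarrow> 0 \<le> gap x"
  using smin_le_smax by (simp add: gap_def)

lemma gap_le: "x \<in> M \<Longrightarrow> gap x \<le> 2 * slope_bound"
  using slopes_bounded[OF smax_in, of x] slopes_bounded[OF smin_in, of x] by (simp add: gap_def abs_le_iff)

text \<open>Conservation of area makes the product of the two stretching factors a multiplicative coboundary.\<close>

lemma gap_f: assumes "x \<in> M" shows "gap (f x) * (lmin x * lmax x) = gap x"
  using push_diff[OF smin_in[OF assms] smax_in[OF assms]] push_smax[OF assms] push_smin[OF assms]
    lmin_pos[OF assms] lmax_pos[OF assms]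
  by (simp add: gap_def lmin_def lmax_def)

text \<open>The lower bound holds because the inverse of a stretching factor of \<open>f\<close> is one of \<open>g\<close>.\<close>

lemma stretch_bounds:
  obtains \<Lambda> where "\<Lambda> > 1" "\<And>x s. s \<in> slopes x \<Longrightarrow> stretch x s \<le> \<Lambda>"
    "\<And>x s. s \<in> slopes x \<Longrightarrow> 1 / \<Lambda> \<le> stretch x s"
proof -
  have bd: "\<exists>B. \<forall>x\<in>M. \<bar>h x\<bar> \<le> B" if "continuous_on UNIV h" for h :: "annulus \<Rightarrow> real"
  proof -
    have "compact (h ` M)" using that compactM by (intro compact_continuous_image) (auto intro: continuous_on_subset)
    then show ?thesis by (metis bounded_iff compact_imp_bounded imageI real_norm_def)
  qed
  obtain Ba Bb Bd where B: "\<And>x. x \<in> M \<Longrightarrow> \<bar>a x\<bar> \<le> Ba" "\<And>x. x \<in> M \<Longrightarrow> \<bar>b x\<bar> \<le> Bb" "\<And>x. x \<in> M \<Longrightarrow> \<bar>d x\<bar> \<le> Bd"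
    using bd continuous_coeffs by metis
  define \<Lambda> where "\<Lambda> = \<bar>Ba\<bar> + \<bar>Bd\<bar> + \<bar>Bb\<bar> * slope_bound + 2"
  have sb: "slope_bound > 0" by (rule slope_bound)
  have "0 \<le> \<bar>Bb\<bar> * slope_bound" using sb by simp
  then have \<Lambda>: "\<Lambda> > 1" unfolding \<Lambda>_def by linarith
  have bs: "\<bar>\<sigma> * b x * s\<bar> \<le> \<bar>Bb\<bar> * slope_bound" if "x \<in> M" "\<bar>s\<bar> \<le> slope_bound" for x s
  proof -
    have "\<bar>b x\<bar> \<le> \<bar>Bb\<bar>" using B(2)[OF that(1)] by linarith
    then have "\<bar>b x\<bar> * \<bar>s\<bar> \<le> \<bar>Bb\<bar> * slope_bound" using that(2) by (intro mult_mono) auto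
    then show ?thesis using sigma by (simp add: abs_mult)
  qed
  have up: "stretch x s \<le> \<Lambda>" if s: "s \<in> slopes x" for x s
    using B(1)[OF slopes_in_M[OF s]] bs[OF slopes_in_M[OF s] slopes_bounded[OF s]]
    by (simp add: stretch_def \<Lambda>_def abs_le_iff) linarith
  have low: "1 / \<Lambda> \<le> stretch x s" if s: "s \<in> slopes x" for x s
  proof -
    have l: "stretch x s > 0" using s by (rule stretch_pos)
    have "fst (Dg (f x) (Df x (1, \<sigma> * s))) = 1" by (simp add: Dg_Df)
    then have "stretch x s * (d x - \<sigma> * b x * push x s) = 1"
      using l by (simp add: Df_slope fst_Dg algebra_simps)
    moreover have "d x - \<sigma> * b x * push x s \<le> \<Lambda>"
      using B(3)[OF slopes_in_M[OF s]] bs[OF slopes_in_M[OF s] slopes_bounded[OF push_slopes[OF s]]]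
      by (simp add: \<Lambda>_def abs_le_iff) linarith
    then have "stretch x s * (d x - \<sigma> * b x * push x s) \<le> stretch x s * \<Lambda>"
      using l by (intro mult_left_mono) auto
    ultimately show ?thesis using \<Lambda> by (simp add: field_simps)
  qed
  show thesis using that \<Lambda> up low by blast
qed

text \<open>The cone being closed, the extremal slopes are semicontinuous.\<close>

lemma slopes_subsequence:
  assumes "xs \<longlonglongrightarrow> x" "\<And>n. ss n \<in> slopes (xs n)"
  obtains r :: "nat \<Rightarrow> nat" and s where "strict_mono r" "(\<lambda>n. ss (r n)) \<longlonglongrightarrow> s" "s \<in> slopes x" "(\<lambda>n. xs (r n)) \<longlonglongrightarrow> x"
proof -
  have "\<forall>n. ss n \<in> {- slope_bound .. slope_bound}"
    using slopes_bounded[OF assms(2)] by (simp add: abs_le_iff minus_le_iff)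
  then obtain s r where r: "s \<in> {- slope_bound .. slope_bound}" "strict_mono r" "(ss \<circ> r) \<longlonglongrightarrow> s"
    by (rule seq_compactE[OF compact_imp_seq_compact[OF compact_Icc]])
  have x: "(\<lambda>n. xs (r n)) \<longlonglongrightarrow> x" using LIMSEQ_subseq_LIMSEQ[OF assms(1) r(2)] by (simp add: o_def)
  have s: "(\<lambda>n. ss (r n)) \<longlonglongrightarrow> s" using r(3) by (simp add: o_def)
  show thesis using that r(2) s slopes_closed_graph[OF x s] assms(2) x by blast
qed

lemma tendsto_stretch:
  assumes "xs \<longlonglongrightarrow> x" "ss \<longlonglongrightarrow> s" shows "(\<lambda>n. stretch (xs n) (ss n)) \<longlonglongrightarrow> stretch x s"
proof -
  have "(\<lambda>n. a (xs n)) \<longlonglongrightarrow> a x" "(\<lambda>n. b (xs n)) \<longlonglongrightarrow> b x"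
    using continuous_on_tendsto_compose[OF continuous_coeffs(1) assms(1)]
      continuous_on_tendsto_compose[OF continuous_coeffs(2) assms(1)] by simp_all
  then show ?thesis unfolding stretch_def by (intro tendsto_intros assms)
qed

lemma closed_lmax_superlevel: "closed {x \<in> M. k \<le> lmax x}"
  unfolding closed_sequential_limits
proof (intro allI impI)
  fix xs x assume A: "(\<forall>n. xs n \<in> {x \<in> M. k \<le> lmax x}) \<and> xs \<longlonglongrightarrow> x"
  then have xs: "\<And>n. xs n \<in> M" "\<And>n. k \<le> lmax (xs n)" "xs \<longlonglongrightarrow> x" by auto
  obtain r s where r: "(\<lambda>n. smax (xs (r n))) \<longlonglongrightarrow> s" "s \<in> slopes x" "(\<lambda>n. xs (r n)) \<longlonglongrightarrow> x"
    using slopes_subsequence[OF xs(3) smax_in[OF xs(1)]] by metis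
  have "k \<le> stretch x s"
    by (rule tendsto_lowerbound[OF tendsto_stretch[OF r(3,1)]])
      (use xs in \<open>auto simp: lmax_def intro: always_eventually\<close>)
  also have "\<dots> \<le> lmax x" unfolding lmax_def by (intro stretch_mono slopes_le r)
  finally show "x \<in> {x \<in> M. k \<le> lmax x}" using slopes_in_M[OF r(2)] by simp
qed

lemma closed_lmin_sublevel: "closed {x \<in> M. lmin x \<le> k}"
  unfolding closed_sequential_limits
proof (intro allI impI)
  fix xs x assume A: "(\<forall>n. xs n \<in> {x \<in> M. lmin x \<le> k}) \<and> xs \<longlonglongrightarrow> x"
  then have xs: "\<And>n. xs n \<in> M" "\<And>n. lmin (xs n) \<le> k" "xs \<longlonglongrightarrow> x" by auto
  obtain r s where r: "(\<lambda>n. smin (xs (r n))) \<longlonglongrightarrow> s" "s \<in> slopes x" "(\<lambda>n. xs (r n)) \<longlonglongrightarrow> x"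
    using slopes_subsequence[OF xs(3) smin_in[OF xs(1)]] by metis
  have "lmin x \<le> stretch x s" unfolding lmin_def by (intro stretch_mono slopes_le r)
  also have "\<dots> \<le> k"
    by (rule tendsto_upperbound[OF tendsto_stretch[OF r(3,1)]])
      (use xs in \<open>auto simp: lmin_def intro: always_eventually\<close>)
  finally show "x \<in> {x \<in> M. lmin x \<le> k}" using slopes_in_M[OF r(2)] by simp
qed

lemma closed_gap_superlevel: "closed {x \<in> M. k \<le> gap x}"
  unfolding closed_sequential_limits
proof (intro allI impI)
  fix xs x assume A: "(\<forall>n. xs n \<in> {x \<in> M. k \<le> gap x}) \<and> xs \<longlonglongrightarrow> x"
  then have xs: "\<And>n. xs n \<in> M" "\<And>n. k \<le> gap (xs n)" "xs \<longlonglongrightarrow> x" by auto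
  obtain r s where r: "strict_mono r" "(\<lambda>n. smax (xs (r n))) \<longlonglongrightarrow> s" "s \<in> slopes x" "(\<lambda>n. xs (r n)) \<longlonglongrightarrow> x"
    using slopes_subsequence[OF xs(3) smax_in[OF xs(1)]] by metis
  obtain r' t where r': "strict_mono r'" "(\<lambda>n. smin (xs (r (r' n)))) \<longlonglongrightarrow> t" "t \<in> slopes x"
    using slopes_subsequence[OF r(4) smin_in[OF xs(1)]] by metis
  have "(\<lambda>n. smax (xs (r (r' n)))) \<longlonglongrightarrow> s"
    using LIMSEQ_subseq_LIMSEQ[OF r(2) r'(1)] by (simp add: o_def)
  then have "(\<lambda>n. smax (xs (r (r' n))) - smin (xs (r (r' n)))) \<longlonglongrightarrow> s - t"
    by (intro tendsto_intros r')
  then have "k \<le> s - t"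
    by (rule tendsto_lowerbound) (use xs in \<open>auto simp: gap_def intro: always_eventually\<close>)
  also have "\<dots> \<le> gap x" unfolding gap_def by (intro diff_mono slopes_le r r')
  finally show "x \<in> {x \<in> M. k \<le> gap x}" using slopes_in_M[OF r(3)] by simp
qed

text \<open>Nonzero vectors of the cone are not vertical. So the cone lies in a line exactly when it has a single slope.\<close>

lemma C1_regular_iff_gap:
  assumes x: "x \<in> M" shows "C1_regular_at M x \<longleftrightarrow> gap x = 0"
proof
  let ?u = "(1 :: real, \<sigma> * smax x)" and ?w = "(1 :: real, \<sigma> * smin x)"
  assume "C1_regular_at M x"
  then obtain D where D: "subspace D" "dim D = 1" "P x \<subseteq> D" unfolding C1_regular_at_def by blast
  show "gap x = 0"
  proof (rule ccontr)
    assume "gap x \<noteq> 0"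
    then have ne: "\<sigma> * smax x \<noteq> \<sigma> * smin x"
      by (metis gap_def right_minus_eq sigma_sq(2))
    have "independent {?u, ?w}"
    proof (rule independent_insertI)
      show "?u \<notin> span {?w}" using ne by (auto simp: span_singleton)
      show "independent {?w}" by (intro independent_insertI) (auto simp: zero_prod_def independent_empty)
    qed
    moreover have "{?u, ?w} \<subseteq> D"
      using smax_in[OF x] smin_in[OF x] D(3) by (auto simp: slopes_def)
    ultimately have "card {?u, ?w} \<le> dim D" by (rule independent_card_le_dim[rotated])
    then show False using ne D(2) by simp
  qed
next
  assume g: "gap x = 0"
  show "C1_regular_at M x"
    unfolding C1_regular_at_def
  proof (intro exI[of _ "span {(1, \<sigma> * smax x)}"] conjI subsetI)
    have "independent {(1 :: real, \<sigma> * smax x)}"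
      by (intro independent_insertI) (auto simp: zero_prod_def independent_empty)
    then show "dim (span {(1 :: real, \<sigma> * smax x)}) = 1" by (simp add: dim_span_eq_card_independent)
    fix v assume v: "v \<in> P x"
    obtain s where s: "fst v \<noteq> 0 \<Longrightarrow> s \<in> slopes x" "v = fst v *\<^sub>R (1, \<sigma> * s)" using P_eq_slopes[OF v] by blast
    show "v \<in> span {(1, \<sigma> * smax x)}"
    proof (cases "fst v = 0")
      case True
      then have "v = 0" using s(2) by (metis scale_zero_left)
      then show ?thesis by (simp add: span_zero)
    next
      case False
      then have "s = smax x" using slopes_le[OF s(1)] g by (simp add: gap_def)
      then show ?thesis using s(2) by (metis span_base span_scale singletonI)
    qed
  qed (rule subspace_span)
qed

lemma gap_f_eq_0_iff: "x \<in> M \<Longrightarrow> gap (f x) = 0 \<longleftrightarrow> gap x = 0"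
  using gap_f[of x] lmin_pos[of x] lmax_pos[of x] by auto

abbreviation Dfn where "Dfn n x \<equiv> tangent_map (f ^^ n) x"

lemma Dfn_slope_field:
  assumes t: "\<And>x. x \<in> M \<Longrightarrow> t x \<in> slopes x" "\<And>x. x \<in> M \<Longrightarrow> push x (t x) = t (f x)" and x: "x \<in> M"
  shows "Dfn n x (1, \<sigma> * t x) = (\<Prod>i<n. stretch ((f ^^ i) x) (t ((f ^^ i) x))) *\<^sub>R (1, \<sigma> * t ((f ^^ n) x))"
proof (induction n)
  case (Suc n)
  let ?y = "(f ^^ n) x"
  have y: "?y \<in> M" using x by simp
  have "Dfn (Suc n) x (1, \<sigma> * t x) = Df ?y (Dfn n x (1, \<sigma> * t x))"
    by (rule tangent_map_funpow_Suc[OF C1f])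
  also have "\<dots> = (\<Prod>i<n. stretch ((f ^^ i) x) (t ((f ^^ i) x))) *\<^sub>R Df ?y (1, \<sigma> * t ?y)"
    unfolding Suc by (rule linear_scale[OF linear_tangent_map[OF C1f]])
  also have "Df ?y (1, \<sigma> * t ?y) = stretch ?y (t ?y) *\<^sub>R (1, \<sigma> * t ((f ^^ Suc n) x))"
    using Df_slope[of ?y "t ?y"] stretch_pos[OF t(1)[OF y]] t(2)[OF y] by simp
  finally show ?case by (simp add: mult.commute mult.left_commute)
qed simp

lemma Dfn_smax:
  "x \<in> M \<Longrightarrow> Dfn n x (1, \<sigma> * smax x) = (\<Prod>i<n. lmax ((f ^^ i) x)) *\<^sub>R (1, \<sigma> * smax ((f ^^ n) x))"
  unfolding lmax_def by (rule Dfn_slope_field) (simp_all add: smax_in push_smax)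

lemma Dfn_smin:
  "x \<in> M \<Longrightarrow> Dfn n x (1, \<sigma> * smin x) = (\<Prod>i<n. lmin ((f ^^ i) x)) *\<^sub>R (1, \<sigma> * smin ((f ^^ n) x))"
  unfolding lmin_def by (rule Dfn_slope_field) (simp_all add: smin_in push_smin)

lemma P_Dfn: "v \<in> P x \<Longrightarrow> Dfn n x v \<in> P ((f ^^ n) x)"
proof (induction n)
  case (Suc n)
  then show ?case using P_f by (simp add: tangent_map_funpow_Suc[OF C1f] del: funpow.simps) simp
qed simp

lemma fst_Df_bounds:
  assumes v: "v \<in> P x"
  shows "\<bar>fst (Df x v)\<bar> \<le> lmax x * \<bar>fst v\<bar>" "lmin x * \<bar>fst v\<bar> \<le> \<bar>fst (Df x v)\<bar>"
proof -
  obtain s where s: "fst v \<noteq> 0 \<Longrightarrow> s \<in> slopes x" "v = fst v *\<^sub>R (1, \<sigma> * s)" using P_eq_slopes[OF v] by blast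
  have eq: "fst (Df x v) = fst v * stretch x s"
    using linear_scale[OF linear_tangent_map[OF C1f], of x "fst v" "(1, \<sigma> * s)"] s(2) fst_Df_slope
    by (metis fst_scaleR real_scaleR_def)
  have "\<bar>fst (Df x v)\<bar> \<le> lmax x * \<bar>fst v\<bar> \<and> lmin x * \<bar>fst v\<bar> \<le> \<bar>fst (Df x v)\<bar>"
  proof (cases "fst v = 0")
    case False
    then have sx: "s \<in> slopes x" by (rule s)
    have "lmin x \<le> stretch x s" "stretch x s \<le> lmax x"
      unfolding lmin_def lmax_def by (intro stretch_mono slopes_le sx)+
    moreover have "stretch x s > 0" by (rule stretch_pos[OF sx])
    ultimately show ?thesis unfolding eq by (simp add: abs_mult mult.commute mult_left_mono)
  qed (simp add: eq)
  then show "\<bar>fst (Df x v)\<bar> \<le> lmax x * \<bar>fst v\<bar>" "lmin x * \<bar>fst v\<bar> \<le> \<bar>fst (Df x v)\<bar>" by auto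
qed

lemma fst_Dfn_bounds:
  assumes x: "x \<in> M" and v: "v \<in> P x"
  shows "\<bar>fst (Dfn n x v)\<bar> \<le> (\<Prod>i<n. lmax ((f ^^ i) x)) * \<bar>fst v\<bar>"
    and "(\<Prod>i<n. lmin ((f ^^ i) x)) * \<bar>fst v\<bar> \<le> \<bar>fst (Dfn n x v)\<bar>"
proof (induction n)
  case (Suc n)
  let ?y = "(f ^^ n) x"
  have y: "?y \<in> M" using x by simp
  note b = fst_Df_bounds[OF P_Dfn[OF v], of n, folded tangent_map_funpow_Suc[OF C1f]]
  {
    case 1
    have "lmax ?y * \<bar>fst (Dfn n x v)\<bar> \<le> lmax ?y * ((\<Prod>i<n. lmax ((f ^^ i) x)) * \<bar>fst v\<bar>)"
      using Suc(1) lmax_pos[OF y] by (intro mult_left_mono) auto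
    then show ?case using b(1) by (simp add: mult_ac del: funpow.simps)
  next
    case 2
    have "lmin ?y * ((\<Prod>i<n. lmin ((f ^^ i) x)) * \<bar>fst v\<bar>) \<le> lmin ?y * \<bar>fst (Dfn n x v)\<bar>"
      using Suc(2) lmin_pos[OF y] by (intro mult_left_mono) auto
    then show ?case using b(2) by (simp add: mult_ac del: funpow.simps)
  }
qed simp_all

end

section \<open>Semicontinuous functions and invariant measures\<close>

text \<open>The least \<open>k\<close>-Lipschitz majorant of \<open>u\<close> on \<open>M\<close> (Pasch-Hausdorff envelope).\<close>

definition lipschitz_envelope :: "'a::metric_space set \<Rightarrow> ('a \<Rightarrow> real) \<Rightarrow> nat \<Rightarrow> 'a \<Rightarrow> real"
  where "lipschitz_envelope M u k x = (SUP y\<in>M. u y - real k * dist x y)"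

lemma lipschitz_envelope:
  fixes u :: "'a::metric_space \<Rightarrow> real"
  assumes M: "M \<noteq> {}" and B': "\<forall>x\<in>M. \<bar>u x\<bar> \<le> B"
    and usc: "\<And>c. closed {x \<in> M. c \<le> u x}"
  shows "\<bar>lipschitz_envelope M u k x - lipschitz_envelope M u k y\<bar> \<le> real k * dist x y"
    and "x \<in> M \<Longrightarrow> u x \<le> lipschitz_envelope M u k x"
    and "x \<in> M \<Longrightarrow> \<bar>lipschitz_envelope M u k x\<bar> \<le> B"
    and "x \<in> M \<Longrightarrow> (\<lambda>k. lipschitz_envelope M u k x) \<longlonglongrightarrow> u x"
proof -
  let ?E = "lipschitz_envelope M u"
  note B = B'[rule_format]
  have ub: "u y - real k * dist x y \<le> B" if "y \<in> M" for y k x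
  proof -
    have "0 \<le> real k * dist x y" by simp
    then show ?thesis using B[OF that] by linarith
  qed
  have bdd: "bdd_above ((\<lambda>y. u y - real k * dist x y) ` M)" for k x
    by (rule bdd_aboveI2) (rule ub)
  have upper: "u y - real k * dist x y \<le> ?E k x" if "y \<in> M" for y k x
    unfolding lipschitz_envelope_def by (rule cSUP_upper[OF that bdd])
  have half: "?E k x \<le> ?E k y + real k * dist x y" for x y k
    unfolding lipschitz_envelope_def[of M u k x]
  proof (rule cSUP_least[OF M])
    fix z assume z: "z \<in> M"
    have "real k * dist y z \<le> real k * (dist x y + dist x z)"
      using dist_triangle2[of y z x] by (intro mult_left_mono) (auto simp: dist_commute)
    then show "u z - real k * dist x z \<le> ?E k y + real k * dist x y"
      using upper[OF z, of k y] by (simp add: algebra_simps)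
  qed
  show "\<bar>?E k x - ?E k y\<bar> \<le> real k * dist x y"
    using half[of k x y] half[of k y x] by (simp add: dist_commute abs_le_iff)
  have above: "u x \<le> ?E k x" if "x \<in> M" for x k
    using upper[OF that, of k x] by simp
  then show "x \<in> M \<Longrightarrow> u x \<le> ?E k x" .
  have below: "?E k x \<le> B" for k x
    unfolding lipschitz_envelope_def by (rule cSUP_least[OF M ub])
  show "\<bar>?E k x\<bar> \<le> B" if "x \<in> M"
    using above[OF that, of k] below[of k x] B[OF that] by linarith
  assume x: "x \<in> M"
  show "(\<lambda>k. ?E k x) \<longlonglongrightarrow> u x"
  proof (rule LIMSEQ_I)
    fix e :: real assume e: "e > 0"
    have "open (- {y \<in> M. u x + e/2 \<le> u y})" using usc by blast
    moreover have "x \<in> - {y \<in> M. u x + e/2 \<le> u y}" using e by simp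
    ultimately obtain r where r: "r > 0" "ball x r \<subseteq> - {y \<in> M. u x + e/2 \<le> u y}"
      using open_contains_ball by blast
    obtain K where K: "2 * B < real K * r" using reals_Archimedean3[OF r(1)] by blast
    have "norm (?E k x - u x) < e" if k: "k \<ge> K" for k
    proof -
      have "?E k x \<le> u x + e/2"
        unfolding lipschitz_envelope_def
      proof (rule cSUP_least[OF M])
        fix y assume y: "y \<in> M"
        show "u y - real k * dist x y \<le> u x + e/2"
        proof (cases "dist x y < r")
          case True
          then have "u y < u x + e/2" using r(2) y by (auto simp: subset_iff)
          moreover have "0 \<le> real k * dist x y" by simp
          ultimately show ?thesis by linarith
        next
          case False
          then have "real K * r \<le> real k * dist x y" using k r(1) by (intro mult_mono) auto
          then show ?thesis using K B[OF y] B[OF x] e by linarith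
        qed
      qed
      then show ?thesis using above[OF x, of k] e by simp
    qed
    then show "\<exists>no. \<forall>n\<ge>no. norm (?E n x - u x) < e" by blast
  qed
qed

lemma continuous_lipschitz_envelope:
  fixes u :: "'a::metric_space \<Rightarrow> real"
  assumes "M \<noteq> {}" "\<forall>x\<in>M. \<bar>u x\<bar> \<le> B" "\<And>c. closed {x \<in> M. c \<le> u x}"
  shows "continuous_on UNIV (lipschitz_envelope M u k)"
proof (rule lipschitz_on_continuous_on)
  show "(real k)-lipschitz_on UNIV (lipschitz_envelope M u k)"
    using lipschitz_envelope(1)[OF assms] by (intro lipschitz_onI) (auto simp: dist_real_def)
qed

lemma borel_measurable_semicontinuous:
  fixes u :: "'a::topological_space \<Rightarrow> real"
  assumes "closed M" "\<And>c. closed {x \<in> M. c \<le> u x}"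
  shows "(\<lambda>x. if x \<in> M then u x else 0) \<in> borel_measurable borel"
  unfolding borel_measurable_iff_ge
proof
  fix k :: real
  have "{x \<in> space borel. k \<le> (if x \<in> M then u x else 0)} = {x \<in> M. k \<le> u x} \<union> (if k \<le> 0 then - M else {})"
    by auto
  moreover have "{x \<in> M. k \<le> u x} \<in> sets borel" "- M \<in> sets borel"
    using assms by auto
  ultimately show "{x \<in> space borel. k \<le> (if x \<in> M then u x else 0)} \<in> sets borel"
    by auto
qed

locale mather_measure = irrational_ordered_twist +
  fixes \<mu> :: "annulus measure"
  assumes invariant: "invariant_prob_on f M \<mu>"
begin

sublocale prob: prob_space \<mu>
  using invariant by (simp add: invariant_prob_on_def)

lemma sets_mu [simp, measurable_cong]: "sets \<mu> = sets borel"
  using invariant by (simp add: invariant_prob_on_def)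

lemma space_mu [simp]: "space \<mu> = UNIV"
  using sets_eq_imp_space_eq[OF sets_mu] by simp

lemma measurable_f [measurable]: "f \<in> borel_measurable borel"
  by (intro borel_measurable_continuous_onI continuous_f)

lemma measurable_fn [measurable]: "(f ^^ n) \<in> borel_measurable borel"
  by (intro borel_measurable_continuous_onI continuous_on_C1_map C1_map_funpow C1f)

lemma emeasure_preimage: "A \<in> sets borel \<Longrightarrow> emeasure \<mu> (f -` A) = emeasure \<mu> A"
  using emeasure_distr[of f \<mu> borel A] invariant by (simp add: invariant_prob_on_def)

lemma M_borel [measurable]: "M \<in> sets borel"
  using closedM by simp

lemma AE_M: "AE x in \<mu>. x \<in> M"
  using prob.AE_in_set_eq_1[of M] invariant
  by (simp add: invariant_prob_on_def prob.emeasure_eq_measure)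

lemma integral_f:
  fixes h :: "annulus \<Rightarrow> real"
  assumes "h \<in> borel_measurable borel"
  shows "(\<integral>x. h (f x) \<partial>\<mu>) = (\<integral>x. h x \<partial>\<mu>)"
  using integral_distr[of f \<mu> borel h] assms invariant by (simp add: invariant_prob_on_def)

lemma integral_fn:
  fixes h :: "annulus \<Rightarrow> real"
  assumes h: "h \<in> borel_measurable borel"
  shows "(\<integral>x. h ((f ^^ n) x) \<partial>\<mu>) = (\<integral>x. h x \<partial>\<mu>)"
proof (induction n)
  case (Suc n)
  have "(\<integral>x. h ((f ^^ Suc n) x) \<partial>\<mu>) = (\<integral>x. h ((f ^^ n) (f x)) \<partial>\<mu>)"
    by (simp only: funpow_Suc_right o_apply)
  also have "\<dots> = (\<integral>x. h ((f ^^ n) x) \<partial>\<mu>)"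
    by (rule integral_f) (use h in measurable)
  finally show ?case using Suc by simp
qed simp

lemma integrable_bounded_on_M:
  fixes h :: "annulus \<Rightarrow> real"
  assumes "h \<in> borel_measurable borel" "\<And>x. x \<in> M \<Longrightarrow> \<bar>h x\<bar> \<le> B"
  shows "integrable \<mu> h"
proof (rule prob.integrable_const_bound[of _ B])
  show "AE x in \<mu>. norm (h x) \<le> B" using AE_M by eventually_elim (use assms(2) in simp)
qed (use assms(1) in simp)

lemma integrable_fn:
  fixes h :: "annulus \<Rightarrow> real"
  assumes "h \<in> borel_measurable borel" "\<And>x. x \<in> M \<Longrightarrow> \<bar>h x\<bar> \<le> B"
  shows "integrable \<mu> (\<lambda>x. h ((f ^^ n) x))"
  by (rule integrable_bounded_on_M[of _ B]) (use assms measurable_compose[OF measurable_fn assms(1)] in simp_all)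

text \<open>The averages of all points of \<open>M\<close> are uniformly close to each other, hence to their common mean, which is
  the integral by invariance.\<close>

lemma uniform_average_lipschitz:
  fixes \<phi> :: "annulus \<Rightarrow> real"
  assumes K: "K > 0" "\<And>x y. \<bar>\<phi> x - \<phi> y\<bar> \<le> K * dist x y" and e: "e > 0"
  shows "\<exists>N. \<forall>n\<ge>N. \<forall>x\<in>M. \<bar>(\<Sum>i<n. \<phi> ((f ^^ i) x)) - real n * (\<integral>x. \<phi> x \<partial>\<mu>)\<bar> \<le> e * real n"
proof -
  obtain N where N: "\<forall>n\<ge>N. \<forall>x\<in>M. \<forall>y\<in>M.
      \<bar>(\<Sum>i<n. \<phi> ((f ^^ i) x)) - (\<Sum>i<n. \<phi> ((f ^^ i) y))\<bar> \<le> e * real n"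
    using uniform_averages_M[OF K(1), of \<phi> e] K(2) e by blast
  have "K-lipschitz_on UNIV \<phi>" using K by (intro lipschitz_onI) (auto simp: dist_real_def)
  then have cont: "continuous_on UNIV \<phi>" by (rule lipschitz_on_continuous_on)
  then have meas: "\<phi> \<in> borel_measurable borel" by (rule borel_measurable_continuous_onI)
  have "compact (\<phi> ` M)" by (intro compact_continuous_image compactM continuous_on_subset[OF cont]) auto
  then obtain B where B: "\<And>x. x \<in> M \<Longrightarrow> \<bar>\<phi> x\<bar> \<le> B"
    by (metis bounded_iff compact_imp_bounded imageI real_norm_def)
  have int: "integrable \<mu> (\<lambda>y. \<Sum>i<n. \<phi> ((f ^^ i) y))" for n
    by (intro Bochner_Integration.integrable_sum integrable_fn[OF meas B])
  have eq: "(\<integral>y. (\<Sum>i<n. \<phi> ((f ^^ i) y)) \<partial>\<mu>) = real n * (\<integral>x. \<phi> x \<partial>\<mu>)" for n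
    by (subst Bochner_Integration.integral_sum) (auto intro: integrable_fn[OF meas B] simp: integral_fn[OF meas])
  have "\<bar>(\<Sum>i<n. \<phi> ((f ^^ i) x)) - real n * (\<integral>x. \<phi> x \<partial>\<mu>)\<bar> \<le> e * real n" if n: "n \<ge> N" "x \<in> M" for n x
  proof -
    have "AE y in \<mu>. (\<Sum>i<n. \<phi> ((f ^^ i) y)) \<le> (\<Sum>i<n. \<phi> ((f ^^ i) x)) + e * real n"
      using AE_M by eventually_elim (use N n in \<open>force simp: abs_le_iff\<close>)
    from prob.integral_le_const[OF int this]
    have 1: "real n * (\<integral>x. \<phi> x \<partial>\<mu>) \<le> (\<Sum>i<n. \<phi> ((f ^^ i) x)) + e * real n" by (simp add: eq)
    have "AE y in \<mu>. (\<Sum>i<n. \<phi> ((f ^^ i) x)) - e * real n \<le> (\<Sum>i<n. \<phi> ((f ^^ i) y))"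
      using AE_M by eventually_elim (use N n in \<open>force simp: abs_le_iff\<close>)
    from prob.integral_ge_const[OF int this]
    have 2: "(\<Sum>i<n. \<phi> ((f ^^ i) x)) - e * real n \<le> real n * (\<integral>x. \<phi> x \<partial>\<mu>)" by (simp add: eq)
    from 1 2 show ?thesis by (simp add: abs_le_iff)
  qed
  then show ?thesis by blast
qed

abbreviation onM :: "(annulus \<Rightarrow> real) \<Rightarrow> annulus \<Rightarrow> real"
  where "onM u x \<equiv> (if x \<in> M then u x else 0)"

lemma envelope_integral_tendsto:
  assumes B: "\<forall>x\<in>M. \<bar>u x\<bar> \<le> B" and usc: "\<And>c. closed {x \<in> M. c \<le> u x}"
    and w: "w \<in> borel_measurable borel" "\<And>x. \<bar>w x\<bar> \<le> 1"
  shows "(\<lambda>k. \<integral>x. w x * lipschitz_envelope M u k x \<partial>\<mu>) \<longlonglongrightarrow> (\<integral>x. w x * onM u x \<partial>\<mu>)"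
proof (rule integral_dominated_convergence[where w="\<lambda>_. B"])
  note env = lipschitz_envelope[OF nonemptyM B usc]
  have m [measurable]: "lipschitz_envelope M u k \<in> borel_measurable borel" for k
    by (intro borel_measurable_continuous_onI continuous_lipschitz_envelope[OF nonemptyM B usc])
  note w(1)[measurable]
  note borel_measurable_semicontinuous[OF closedM usc, measurable]
  show "(\<lambda>x. w x * onM u x) \<in> borel_measurable \<mu>" by measurable
  show "(\<lambda>x. w x * lipschitz_envelope M u k x) \<in> borel_measurable \<mu>" for k by measurable
  show "integrable \<mu> (\<lambda>_. B)" by simp
  show "AE x in \<mu>. (\<lambda>k. w x * lipschitz_envelope M u k x) \<longlonglongrightarrow> w x * onM u x"
    using AE_M by eventually_elim (auto intro!: tendsto_intros env(4))
  show "AE x in \<mu>. norm (w x * lipschitz_envelope M u k x) \<le> B" for k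
    using AE_M
  proof eventually_elim
    case (elim x)
    have "\<bar>w x\<bar> * \<bar>lipschitz_envelope M u k x\<bar> \<le> 1 * B"
      using w(2) env(3)[OF elim] by (intro mult_mono) auto
    then show ?case by (simp add: abs_mult)
  qed
qed

text \<open>For an upper semicontinuous function the uniform convergence of averages survives as a uniform
  upper bound, by approximation from above.\<close>

lemma uniform_upper_average:
  assumes B: "\<forall>x\<in>M. \<bar>u x\<bar> \<le> B" and usc: "\<And>c. closed {x \<in> M. c \<le> u x}" and e: "e > 0"
  shows "\<exists>N. \<forall>n\<ge>N. \<forall>x\<in>M. (\<Sum>i<n. u ((f ^^ i) x)) \<le> real n * ((\<integral>x. onM u x \<partial>\<mu>) + e)"
proof -
  note env = lipschitz_envelope[OF nonemptyM B usc]
  have "(\<lambda>k. \<integral>x. lipschitz_envelope M u k x \<partial>\<mu>) \<longlonglongrightarrow> (\<integral>x. onM u x \<partial>\<mu>)"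
    using envelope_integral_tendsto[OF B usc, of "\<lambda>_. 1"] by simp
  then have "\<forall>\<^sub>F k in sequentially. (\<integral>x. lipschitz_envelope M u k x \<partial>\<mu>) < (\<integral>x. onM u x \<partial>\<mu>) + e/2"
    by (rule order_tendstoD) (use e in simp)
  then have "\<forall>\<^sub>F k in sequentially. (\<integral>x. lipschitz_envelope M u k x \<partial>\<mu>) < (\<integral>x. onM u x \<partial>\<mu>) + e/2 \<and> k > 0"
    using eventually_gt_at_top by (rule eventually_conj)
  then obtain k where k: "(\<integral>x. lipschitz_envelope M u k x \<partial>\<mu>) < (\<integral>x. onM u x \<partial>\<mu>) + e/2" "k > 0"
    using eventually_happens'[OF sequentially_bot] by blast
  obtain N where N: "\<forall>n\<ge>N. \<forall>x\<in>M. \<bar>(\<Sum>i<n. lipschitz_envelope M u k ((f ^^ i) x))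
      - real n * (\<integral>x. lipschitz_envelope M u k x \<partial>\<mu>)\<bar> \<le> e/2 * real n"
    using uniform_average_lipschitz[of "real k" "lipschitz_envelope M u k" "e/2"] env(1) k(2) e by auto
  have "(\<Sum>i<n. u ((f ^^ i) x)) \<le> real n * ((\<integral>x. onM u x \<partial>\<mu>) + e)" if n: "n \<ge> N" "x \<in> M" for n x
  proof -
    have "(\<Sum>i<n. u ((f ^^ i) x)) \<le> (\<Sum>i<n. lipschitz_envelope M u k ((f ^^ i) x))"
      by (intro sum_mono env(2)) (use n in simp)
    also have "\<dots> \<le> real n * (\<integral>x. lipschitz_envelope M u k x \<partial>\<mu>) + e/2 * real n"
    proof -
      have "\<bar>(\<Sum>i<n. lipschitz_envelope M u k ((f ^^ i) x)) - real n * (\<integral>x. lipschitz_envelope M u k x \<partial>\<mu>)\<bar>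
          \<le> e/2 * real n" using N n by blast
      then show ?thesis by linarith
    qed
    also have "\<dots> \<le> real n * ((\<integral>x. onM u x \<partial>\<mu>) + e/2) + e/2 * real n"
      using k(1) by (intro add_right_mono mult_left_mono) auto
    also have "\<dots> = real n * ((\<integral>x. onM u x \<partial>\<mu>) + e)" by (simp add: algebra_simps)
    finally show ?thesis .
  qed
  then show ?thesis by blast
qed

text \<open>The support is a nonempty closed invariant subset of the minimal set \<open>M\<close>.\<close>

lemma measure_support_eq: "measure_support \<mu> = M"
proof -
  let ?S = "measure_support \<mu>"
  have sub: "?S \<subseteq> M"
  proof
    fix x assume x: "x \<in> ?S"
    show "x \<in> M"
    proof (rule ccontr)
      assume "x \<notin> M"
      then have "emeasure \<mu> (- M) > 0"
        using x closedM by (auto simp: measure_support_def)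
      moreover have "emeasure \<mu> (- M) = 0"
        using AE_M by (subst (asm) AE_iff_measurable[of "- M"]) auto
      ultimately show False by simp
    qed
  qed
  have closed: "closed ?S"
  proof -
    have "- ?S = \<Union>{U. open U \<and> emeasure \<mu> U = 0}"
      by (auto simp: measure_support_def zero_less_iff_neq_zero simp del: split_paired_All)
    then have "open (- ?S)" by auto
    then show ?thesis by (simp add: closed_def)
  qed
  have nonempty: "?S \<noteq> {}"
  proof
    assume "?S = {}"
    then have "M \<subseteq> \<Union>{U. open U \<and> emeasure \<mu> U = 0}"
      by (auto simp: measure_support_def zero_less_iff_neq_zero simp del: split_paired_All)
    then obtain D where D: "D \<subseteq> {U. open U \<and> emeasure \<mu> U = 0}" "finite D" "M \<subseteq> \<Union>D"
      using compactM by (elim compactE) auto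
    have "(\<Union>U\<in>D. U) \<in> null_sets \<mu>"
    proof (rule null_sets_UN'[OF countable_finite[OF D(2)]])
      fix U assume "U \<in> D"
      then have "open U" "emeasure \<mu> U = 0" using D(1) by auto
      then show "U \<in> null_sets \<mu>" by (intro null_setsI) auto
    qed
    then have "\<Union>D \<in> null_sets \<mu>" by simp
    then have "emeasure \<mu> M \<le> 0"
      using emeasure_mono[OF D(3), of \<mu>] by (auto simp: null_sets_def)
    then show False using invariant by (simp add: invariant_prob_on_def)
  qed
  have 1: "f x \<in> ?S" if xS: "x \<in> ?S" for x
    unfolding measure_support_def
  proof (safe)
    fix U assume U: "open U" "f x \<in> U"
    have "open (f -` U)" using U(1) continuous_f[of UNIV] by (simp add: open_vimage)
    then have "emeasure \<mu> (f -` U) > 0" using xS U(2) by (auto simp: measure_support_def)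
    then show "emeasure \<mu> U > 0" using emeasure_preimage[of U] U(1) by simp
  qed
  have 2: "g x \<in> ?S" if xS: "x \<in> ?S" for x
    unfolding measure_support_def
  proof (safe)
    fix U assume U: "open U" "g x \<in> U"
    have o: "open (g -` U)" using U(1) continuous_g[of UNIV] by (simp add: open_vimage)
    then have "emeasure \<mu> (g -` U) > 0" using xS U(2) by (auto simp: measure_support_def)
    moreover have "emeasure \<mu> (f -` (g -` U)) = emeasure \<mu> (g -` U)"
      using o by (intro emeasure_preimage) simp
    moreover have "f -` (g -` U) = U" by (simp add: vimage_def)
    ultimately show "emeasure \<mu> U > 0" by simp
  qed
  have "f ` ?S = ?S"
  proof (intro set_eqI iffI)
    fix x assume "x \<in> ?S"
    then have "f (g x) \<in> f ` ?S" by (intro imageI 2)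
    then show "x \<in> f ` ?S" by simp
  qed (use 1 in blast)
  then show ?thesis using minimalM sub closed nonempty by blast
qed

section \<open>Lyapunov exponents\<close>

text \<open>The mean logarithmic stretching along the two extremal slope fields.\<close>

definition \<chi>max where "\<chi>max = (\<integral>x. onM (\<lambda>x. ln (lmax x)) x \<partial>\<mu>)"
definition \<chi>min where "\<chi>min = (\<integral>x. onM (\<lambda>x. ln (lmin x)) x \<partial>\<mu>)"

lemma ln_stretch_bounded: "\<exists>B>0. \<forall>x s. s \<in> slopes x \<longrightarrow> \<bar>ln (stretch x s)\<bar> \<le> B"
proof -
  obtain \<Lambda> where \<Lambda>: "\<Lambda> > 1" "\<And>x s. s \<in> slopes x \<Longrightarrow> stretch x s \<le> \<Lambda>"
    "\<And>x s. s \<in> slopes x \<Longrightarrow> 1 / \<Lambda> \<le> stretch x s" by (rule stretch_bounds) blast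
  have "\<bar>ln (stretch x s)\<bar> \<le> ln \<Lambda>" if s: "s \<in> slopes x" for x s
  proof -
    have "ln (stretch x s) \<le> ln \<Lambda>" using \<Lambda>(2)[OF s] stretch_pos[OF s] \<Lambda>(1) by simp
    moreover have "ln (1 / \<Lambda>) \<le> ln (stretch x s)"
      using \<Lambda>(3)[OF s] stretch_pos[OF s] \<Lambda>(1) by (subst ln_le_cancel_iff) auto
    then have "- ln \<Lambda> \<le> ln (stretch x s)" using \<Lambda>(1) by (simp add: ln_div)
    ultimately show ?thesis by (simp add: abs_le_iff)
  qed
  moreover have "ln \<Lambda> > 0" using \<Lambda>(1) by simp
  ultimately show ?thesis by blast
qed

definition ln_bound where "ln_bound = (SOME B. B > 0 \<and> (\<forall>x s. s \<in> slopes x \<longrightarrow> \<bar>ln (stretch x s)\<bar> \<le> B))"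

lemma ln_bound: "ln_bound > 0" "x \<in> M \<Longrightarrow> \<bar>ln (lmax x)\<bar> \<le> ln_bound" "x \<in> M \<Longrightarrow> \<bar>ln (lmin x)\<bar> \<le> ln_bound"
  using someI_ex[OF ln_stretch_bounded, folded ln_bound_def] smax_in[of x] smin_in[of x]
  unfolding lmax_def lmin_def by blast+

lemma usc_ln_lmax: "closed {x \<in> M. k \<le> ln (lmax x)}"
proof -
  have "{x \<in> M. k \<le> ln (lmax x)} = {x \<in> M. exp k \<le> lmax x}"
    using lmax_pos by (auto simp: ln_ge_iff)
  then show ?thesis using closed_lmax_superlevel by simp
qed

lemma usc_ln_lmin: "closed {x \<in> M. k \<le> - ln (lmin x)}"
proof -
  have "k \<le> - ln (lmin x) \<longleftrightarrow> lmin x \<le> exp (- k)" if "x \<in> M" for x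
  proof -
    have "ln (lmin x) \<le> - k \<longleftrightarrow> lmin x \<le> exp (- k)"
      using ln_le_cancel_iff[OF lmin_pos[OF that], of "exp (- k)"] by simp
    then show ?thesis by linarith
  qed
  then have "{x \<in> M. k \<le> - ln (lmin x)} = {x \<in> M. lmin x \<le> exp (- k)}" by blast
  then show ?thesis using closed_lmin_sublevel by simp
qed

lemma measurable_lmax [measurable]: "onM (\<lambda>x. ln (lmax x)) \<in> borel_measurable borel"
  by (rule borel_measurable_semicontinuous[OF closedM usc_ln_lmax])

lemma onM_uminus: "onM (\<lambda>x. - ln (lmin x)) = (\<lambda>x. - onM (\<lambda>x. ln (lmin x)) x)"
  by auto

lemma measurable_lmin [measurable]: "onM (\<lambda>x. ln (lmin x)) \<in> borel_measurable borel"
  using borel_measurable_semicontinuous[OF closedM usc_ln_lmin] unfolding onM_uminus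
  by (simp add: borel_measurable_uminus_eq)

lemma integrable_lmax: "integrable \<mu> (onM (\<lambda>x. ln (lmax x)))"
  and integrable_lmin: "integrable \<mu> (onM (\<lambda>x. ln (lmin x)))"
  by (rule integrable_bounded_on_M[of _ ln_bound]; use ln_bound in simp)+

lemma ln_prod_lmax: "x \<in> M \<Longrightarrow> ln (\<Prod>i<n. lmax ((f ^^ i) x)) = (\<Sum>i<n. ln (lmax ((f ^^ i) x)))"
  by (rule ln_prod, simp, metis funpow_f_M lmax_pos less_irrefl)

lemma ln_prod_lmin: "x \<in> M \<Longrightarrow> ln (\<Prod>i<n. lmin ((f ^^ i) x)) = (\<Sum>i<n. ln (lmin ((f ^^ i) x)))"
  by (rule ln_prod, simp, metis funpow_f_M lmin_pos less_irrefl)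

lemma prod_lmax_pos: "x \<in> M \<Longrightarrow> (\<Prod>i<n. lmax ((f ^^ i) x)) > 0"
  and prod_lmin_pos: "x \<in> M \<Longrightarrow> (\<Prod>i<n. lmin ((f ^^ i) x)) > 0"
  by (intro prod_pos; simp add: lmax_pos lmin_pos)+

lemma uniform_upper_lmax:
  assumes "e > 0"
  shows "\<exists>N. \<forall>n\<ge>N. \<forall>x\<in>M. (\<Sum>i<n. ln (lmax ((f ^^ i) x))) \<le> real n * (\<chi>max + e)"
  unfolding \<chi>max_def by (rule uniform_upper_average[OF _ usc_ln_lmax assms]) (use ln_bound(2) in blast)

lemma uniform_lower_lmin:
  assumes "e > 0"
  shows "\<exists>N. \<forall>n\<ge>N. \<forall>x\<in>M. real n * (\<chi>min - e) \<le> (\<Sum>i<n. ln (lmin ((f ^^ i) x)))"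
proof -
  have "\<exists>N. \<forall>n\<ge>N. \<forall>x\<in>M. (\<Sum>i<n. - ln (lmin ((f ^^ i) x))) \<le> real n * ((\<integral>x. onM (\<lambda>x. - ln (lmin x)) x \<partial>\<mu>) + e)"
    by (rule uniform_upper_average[OF _ usc_ln_lmin assms, of ln_bound]) (use ln_bound(3) in simp)
  moreover have "(\<integral>x. onM (\<lambda>x. - ln (lmin x)) x \<partial>\<mu>) = - \<chi>min"
    unfolding onM_uminus \<chi>min_def by simp
  ultimately show ?thesis by (simp add: sum_negf algebra_simps)
qed

text \<open>Signs of the extremal exponents: a negative \<open>\<chi>max\<close> would make an iterate of \<open>f\<close> a
  contraction along \<open>M\<close>, a positive \<open>\<chi>min\<close> an iterate of the inverse.\<close>

lemma \<chi>max_nonneg: "\<chi>max \<ge> 0"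
proof (rule ccontr)
  assume "\<not> \<chi>max \<ge> 0"
  then have neg: "- \<chi>max / 2 > 0" by simp
  obtain N where N: "\<And>n x. n \<ge> N \<Longrightarrow> x \<in> M \<Longrightarrow> (\<Sum>i<n. ln (lmax ((f ^^ i) x))) \<le> real n * (\<chi>max + - \<chi>max / 2)"
    using uniform_upper_lmax[OF neg] by blast
  obtain n0 where n0: "ln 2 < real n0 * (- \<chi>max / 2)" using reals_Archimedean3[OF neg] by blast
  define n where "n = max N n0"
  have small: "(\<Prod>i<n. lmax ((f ^^ i) x)) \<le> 1/2" if x: "x \<in> M" for x
  proof -
    have "real n0 * (- \<chi>max / 2) \<le> real n * (- \<chi>max / 2)"
      using neg by (intro mult_right_mono) (auto simp: n_def)
    then have "ln (\<Prod>i<n. lmax ((f ^^ i) x)) \<le> - ln 2"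
      using N[of n x] x n0 by (simp add: n_def ln_prod_lmax)
    also have "- ln 2 = ln (1/2 :: real)" by (simp add: ln_div)
    finally show ?thesis using prod_lmax_pos[OF x] by (subst (asm) ln_le_cancel_iff) auto
  qed
  show False
  proof (rule no_contraction[of "f ^^ n"])
    show "(f ^^ n) ` M = M" by (rule funpow_image[OF fM])
    fix x v assume v: "v \<in> P x"
    have x: "x \<in> M" using paratingent_cone_in_closure[OF v closedM] .
    have "(\<Prod>i<n. lmax ((f ^^ i) x)) * \<bar>fst v\<bar> \<le> 1/2 * \<bar>fst v\<bar>"
      using small[OF x] by (intro mult_right_mono) auto
    then show "\<bar>fst (Dfn n x v)\<bar> \<le> 1/2 * \<bar>fst v\<bar>"
      using fst_Dfn_bounds(1)[OF x v, of n] by linarith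
  qed (intro C1_map_funpow C1f)
qed

lemma fn_gn: "(f ^^ n) ((g ^^ n) x) = x"
proof (induction n arbitrary: x)
  case (Suc n)
  have "(f ^^ Suc n) ((g ^^ Suc n) x) = f ((f ^^ n) ((g ^^ n) (g x)))"
    by (simp add: funpow_swap1)
  then show ?case using Suc by simp
qed simp

lemma \<chi>min_nonpos: "\<chi>min \<le> 0"
proof (rule ccontr)
  assume "\<not> \<chi>min \<le> 0"
  then have pos: "\<chi>min / 2 > 0" by simp
  obtain N where N: "\<And>n x. n \<ge> N \<Longrightarrow> x \<in> M \<Longrightarrow> real n * (\<chi>min - \<chi>min / 2) \<le> (\<Sum>i<n. ln (lmin ((f ^^ i) x)))"
    using uniform_lower_lmin[OF pos] by blast
  obtain n0 where n0: "ln 2 < real n0 * (\<chi>min / 2)" using reals_Archimedean3[OF pos] by blast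
  define n where "n = max N n0"
  have big: "2 \<le> (\<Prod>i<n. lmin ((f ^^ i) x))" if x: "x \<in> M" for x
  proof -
    have "real n0 * (\<chi>min / 2) \<le> real n * (\<chi>min / 2)"
      using pos by (intro mult_right_mono) (auto simp: n_def)
    then have "ln 2 \<le> ln (\<Prod>i<n. lmin ((f ^^ i) x))"
      using N[of n x] x n0 by (simp add: n_def ln_prod_lmin)
    then show ?thesis using prod_lmin_pos[OF x] by (subst (asm) ln_le_cancel_iff) auto
  qed
  have gnM: "(g ^^ n) ` M = M" for n
    by (rule funpow_image[OF gM])
  have Cgn: "C1_map (g ^^ n)" by (intro C1_map_funpow C1g)
  show False
  proof (rule no_contraction[OF Cgn gnM])
    fix x v assume v: "v \<in> P x"
    have x: "x \<in> M" using paratingent_cone_in_closure[OF v closedM] .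
    let ?y = "(g ^^ n) x" and ?w = "tangent_map (g ^^ n) x v"
    have y: "?y \<in> M" using gnM x by blast
    have w: "?w \<in> P ?y" using paratingent_cone_image[OF Cgn _ v, of M] gnM by simp
    have "tangent_map (f ^^ n \<circ> g ^^ n) x v = Dfn n ?y ?w"
      by (rule tangent_map_compose[OF C1_map_funpow[OF C1f] Cgn])
    moreover have "f ^^ n \<circ> g ^^ n = (\<lambda>x. x)" using fn_gn by (intro ext) simp
    ultimately have vw: "Dfn n ?y ?w = v" by simp
    have "2 * \<bar>fst ?w\<bar> \<le> (\<Prod>i<n. lmin ((f ^^ i) ?y)) * \<bar>fst ?w\<bar>"
      using big[OF y] by (intro mult_right_mono) auto
    then show "\<bar>fst ?w\<bar> \<le> 1/2 * \<bar>fst v\<bar>"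
      using fst_Dfn_bounds(2)[OF y w, of n] by (simp add: vw)
  qed
qed

lemma gapM_measurable [measurable]: "onM gap \<in> borel_measurable borel"
  by (rule borel_measurable_semicontinuous[OF closedM closed_gap_superlevel])

lemma gap_funpow_eq_0_iff: "x \<in> M \<Longrightarrow> gap ((f ^^ n) x) = 0 \<longleftrightarrow> gap x = 0"
  by (induction n) (auto simp: gap_f_eq_0_iff)

text \<open>Every orbit in \<open>M\<close> spends near the closed set where the gap is at least \<open>e\<close> at least the fraction of time given by
  the measure of that set, while orbits in the invariant set \<open>A\<close> never meet it. The formal argument integrates
  the averages of Lipschitz majorants of the indicator function over \<open>A\<close>.\<close>

lemma gap_superlevel_visits:
  assumes "e > 0"
  defines "A \<equiv> {x \<in> M. gap x = 0}"
  assumes A: "A \<in> sets borel"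
  shows "prob.prob A * prob.prob {x \<in> M. e \<le> gap x} = 0"
proof -
  define C where "C = {x \<in> M. e \<le> gap x}"
  have CM: "C \<subseteq> M" by (auto simp: C_def)
  have clC: "closed C" unfolding C_def by (rule closed_gap_superlevel)
  define u where "u = (indicat_real C)"
  have B: "\<forall>x\<in>M. \<bar>u x\<bar> \<le> 1" by (simp add: u_def indicator_def)
  have usc: "closed {x \<in> M. k \<le> u x}" for k
  proof -
    have "{x \<in> M. k \<le> u x} = (if k \<le> 0 then M else if k \<le> 1 then C else {})"
      using CM by (auto simp: u_def indicator_def)
    then show ?thesis using closedM clC by simp
  qed
  note env = lipschitz_envelope[OF nonemptyM B usc]
  let ?E = "lipschitz_envelope M u"
  have mE [measurable]: "?E k \<in> borel_measurable borel" for k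
    by (intro borel_measurable_continuous_onI continuous_lipschitz_envelope[OF nonemptyM B usc])
  note A [measurable]
  define w where "w = indicat_real A"
  have mw [measurable]: "w \<in> borel_measurable borel" by (simp add: w_def A)
  have w1: "\<bar>w x\<bar> \<le> 1" "0 \<le> w x" for x by (simp_all add: w_def indicator_def)
  have wf: "w ((f ^^ i) x) = w x" if "x \<in> M" for x i
    using that gap_funpow_eq_0_iff by (simp add: w_def A_def indicator_def)
  have iw: "(\<integral>x. w x \<partial>\<mu>) = prob.prob A" by (simp add: w_def)
  have intw: "integrable \<mu> w" by (rule integrable_bounded_on_M[OF mw w1(1)])
  have bE: "\<bar>w x * ?E k x\<bar> \<le> 1" if "x \<in> M" for x k
    using mult_mono[of "\<bar>w x\<bar>" 1 "\<bar>?E k x\<bar>" 1] w1 env(3)[OF that] by (simp add: abs_mult)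
  have low: "prob.prob A * prob.prob C \<le> (\<integral>x. w x * ?E k x \<partial>\<mu>)" if k: "k > 0" for k
  proof (rule field_le_epsilon)
    fix d :: real assume d: "d > 0"
    have Cle: "prob.prob C \<le> (\<integral>x. ?E k x \<partial>\<mu>)"
    proof -
      have "(\<integral>x. u x \<partial>\<mu>) \<le> (\<integral>x. ?E k x \<partial>\<mu>)"
      proof (rule integral_mono_AE)
        show "integrable \<mu> u"
          by (rule integrable_bounded_on_M[of u 1]) (use clC B in \<open>auto simp: u_def\<close>)
        show "integrable \<mu> (?E k)" by (rule integrable_bounded_on_M[OF mE env(3)])
        show "AE x in \<mu>. u x \<le> ?E k x" using AE_M by eventually_elim (rule env(2))
      qed
      then show ?thesis by (simp add: u_def)
    qed
    obtain N where N: "\<forall>n\<ge>N. \<forall>x\<in>M. \<bar>(\<Sum>i<n. ?E k ((f ^^ i) x)) - real n * (\<integral>x. ?E k x \<partial>\<mu>)\<bar> \<le> d * real n"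
      using uniform_average_lipschitz[of "real k" "?E k" d] env(1) k d by auto
    define n where "n = Suc N"
    have pt: "real n * (prob.prob C - d) \<le> (\<Sum>i<n. ?E k ((f ^^ i) x))" if x: "x \<in> M" for x
    proof -
      have "\<bar>(\<Sum>i<n. ?E k ((f ^^ i) x)) - real n * (\<integral>x. ?E k x \<partial>\<mu>)\<bar> \<le> d * real n"
      proof -
        have "n \<ge> N" by (simp add: n_def)
        then show ?thesis using N x by blast
      qed
      moreover have "real n * prob.prob C \<le> real n * (\<integral>x. ?E k x \<partial>\<mu>)"
        using Cle by (intro mult_left_mono) auto
      ultimately show ?thesis by (simp add: algebra_simps abs_le_iff)
    qed
    have "(\<integral>x. w x * (real n * (prob.prob C - d)) \<partial>\<mu>) \<le> (\<integral>x. (\<Sum>i<n. w ((f ^^ i) x) * ?E k ((f ^^ i) x)) \<partial>\<mu>)"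
    proof (rule integral_mono_AE)
      show "integrable \<mu> (\<lambda>x. w x * (real n * (prob.prob C - d)))" using intw by simp
      show "integrable \<mu> (\<lambda>x. \<Sum>i<n. w ((f ^^ i) x) * ?E k ((f ^^ i) x))"
        by (intro Bochner_Integration.integrable_sum integrable_fn[where h="\<lambda>x. w x * ?E k x" and B=1] bE) measurable
      show "AE x in \<mu>. w x * (real n * (prob.prob C - d)) \<le> (\<Sum>i<n. w ((f ^^ i) x) * ?E k ((f ^^ i) x))"
        using AE_M
      proof eventually_elim
        case (elim x)
        have "w x * (real n * (prob.prob C - d)) \<le> w x * (\<Sum>i<n. ?E k ((f ^^ i) x))"
          by (intro mult_left_mono pt elim w1)
        then show ?case by (simp add: wf[OF elim] sum_distrib_left)
      qed
    qed
    also have "\<dots> = (\<Sum>i<n. \<integral>x. w ((f ^^ i) x) * ?E k ((f ^^ i) x) \<partial>\<mu>)"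
      by (intro Bochner_Integration.integral_sum integrable_fn[where h="\<lambda>x. w x * ?E k x" and B=1] bE) measurable
    also have "\<dots> = real n * (\<integral>x. w x * ?E k x \<partial>\<mu>)"
      using integral_fn[of "\<lambda>x. w x * ?E k x"] by simp
    finally have "(\<integral>x. w x \<partial>\<mu>) * (real n * (prob.prob C - d)) \<le> real n * (\<integral>x. w x * ?E k x \<partial>\<mu>)"
      unfolding integral_mult_left_zero .
    then have "real n * (prob.prob A * (prob.prob C - d)) \<le> real n * (\<integral>x. w x * ?E k x \<partial>\<mu>)"
      by (simp only: iw mult.left_commute)
    then have "prob.prob A * (prob.prob C - d) \<le> (\<integral>x. w x * ?E k x \<partial>\<mu>)"
      by (simp add: n_def del: of_nat_Suc)
    moreover have "prob.prob A * d \<le> 1 * d" using d by (intro mult_right_mono) auto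
    ultimately show "prob.prob A * prob.prob C \<le> (\<integral>x. w x * ?E k x \<partial>\<mu>) + d"
      by (simp add: right_diff_distrib)
  qed
  have "(\<lambda>k. \<integral>x. w x * ?E k x \<partial>\<mu>) \<longlonglongrightarrow> (\<integral>x. w x * onM u x \<partial>\<mu>)"
    by (rule envelope_integral_tendsto[OF B usc mw w1(1)])
  moreover have "(\<lambda>x. w x * onM u x) = (\<lambda>x. 0)"
    using assms(1) by (auto simp: w_def u_def A_def C_def indicator_def)
  ultimately have "(\<lambda>k. \<integral>x. w x * ?E k x \<partial>\<mu>) \<longlonglongrightarrow> 0" by simp
  then have "prob.prob A * prob.prob C \<le> 0"
    by (rule tendsto_lowerbound[OF _ eventually_mono[OF eventually_gt_at_top[of 0] low]]) simp_all
  moreover have "0 \<le> prob.prob A * prob.prob C" by simp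
  ultimately show ?thesis unfolding C_def by linarith
qed

text \<open>A substitute for ergodicity: the set where the gap is positive is a countable union of the closed sets of the
  previous lemma, one of which has positive measure.\<close>

lemma gap_dichotomy:
  assumes "\<not> (AE x in \<mu>. gap x = 0)" shows "AE x in \<mu>. gap x > 0"
proof -
  define A where "A = {x \<in> M. gap x = 0}"
  define C where "C = (\<lambda>n. {x \<in> M. inverse (real (Suc n)) \<le> gap x})"
  have Cm [measurable]: "C n \<in> sets borel" for n unfolding C_def using closed_gap_superlevel by simp
  have AC: "A = M - (\<Union>n. C n)"
  proof (intro set_eqI iffI)
    fix x assume x: "x \<in> M - (\<Union>n. C n)"
    have "gap x \<le> 0"
    proof (rule ccontr)
      assume "\<not> gap x \<le> 0"
      then obtain n where "inverse (real (Suc n)) < gap x" using reals_Archimedean[of "gap x"] by auto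
      then have "x \<in> C n" using x by (simp add: C_def less_imp_le)
      then show False using x by blast
    qed
    then show "x \<in> A" using gap_nonneg[of x] x by (auto simp: A_def)
  next
    fix x assume x: "x \<in> A"
    have "x \<notin> C n" for n
    proof
      assume "x \<in> C n"
      then have "inverse (real (Suc n)) \<le> 0" using x by (simp add: A_def C_def)
      moreover have "inverse (real (Suc n)) > 0" by simp
      ultimately show False by linarith
    qed
    then show "x \<in> M - (\<Union>n. C n)" using x by (auto simp: A_def)
  qed
  have Am [measurable]: "A \<in> sets borel" unfolding AC by measurable
  have "\<exists>n. prob.prob (C n) \<noteq> 0"
  proof (rule ccontr)
    assume "\<not> ?thesis"
    then have "AE x in \<mu>. x \<notin> C n" for n
      by (subst AE_iff_measurable[of "C n"]) (auto simp: prob.emeasure_eq_measure)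
    then have "AE x in \<mu>. \<forall>n. x \<notin> C n" by (simp add: AE_all_countable)
    then have "AE x in \<mu>. gap x = 0"
      using AE_M
    proof eventually_elim
      case (elim x)
      then have "x \<in> A" unfolding AC by blast
      then show ?case by (simp add: A_def)
    qed
    then show False using assms by blast
  qed
  then obtain n where n: "prob.prob (C n) \<noteq> 0" by blast
  have "prob.prob A * prob.prob (C n) = 0"
    using gap_superlevel_visits[of "inverse (real (Suc n))"] Am unfolding A_def C_def by simp
  then have "prob.prob A = 0" using n by simp
  then have "AE x in \<mu>. x \<notin> A"
    by (subst AE_iff_measurable[of A]) (auto simp: prob.emeasure_eq_measure)
  then show ?thesis
    using AE_M
  proof eventually_elim
    case (elim x)
    then show ?case using gap_nonneg[of x] by (auto simp: A_def less_le)
  qed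
qed

lemma \<chi>min_less_\<chi>max:
  assumes "AE x in \<mu>. gap x > 0" shows "\<chi>min < \<chi>max"
proof -
  let ?h = "\<lambda>x. onM (\<lambda>x. ln (lmax x)) x - onM (\<lambda>x. ln (lmin x)) x"
  have int: "integrable \<mu> ?h" using integrable_lmax integrable_lmin by (rule Bochner_Integration.integrable_diff)
  have pos: "AE x in \<mu>. 0 < ?h x"
    using assms AE_M
  proof eventually_elim
    case (elim x)
    then have "lmin x < lmax x" unfolding lmin_def lmax_def by (intro stretch_strict_mono) (simp add: gap_def)
    then show ?case using elim lmin_pos[OF elim(2)] by simp
  qed
  then have nn: "AE x in \<mu>. 0 \<le> ?h x" by eventually_elim simp
  have "(\<integral>x. ?h x \<partial>\<mu>) \<noteq> 0"
  proof
    assume "(\<integral>x. ?h x \<partial>\<mu>) = 0"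
    then have "AE x in \<mu>. ?h x = 0" using integral_nonneg_eq_0_iff_AE[OF int nn] by blast
    with pos have "AE x in \<mu>. False" by eventually_elim simp
    then show False by simp
  qed
  moreover have "0 \<le> (\<integral>x. ?h x \<partial>\<mu>)" using nn by (rule integral_nonneg_AE)
  moreover have "(\<integral>x. ?h x \<partial>\<mu>) = \<chi>max - \<chi>min"
    unfolding \<chi>max_def \<chi>min_def by (intro Bochner_Integration.integral_diff integrable_lmax integrable_lmin)
  ultimately show ?thesis by linarith
qed

text \<open>By conservation of area \<open>ln lmin + ln lmax\<close> equals \<open>ln gap - ln (gap \<circ> f)\<close>, so its sums along
  orbits telescope. The end term \<open>W \<circ> f\<^sup>n\<close> has the same distribution as \<open>W\<close>, which is finite almost everywhere.
  Divided by \<open>n\<close> and truncated at the bound known for the averages, it tends to 0 in mean.\<close>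

lemma \<chi>_sum_nonpos:
  assumes gap: "AE x in \<mu>. gap x > 0" shows "\<chi>min + \<chi>max \<le> 0"
proof -
  note B = ln_bound
  define W where "W = (\<lambda>x. ln (2 * slope_bound) - ln (onM gap x))"
  (* truncation above at the bound for the averages, and below at 0 *)
  define h where "h = (\<lambda>n x. max 0 (min (2 * ln_bound) (W x / real n)))"
  have Wm [measurable]: "W \<in> borel_measurable borel" unfolding W_def by measurable
  have hm [measurable]: "h n \<in> borel_measurable borel" for n unfolding h_def by measurable
  have hb: "\<bar>h n x\<bar> \<le> 2 * ln_bound" for n x using B(1) by (simp add: h_def)
  let ?s = "\<lambda>x. onM (\<lambda>x. ln (lmin x)) x + onM (\<lambda>x. ln (lmax x)) x"
  have ints: "integrable \<mu> (\<lambda>x. ?s ((f ^^ i) x))" for i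
    by (rule integrable_fn[of ?s "2 * ln_bound"]) (measurable, use B in \<open>force simp: abs_le_iff\<close>)
  have ints0: "integrable \<mu> ?s" by (rule Bochner_Integration.integrable_add[OF integrable_lmin integrable_lmax])
  have step: "ln (lmin x) + ln (lmax x) = ln (gap x) - ln (gap (f x))" if "x \<in> M" "gap x > 0" for x
  proof -
    have "gap (f x) > 0" using gap_f_eq_0_iff[OF that(1)] gap_nonneg[of "f x"] that by (simp add: less_le)
    then show ?thesis
      using gap_f[OF that(1), symmetric] lmin_pos[OF that(1)] lmax_pos[OF that(1)] by (simp add: ln_mult)
  qed
  have tel: "(\<Sum>i<n. ?s ((f ^^ i) x)) = ln (gap x) - ln (gap ((f ^^ n) x)) \<and> gap ((f ^^ n) x) > 0"
    if x: "x \<in> M" "gap x > 0" for x n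
  proof (induction n)
    case (Suc n)
    have y: "(f ^^ n) x \<in> M" "gap ((f ^^ n) x) > 0" using x Suc by auto
    have "gap ((f ^^ Suc n) x) \<noteq> 0" using gap_funpow_eq_0_iff[OF x(1), of "Suc n"] x(2) by simp
    then have "gap ((f ^^ Suc n) x) > 0" using gap_nonneg[of "(f ^^ Suc n) x"] x(1) by (simp add: less_le)
    then show ?case using Suc step[OF y] y(1) by simp
  qed (use x in simp)
  have bound: "\<chi>min + \<chi>max \<le> (\<integral>x. h n x \<partial>\<mu>)" if n: "n > 0" for n
  proof -
    have "real n * (\<chi>min + \<chi>max) = (\<Sum>i<n. \<integral>x. ?s ((f ^^ i) x) \<partial>\<mu>)"
      using integral_fn[of ?s] Bochner_Integration.integral_add[OF integrable_lmin integrable_lmax]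
      by (simp add: \<chi>min_def \<chi>max_def)
    also have "\<dots> = (\<integral>x. (\<Sum>i<n. ?s ((f ^^ i) x)) \<partial>\<mu>)"
      by (rule Bochner_Integration.integral_sum[symmetric]) (rule ints)
    also have "\<dots> \<le> (\<integral>x. real n * h n ((f ^^ n) x) \<partial>\<mu>)"
    proof (rule integral_mono_AE)
      show "integrable \<mu> (\<lambda>x. \<Sum>i<n. ?s ((f ^^ i) x))" by (intro Bochner_Integration.integrable_sum ints)
      show "integrable \<mu> (\<lambda>x. real n * h n ((f ^^ n) x))"
        by (intro Bochner_Integration.integrable_mult_right integrable_fn[OF hm hb])
      show "AE x in \<mu>. (\<Sum>i<n. ?s ((f ^^ i) x)) \<le> real n * h n ((f ^^ n) x)"
        using gap AE_M
      proof eventually_elim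
        case (elim x)
        have y: "(f ^^ n) x \<in> M" using elim by simp
        have t: "(\<Sum>i<n. ?s ((f ^^ i) x)) = ln (gap x) - ln (gap ((f ^^ n) x))" "gap ((f ^^ n) x) > 0"
          using tel[OF elim(2,1)] by auto
        have "ln (gap x) \<le> ln (2 * slope_bound)"
          using gap_le[OF elim(2)] elim(1) by simp
        then have 1: "(\<Sum>i<n. ?s ((f ^^ i) x)) \<le> real n * (W ((f ^^ n) x) / real n)"
          using n y t by (simp add: W_def)
        have "(\<Sum>i<n. ?s ((f ^^ i) x)) \<le> (\<Sum>i<n. 2 * ln_bound)"
        proof (rule sum_mono)
          fix i
          have "(f ^^ i) x \<in> M" using elim by simp
          then show "?s ((f ^^ i) x) \<le> 2 * ln_bound" using B(2,3)[of "(f ^^ i) x"] by (simp add: abs_le_iff)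
        qed
        then have 2: "(\<Sum>i<n. ?s ((f ^^ i) x)) \<le> real n * (2 * ln_bound)" by simp
        have "real n * min (2 * ln_bound) (W ((f ^^ n) x) / real n) \<le> real n * h n ((f ^^ n) x)"
          unfolding h_def by (intro mult_left_mono) auto
        then show ?case using 1 2 by (auto simp: min_def split: if_splits)
      qed
    qed
    also have "\<dots> = real n * (\<integral>x. h n x \<partial>\<mu>)" using integral_fn[OF hm, of n n] by simp
    finally show ?thesis using n by simp
  qed
  have "(\<lambda>n. \<integral>x. h n x \<partial>\<mu>) \<longlonglongrightarrow> (\<integral>x. 0 \<partial>\<mu>)"
  proof (rule integral_dominated_convergence[where w="\<lambda>_. 2 * ln_bound"])
    show "AE x in \<mu>. (\<lambda>n. h n x) \<longlonglongrightarrow> 0"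
    proof (rule AE_I2)
      fix x
      have "(\<lambda>n. max 0 (min (2 * ln_bound) (W x / real n))) \<longlonglongrightarrow> max 0 (min (2 * ln_bound) 0)"
        by (intro tendsto_intros lim_const_over_n)
      then show "(\<lambda>n. h n x) \<longlonglongrightarrow> 0" using B(1) by (simp add: h_def)
    qed
  qed (use hb in auto)
  then have lim: "(\<lambda>n. \<integral>x. h n x \<partial>\<mu>) \<longlonglongrightarrow> 0" by simp
  show ?thesis
    by (rule tendsto_lowerbound[OF lim eventually_mono[OF eventually_gt_at_top[of 0] bound]]) simp_all
qed

text \<open>The determinant of two tangent vectors.\<close>

definition wedge :: "real \<times> real \<Rightarrow> real \<times> real \<Rightarrow> real"
  where "wedge v w = fst v * snd w - snd v * fst w"

lemma wedge_Df: "wedge (Df x v) (Df x w) = wedge v w"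
proof -
  have "wedge (Df x v) (Df x w) = (a x * d x - b x * c x) * wedge v w"
    by (simp add: wedge_def Df_eq algebra_simps)
  then show ?thesis by (simp add: det1)
qed

lemma wedge_Dfn: "wedge (Dfn n x v) (Dfn n x w) = wedge v w"
  by (induction n) (simp_all add: tangent_map_funpow_Suc[OF C1f] wedge_Df del: funpow.simps)

lemma abs_wedge_le: "\<bar>wedge v w\<bar> \<le> 2 * norm v * norm w"
proof -
  have "\<bar>wedge v w\<bar> \<le> \<bar>fst v\<bar> * \<bar>snd w\<bar> + \<bar>snd v\<bar> * \<bar>fst w\<bar>"
    unfolding wedge_def abs_mult[symmetric] by linarith
  also have "\<dots> \<le> norm v * norm w + norm v * norm w"
    by (intro add_mono mult_mono abs_fst_le_norm abs_snd_le_norm) auto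
  finally show ?thesis by simp
qed

lemma norm_slope_le: "s \<in> slopes x \<Longrightarrow> norm (1 :: real, \<sigma> * s) \<le> 1 + slope_bound"
proof -
  assume s: "s \<in> slopes x"
  have "norm (1 :: real, \<sigma> * s) \<le> \<bar>1\<bar> + \<bar>\<sigma> * s\<bar>"
    using sqrt_sum_squares_le_sum_abs[of 1 "\<sigma> * s"] by (simp add: norm_Pair)
  then show ?thesis using slopes_bounded[OF s] sigma by (simp add: abs_mult)
qed

text \<open>A vector without exponential growth or decay prevents \<open>lmin\<close> from contracting exponentially: either it
  lies in the direction of slope \<open>smin\<close>, or the area it spans with that direction is preserved.\<close>

lemma lmin_product_lower:
  assumes x: "x \<in> M" and v: "v \<noteq> 0"
  obtains K where "\<And>n. - ln (\<Prod>i<n. lmin ((f ^^ i) x)) \<le> \<bar>ln (norm (Dfn n x v))\<bar> + K"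
proof -
  define e where "e = (1 :: real, \<sigma> * smin x)"
  define L where "L = (\<lambda>n. \<Prod>i<n. lmin ((f ^^ i) x))"
  define en where "en = (\<lambda>n. (1 :: real, \<sigma> * smin ((f ^^ n) x)))"
  have L: "L n > 0" for n unfolding L_def by (rule prod_lmin_pos[OF x])
  have De: "Dfn n x e = L n *\<^sub>R en n" for n unfolding e_def L_def en_def by (rule Dfn_smin[OF x])
  have en: "norm (en n) \<le> 1 + slope_bound" "norm (en n) > 0" for n
    unfolding en_def using norm_slope_le[OF smin_in] x by (auto simp: zero_prod_def)
  have sb: "1 + slope_bound > 1" using slope_bound(1) by simp
  have "\<exists>K. \<forall>n. - ln (L n) \<le> \<bar>ln (norm (Dfn n x v))\<bar> + K"
  proof (cases "wedge v e = 0")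
    case True
    then have sv: "snd v = fst v * (\<sigma> * smin x)" by (simp add: wedge_def e_def)
    then have ve: "v = fst v *\<^sub>R e" by (simp add: e_def prod_eq_iff)
    have v1: "fst v \<noteq> 0" using v sv by (auto simp: prod_eq_iff)
    have "- ln (L n) \<le> \<bar>ln (norm (Dfn n x v))\<bar> + (ln \<bar>fst v\<bar> + ln (1 + slope_bound))" for n
    proof -
      have "Dfn n x v = fst v *\<^sub>R Dfn n x e"
        using ve linear_scale[OF linear_tangent_map[OF C1_map_funpow[OF C1f]]] by metis
      then have "norm (Dfn n x v) = \<bar>fst v\<bar> * (L n * norm (en n))"
        using L[of n] by (simp add: De abs_mult)
      then have "ln (norm (Dfn n x v)) = ln \<bar>fst v\<bar> + (ln (L n) + ln (norm (en n)))"
        using v1 L[of n] en(2)[of n] by (simp add: ln_mult)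
      moreover have "ln (norm (en n)) \<le> ln (1 + slope_bound)"
        using en[of n] sb by simp
      ultimately show ?thesis by linarith
    qed
    then show ?thesis by blast
  next
    case False
    have "- ln (L n) \<le> \<bar>ln (norm (Dfn n x v))\<bar> + (ln (2 * (1 + slope_bound)) - ln \<bar>wedge v e\<bar>)" for n
    proof -
      have le: "\<bar>wedge v e\<bar> \<le> 2 * norm (Dfn n x v) * norm (L n *\<^sub>R en n)"
        using abs_wedge_le[of "Dfn n x v" "Dfn n x e"] unfolding wedge_Dfn unfolding De .
      then have n0: "norm (Dfn n x v) > 0" using False by (auto simp: less_le)
      have "2 * norm (Dfn n x v) * norm (L n *\<^sub>R en n) = norm (Dfn n x v) * (L n * (2 * norm (en n)))"
        using L[of n] by simp
      also have "\<dots> \<le> norm (Dfn n x v) * (L n * (2 * (1 + slope_bound)))"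
        using en(1)[of n] L[of n] by (intro mult_left_mono) auto
      finally have "\<bar>wedge v e\<bar> \<le> norm (Dfn n x v) * (L n * (2 * (1 + slope_bound)))"
        using le by linarith
      then have "ln \<bar>wedge v e\<bar> \<le> ln (norm (Dfn n x v) * (L n * (2 * (1 + slope_bound))))"
        using False L[of n] n0 sb by (subst ln_le_cancel_iff) auto
      also have "\<dots> = ln (norm (Dfn n x v)) + (ln (L n) + ln (2 * (1 + slope_bound)))"
        using L[of n] n0 sb by (simp add: ln_mult)
      finally show ?thesis by linarith
    qed
    then show ?thesis by blast
  qed
  then show thesis using that unfolding L_def by blast
qed

text \<open>By the previous lemma the averages of \<open>ln lmin\<close> have a nonnegative lower limit almost everywhere, and their
  integral is constant.\<close>

lemma \<chi>min_nonneg: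
  assumes zero: "AE x in \<mu>. \<exists>v. v \<noteq> 0 \<and> (\<lambda>n. ln (norm (Dfn n x v)) / real n) \<longlonglongrightarrow> 0"
  shows "\<chi>min \<ge> 0"
proof -
  note B = ln_bound
  let ?u = "onM (\<lambda>x. ln (lmin x))"
  have ub: "\<bar>?u x\<bar> \<le> ln_bound" for x using B by simp
  define h where "h = (\<lambda>n x. min 0 ((\<Sum>i<n. ?u ((f ^^ i) x)) / real n))"
  have m [measurable]: "(\<lambda>x. ?u ((f ^^ i) x)) \<in> borel_measurable borel" for i
    using measurable_compose[OF measurable_fn measurable_lmin] .
  have hm [measurable]: "h n \<in> borel_measurable borel" for n unfolding h_def by measurable
  have sb: "\<bar>(\<Sum>i<n. ?u ((f ^^ i) x)) / real n\<bar> \<le> ln_bound" for n x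
  proof (cases "n = 0")
    case False
    have "\<bar>\<Sum>i<n. ?u ((f ^^ i) x)\<bar> \<le> (\<Sum>i<n. \<bar>?u ((f ^^ i) x)\<bar>)" by (rule sum_abs)
    also have "\<dots> \<le> (\<Sum>i<n. ln_bound)" by (intro sum_mono ub)
    finally show ?thesis using False by (simp add: divide_simps mult.commute)
  qed (use B(1) in simp)
  have hb: "\<bar>h n x\<bar> \<le> ln_bound" for n x
  proof -
    have "\<bar>(\<Sum>i<n. ?u ((f ^^ i) x)) / real n\<bar> \<le> ln_bound" by (rule sb)
    then show ?thesis using B(1) unfolding h_def by linarith
  qed
  have inti: "integrable \<mu> (\<lambda>x. ?u ((f ^^ i) x))" for i
    by (rule integrable_fn[OF measurable_lmin ub])
  have bound: "(\<integral>x. h n x \<partial>\<mu>) \<le> \<chi>min" if n: "n > 0" for n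
  proof -
    have "(\<integral>x. h n x \<partial>\<mu>) \<le> (\<integral>x. (\<Sum>i<n. ?u ((f ^^ i) x)) / real n \<partial>\<mu>)"
    proof (rule integral_mono)
      show "integrable \<mu> (h n)" by (rule integrable_bounded_on_M[OF hm hb])
      show "integrable \<mu> (\<lambda>x. (\<Sum>i<n. ?u ((f ^^ i) x)) / real n)"
        by (intro Bochner_Integration.integrable_divide Bochner_Integration.integrable_sum inti)
    qed (simp add: h_def)
    also have "\<dots> = (\<integral>x. (\<Sum>i<n. ?u ((f ^^ i) x)) \<partial>\<mu>) / real n"
      by (rule integral_divide_zero)
    also have "(\<integral>x. (\<Sum>i<n. ?u ((f ^^ i) x)) \<partial>\<mu>) = (\<Sum>i<n. \<integral>x. ?u ((f ^^ i) x) \<partial>\<mu>)"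
      by (rule Bochner_Integration.integral_sum[OF inti])
    also have "(\<Sum>i<n. \<integral>x. ?u ((f ^^ i) x) \<partial>\<mu>) / real n = \<chi>min" using n integral_fn[OF measurable_lmin] by (simp add: \<chi>min_def)
    finally show ?thesis .
  qed
  have "(\<lambda>n. \<integral>x. h n x \<partial>\<mu>) \<longlonglongrightarrow> (\<integral>x. 0 \<partial>\<mu>)"
  proof (rule integral_dominated_convergence[where w="\<lambda>_. ln_bound"])
    show "AE x in \<mu>. (\<lambda>n. h n x) \<longlonglongrightarrow> 0"
      using zero AE_M
    proof eventually_elim
      case (elim x)
      then obtain v where v: "v \<noteq> 0" "(\<lambda>n. ln (norm (Dfn n x v)) / real n) \<longlonglongrightarrow> 0" by blast
      obtain K where K: "\<And>n. - ln (\<Prod>i<n. lmin ((f ^^ i) x)) \<le> \<bar>ln (norm (Dfn n x v))\<bar> + K"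
        using lmin_product_lower[OF elim(2) v(1)] by blast
      have "(\<lambda>n. \<bar>ln (norm (Dfn n x v)) / real n\<bar> + \<bar>K\<bar> / real n) \<longlonglongrightarrow> \<bar>0\<bar> + 0"
        by (intro tendsto_intros v lim_const_over_n)
      moreover have "\<bar>h n x\<bar> \<le> \<bar>ln (norm (Dfn n x v)) / real n\<bar> + \<bar>K\<bar> / real n" for n
      proof -
        have "(\<Sum>i<n. ?u ((f ^^ i) x)) = ln (\<Prod>i<n. lmin ((f ^^ i) x))"
          using elim(2) by (simp add: ln_prod_lmin)
        then have "- (\<bar>ln (norm (Dfn n x v))\<bar> + \<bar>K\<bar>) \<le> (\<Sum>i<n. ?u ((f ^^ i) x))"
          using K[of n] by linarith
        then have "- (\<bar>ln (norm (Dfn n x v))\<bar> + \<bar>K\<bar>) / real n \<le> (\<Sum>i<n. ?u ((f ^^ i) x)) / real n"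
          by (intro divide_right_mono) auto
        moreover have "- (\<bar>ln (norm (Dfn n x v))\<bar> + \<bar>K\<bar>) / real n
            = - (\<bar>ln (norm (Dfn n x v)) / real n\<bar> + \<bar>K\<bar> / real n)"
          by (simp add: add_divide_distrib diff_divide_distrib)
        moreover have "0 \<le> \<bar>ln (norm (Dfn n x v)) / real n\<bar> + \<bar>K\<bar> / real n" by simp
        ultimately show ?thesis unfolding h_def by linarith
      qed
      ultimately show ?case
        by (intro tendsto_rabs_zero_cancel[of "\<lambda>n. h n x"])
          (rule tendsto_sandwich[OF _ _ tendsto_const], auto intro: always_eventually)
    qed
  qed (use hb in auto)
  then have lim: "(\<lambda>n. \<integral>x. h n x \<partial>\<mu>) \<longlonglongrightarrow> 0" by simp
  show ?thesis
    by (rule tendsto_upperbound[OF lim eventually_mono[OF eventually_gt_at_top[of 0] bound]]) simp_all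
qed

text \<open>If the extremal slopes agree almost everywhere, then the two mean stretchings agree, and both vanish by their
  signs. The uniform upper bound for one field and the uniform lower bound for the other then enclose the
  growth at every point of \<open>M\<close>.\<close>

lemma zero_exponent_everywhere:
  assumes gap: "AE x in \<mu>. gap x = 0" and x: "x \<in> M"
  shows "(\<lambda>n. ln (norm (Dfn n x (1, \<sigma> * smax x))) / real n) \<longlonglongrightarrow> 0"
proof -
  have "\<chi>min = \<chi>max"
    unfolding \<chi>min_def \<chi>max_def
  proof (rule integral_cong_AE)
    show "AE x in \<mu>. onM (\<lambda>x. ln (lmin x)) x = onM (\<lambda>x. ln (lmax x)) x"
      using gap by eventually_elim (simp add: gap_def lmin_def lmax_def)
  qed measurable
  then have \<chi>: "\<chi>max = 0" "\<chi>min = 0" using \<chi>max_nonneg \<chi>min_nonpos by auto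
  define Y where "Y = (\<lambda>n. \<Sum>i<n. ln (lmax ((f ^^ i) x)))"
  have Y: "ln (norm (Dfn n x (1, \<sigma> * smax x))) = Y n + ln (norm (1 :: real, \<sigma> * smax ((f ^^ n) x)))" for n
  proof -
    define p where "p = (\<Prod>i<n. lmax ((f ^^ i) x))"
    have p: "p > 0" "ln p = Y n"
      unfolding p_def Y_def by (rule prod_lmax_pos[OF x], rule ln_prod_lmax[OF x])
    have "norm (Dfn n x (1, \<sigma> * smax x)) = p * norm (1 :: real, \<sigma> * smax ((f ^^ n) x))"
      unfolding Dfn_smax[OF x] norm_scaleR p_def[symmetric] using p(1) by simp
    moreover have "norm (1 :: real, \<sigma> * smax ((f ^^ n) x)) > 0" by (simp add: zero_prod_def)
    ultimately show ?thesis using p by (simp add: ln_mult)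
  qed
  have e: "0 \<le> ln (norm (1 :: real, \<sigma> * smax ((f ^^ n) x)))"
    "ln (norm (1 :: real, \<sigma> * smax ((f ^^ n) x))) \<le> ln (1 + slope_bound)" for n
  proof -
    have "1 \<le> norm (1 :: real, \<sigma> * smax ((f ^^ n) x))"
      using abs_fst_le_norm[of "(1, \<sigma> * smax ((f ^^ n) x))"] by simp
    moreover have "norm (1 :: real, \<sigma> * smax ((f ^^ n) x)) \<le> 1 + slope_bound"
      using norm_slope_le[OF smax_in] x by simp
    ultimately show "0 \<le> ln (norm (1 :: real, \<sigma> * smax ((f ^^ n) x)))"
      "ln (norm (1 :: real, \<sigma> * smax ((f ^^ n) x))) \<le> ln (1 + slope_bound)"
      by (simp, subst ln_le_cancel_iff) linarith+
  qed
  have "(\<lambda>n. Y n / real n) \<longlonglongrightarrow> 0"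
  proof (rule LIMSEQ_I)
    fix r :: real assume r: "r > 0"
    obtain N1 where N1: "\<And>n. n \<ge> N1 \<Longrightarrow> Y n \<le> real n * (\<chi>max + r/2)"
      using uniform_upper_lmax[of "r/2"] r x by (auto simp: Y_def)
    obtain N2 where N2: "\<And>n. n \<ge> N2 \<Longrightarrow> real n * (\<chi>min - r/2) \<le> (\<Sum>i<n. ln (lmin ((f ^^ i) x)))"
      using uniform_lower_lmin[of "r/2"] r x by auto
    have minY: "(\<Sum>i<n. ln (lmin ((f ^^ i) x))) \<le> Y n" for n
      unfolding Y_def
    proof (rule sum_mono)
      fix i
      have y: "(f ^^ i) x \<in> M" using x by simp
      show "ln (lmin ((f ^^ i) x)) \<le> ln (lmax ((f ^^ i) x))"
        using lmin_le_lmax[OF y] lmin_pos[OF y] by simp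
    qed
    have "norm (Y n / real n - 0) < r" if n: "n \<ge> Suc (max N1 N2)" for n
    proof -
      have nn: "n \<ge> N1" "n \<ge> N2" using n by auto
      have "real n * (\<chi>max + r/2) = real n * (r/2)" "real n * (\<chi>min - r/2) = - (real n * (r/2))"
        by (simp_all add: \<chi>)
      then have "Y n \<le> real n * (r/2)" "- (real n * (r/2)) \<le> Y n"
        using N1[OF nn(1)] N2[OF nn(2)] minY[of n] by linarith+
      then have "\<bar>Y n\<bar> \<le> real n * (r/2)" by (simp add: abs_le_iff)
      moreover have "real n * (r/2) < real n * r" using n r by simp
      ultimately have "\<bar>Y n\<bar> < real n * r" by linarith
      then show ?thesis using n by (simp add: field_simps)
    qed
    then show "\<exists>no. \<forall>n\<ge>no. norm (Y n / real n - 0) < r" by blast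
  qed
  moreover have "(\<lambda>n. ln (norm (1 :: real, \<sigma> * smax ((f ^^ n) x))) / real n) \<longlonglongrightarrow> 0"
    by (rule tendsto_sandwich[OF _ _ tendsto_const lim_const_over_n[of "ln (1 + slope_bound)"]])
      (use e in \<open>auto intro!: always_eventually divide_right_mono\<close>)
  ultimately have "(\<lambda>n. Y n / real n + ln (norm (1 :: real, \<sigma> * smax ((f ^^ n) x))) / real n) \<longlonglongrightarrow> 0 + 0"
    by (rule tendsto_add)
  then show ?thesis by (simp add: Y add_divide_distrib)
qed

theorem nowhere_C1_regular_iff:
  "(AE x in \<mu>. \<not> C1_regular_at (measure_support \<mu>) x) \<longleftrightarrow> (\<forall>\<kappa> \<in> lyapunov_exponents f \<mu>. \<kappa> \<noteq> 0)"
proof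
  assume irr: "AE x in \<mu>. \<not> C1_regular_at (measure_support \<mu>) x"
  have gap: "AE x in \<mu>. gap x > 0"
    using irr AE_M
  proof eventually_elim
    case (elim x)
    then show ?case using C1_regular_iff_gap[of x] gap_nonneg[of x] by (simp add: measure_support_eq less_le)
  qed
  show "\<forall>\<kappa> \<in> lyapunov_exponents f \<mu>. \<kappa> \<noteq> 0"
  proof (intro ballI notI)
    fix \<kappa> :: real assume "\<kappa> \<in> lyapunov_exponents f \<mu>" "\<kappa> = 0"
    then have "\<chi>min \<ge> 0" by (intro \<chi>min_nonneg) (simp add: lyapunov_exponents_def)
    then show False using \<chi>min_less_\<chi>max[OF gap] \<chi>_sum_nonpos[OF gap] by linarith
  qed
next
  assume nz: "\<forall>\<kappa> \<in> lyapunov_exponents f \<mu>. \<kappa> \<noteq> 0"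
  have "\<not> (AE x in \<mu>. gap x = 0)"
  proof
    assume gap: "AE x in \<mu>. gap x = 0"
    have "AE x in \<mu>. \<exists>v. v \<noteq> 0 \<and> (\<lambda>n. ln (norm (Dfn n x v)) / real n) \<longlonglongrightarrow> 0"
      using AE_M
    proof eventually_elim
      case (elim x)
      then show ?case using zero_exponent_everywhere[OF gap elim]
        by (intro exI[of _ "(1, \<sigma> * smax x)"]) (simp add: zero_prod_def)
    qed
    then have "0 \<in> lyapunov_exponents f \<mu>" by (simp add: lyapunov_exponents_def)
    then show False using nz by blast
  qed
  from gap_dichotomy[OF this] AE_M
  show "AE x in \<mu>. \<not> C1_regular_at (measure_support \<mu>) x"
  proof eventually_elim
    case (elim x)
    then show ?case using C1_regular_iff_gap[of x] by (simp add: measure_support_eq)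
  qed
qed

end

section \<open>Lifts of twist maps\<close>

lemma C1_lift_translate:
  assumes "C1_lift F F' f" shows "C1_lift (\<lambda>z. F z + (of_int k, 0)) F' f"
  unfolding C1_lift_def is_lift_def
proof (intro conjI allI)
  show "continuous_on UNIV (\<lambda>z. F z + (of_int k, 0))"
    by (intro continuous_intros C1_liftD(1)[OF assms])
  show "((\<lambda>z. F z + (of_int k, 0)) has_derivative blinfun_apply (F' z)) (at z)" for z
    using has_derivative_add[OF C1_liftD(3)[OF assms] has_derivative_const] by simp
qed (simp_all add: C1_liftD[OF assms])

text \<open>A lift of the inverse is inverse to a given lift up to a deck transformation, by which it is corrected.\<close>

lemma C1_diffeomorphism_lifts:
  assumes "C1_diffeomorphism f"
  obtains F F' G G' where "C1_lift F F' f" "C1_lift G G' (inv f)" "\<forall>z. G (F z) = z" "\<forall>z. F (G z) = z"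
proof -
  have bij: "bij f" using assms by (simp add: C1_diffeomorphism_def)
  obtain F F' G0 G' where F: "C1_lift F F' f" and G0: "C1_lift G0 G' (inv f)"
    using assms by (auto simp: C1_diffeomorphism_def C1_map_iff)
  have comp: "continuous_on UNIV (\<lambda>z. A (B z))"
    if "continuous_on UNIV A" "continuous_on UNIV B" for A B :: "real \<times> real \<Rightarrow> real \<times> real"
    using continuous_on_compose2[OF that] by simp
  have "to_annulus (G0 (F z)) = to_annulus z" for z
    using bij by (simp add: C1_liftD(2)[OF F] C1_liftD(2)[OF G0] bij_is_inj)
  then obtain k :: int where k: "\<forall>z. G0 (F z) = z + (of_int k, 0)"
    using continuous_same_fibre_const[of "\<lambda>z. G0 (F z)" "\<lambda>z. z"]
      comp[OF C1_liftD(1)[OF G0] C1_liftD(1)[OF F]] continuous_on_id by metis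
  define G where "G = (\<lambda>z. G0 z + (of_int (- k), 0))"
  have G: "C1_lift G G' (inv f)" unfolding G_def by (rule C1_lift_translate[OF G0])
  have GF: "G (F z) = z" for z using k[rule_format, of z] by (simp add: G_def prod_eq_iff)
  have "to_annulus (F (G z)) = to_annulus z" for z
    using bij by (simp add: C1_liftD(2)[OF F] C1_liftD(2)[OF G] bij_is_surj surj_f_inv_f)
  then obtain m :: int where m: "\<forall>z. F (G z) = z + (of_int m, 0)"
    using continuous_same_fibre_const[of "\<lambda>z. F (G z)" "\<lambda>z. z"]
      comp[OF C1_liftD(1)[OF F] C1_liftD(1)[OF G]] continuous_on_id by metis
  have FG: "F (G z) = z" for z
  proof -
    have "F (G (F (G z))) = F (G z)" by (simp add: GF)
    then have "m = 0" using m[rule_format, of "F (G z)"] by (simp add: prod_eq_iff)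
    then show ?thesis using m[rule_format, of z] by (simp add: zero_prod_def[symmetric])
  qed
  show thesis using that[OF F G] GF FG by blast
qed

lemma lift_shift_multiple:
  fixes F :: "real \<times> real \<Rightarrow> real \<times> real"
  assumes "\<And>z. F (z + (1, 0)) = F z + (of_int m, 0)"
  shows "F (z + (of_int k, 0)) = F z + (of_int (m * k), 0)"
proof (induction k rule: int_induct[of _ 0])
  case (step1 k)
  have "F (z + (of_int (k + 1), 0)) = F (z + (of_int k, 0) + (1, 0))" by (simp add: add.assoc)
  also have "\<dots> = F (z + (of_int k, 0)) + (of_int m, 0)" by (rule assms)
  finally show ?case using step1 by (simp add: prod_eq_iff algebra_simps)
next
  case (step2 k)
  have "F (z + (of_int k, 0)) = F (z + (of_int (k - 1), 0) + (1, 0))" by (simp add: add.assoc)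
  also have "\<dots> = F (z + (of_int (k - 1), 0)) + (of_int m, 0)" by (rule assms)
  finally show ?case using step2 by (simp add: prod_eq_iff algebra_simps)
qed (simp add: zero_prod_def[symmetric])

text \<open>The degrees of a map and of its inverse are integers with product 1. The degree \<open>-1\<close> would reverse the order of a
  point and its translate.\<close>

lemma lift_commutes_with_shift:
  assumes F: "C1_lift F F' f" and G: "C1_lift G G' (inv f)" and GF: "\<forall>z. G (F z) = z"
    and order: "\<And>z w. z \<in> Z \<Longrightarrow> w \<in> Z \<Longrightarrow> fst z < fst w \<Longrightarrow> fst (F z) < fst (F w)"
    and Z: "z0 \<in> Z" "z0 + (1, 0) \<in> Z"
  shows "F (z + (of_int k, 0)) = F z + (of_int k, 0)"
proof -
  have deg: "\<exists>m::int. \<forall>z. A (z + (1, 0)) = A z + (of_int m, 0)" if A: "C1_lift A A' p" for A A' p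
    using is_lift_unique[OF is_lift_shift[of A p 1]] A unfolding C1_lift_def by (metis of_int_1)
  obtain m :: int where m: "\<And>z. F (z + (1, 0)) = F z + (of_int m, 0)" using deg[OF F] by blast
  obtain l :: int where l: "\<And>z. G (z + (1, 0)) = G z + (of_int l, 0)" using deg[OF G] by blast
  have "G (F (z0 + (1, 0))) = G (F z0) + (of_int (l * m), 0)"
    unfolding m by (rule lift_shift_multiple[where F = G, OF l])
  then have "l * m = 1"
    using GF by (simp add: prod_eq_iff flip: of_int_mult)
  moreover have "m > 0" using order[OF Z] m[of z0] by simp
  ultimately have "m = 1" using pos_zmult_eq_1_iff by (metis mult.commute)
  then show ?thesis using lift_shift_multiple[where F = F, OF m] by simp
qed

text \<open>The inverse is differentiable too, so the chain rule applies to the identity.\<close>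

lemma C1_diffeo_real_derivative_nonzero:
  assumes q: "C1_diffeo_real q" and D: "(q has_real_derivative D) (at r)"
  shows "D \<noteq> 0"
proof -
  have "inv q differentiable at (q r)"
    using q by (simp add: C1_diffeo_real_def C1_differentiable_on_eq)
  then obtain E where E: "(inv q has_real_derivative E) (at (q r))"
    using real_differentiable_def by blast
  have "((\<lambda>x. inv q (q x)) has_real_derivative E * D) (at r)"
    using DERIV_chain2[OF E D] .
  moreover have "(\<lambda>x. inv q (q x)) = (\<lambda>x. x)"
    using q by (simp add: C1_diffeo_real_def bij_is_inj)
  ultimately have "E * D = 1" using DERIV_unique[OF _ DERIV_ident] by metis
  then show ?thesis by auto
qed

lemma C1_diffeo_real_derivative_pos:
  assumes "C1_diffeo_real q" "(q has_real_derivative D) (at r)" "strict_mono q"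
  shows "D > 0"
proof (rule ccontr)
  assume "\<not> D > 0"
  then have "D < 0" using C1_diffeo_real_derivative_nonzero[OF assms(1,2)] by simp
  then obtain e where e: "e > 0" "\<And>h. h > 0 \<Longrightarrow> h < e \<Longrightarrow> q (r + h) < q r"
    using DERIV_neg_dec_right[OF assms(2)] by blast
  have "q (r + e/2) < q r" using e by simp
  moreover have "q r < q (r + e/2)" using assms(3) e(1) by (simp add: strict_mono_def)
  ultimately show False by simp
qed

lemma C1_diffeo_real_derivative_neg:
  assumes "C1_diffeo_real q" "(q has_real_derivative D) (at r)" "strict_antimono_on UNIV q"
  shows "D < 0"
proof (rule ccontr)
  assume "\<not> D < 0"
  then have "D > 0" using C1_diffeo_real_derivative_nonzero[OF assms(1,2)] by simp
  then obtain e where e: "e > 0" "\<And>h. h > 0 \<Longrightarrow> h < e \<Longrightarrow> q r < q (r + h)"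
    using DERIV_pos_inc_right[OF assms(2)] by blast
  have "q r < q (r + e/2)" using e by simp
  moreover have "q (r + e/2) < q r" using assms(3) e(1) by (simp add: monotone_on_def)
  ultimately show False by simp
qed

lemma fibre_derivative:
  assumes "C1_lift F F' f"
  shows "((\<lambda>r. fst (F (t, r))) has_real_derivative fst (tangent_map f (to_annulus (t, r)) (0, 1))) (at r)"
proof -
  have "((\<lambda>r. F (t, r)) has_derivative (\<lambda>h. F' (t, r) (0, h))) (at r)"
    by (rule has_derivative_compose[OF _ C1_liftD(3)[OF assms]]) (auto intro!: derivative_eq_intros)
  then have "((\<lambda>r. fst (F (t, r))) has_derivative (\<lambda>h. fst (F' (t, r) (0, h)))) (at r)"
    by (rule has_derivative_fst)
  moreover have "(\<lambda>h. fst (F' (t, r) (0, h))) = (*) (fst (F' (t, r) (0, 1)))"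
  proof
    fix h :: real
    show "fst (F' (t, r) (0, h)) = fst (F' (t, r) (0, 1)) * h"
      using blinfun.scaleR_right[of "F' (t, r)" h "(0, 1)"] by simp
  qed
  ultimately show ?thesis
    by (simp only: has_field_derivative_def tangent_map_eq[OF assms])
qed

theorem proposition2:
  fixes f :: "annulus \<Rightarrow> annulus" and \<mu> :: "annulus measure"
  assumes "twist_map f" and "exact_symplectic f" and "irrational_mather_measure f \<mu>"
  shows "(AE x in \<mu>. \<not> C1_regular_at (measure_support \<mu>) x) \<longleftrightarrow>
         (\<forall>\<kappa> \<in> lyapunov_exponents f \<mu>. \<kappa> \<noteq> 0)"
proof -
  have diffeo: "C1_diffeomorphism f"
    using assms(1) unfolding twist_map_def negative_twist_map_def positive_twist_map_def C1_diffeomorphism_def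
    by (elim disjE exE conjE) (simp_all add: inv_inv_eq bij_imp_bij_inv)
  have C1f: "C1_map f" and bij: "bij f" using diffeo by (simp_all add: C1_diffeomorphism_def)
  obtain F F' G G' where F: "C1_lift F F' f" and G: "C1_lift G G' (inv f)"
    and GF: "\<forall>z. G (F z) = z" and FG: "\<forall>z. F (G z) = z"
    using C1_diffeomorphism_lifts[OF diffeo] by blast
  have lift: "is_lift F f" "is_lift G (inv f)" using F G by (simp_all add: C1_lift_def)
  obtain M where M: "aubry_mather_set f M" "irrational_set f M" "invariant_prob_on f M \<mu>"
    using assms(3) unfolding irrational_mather_measure_def by blast
  have ord: "M \<noteq> {}" "compact M" "f ` M = M"
    "\<And>z w. to_annulus z \<in> M \<Longrightarrow> to_annulus w \<in> M \<Longrightarrow> fst z < fst w \<longleftrightarrow> fst (F z) < fst (F w)"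
    using M(1) lift(1) unfolding aubry_mather_set_def f_ordered_def by blast+
  have minimal: "N = M" if N: "N \<subseteq> M" "closed N" "N \<noteq> {}" "f ` N = N" for N
  proof -
    have "compact N" using compact_Int_closed[OF ord(2) N(2)] N(1) by (simp add: Int_absorb1)
    then have "f_ordered f N"
      using M(1) N(1,3,4) unfolding aubry_mather_set_def f_ordered_def by blast
    then show ?thesis using M(1) N(1) unfolding aubry_mather_set_def by blast
  qed
  obtain x0 where "x0 \<in> M" using ord(1) by blast
  then obtain z0 where z0: "to_annulus z0 \<in> M" using to_annulus_surj by metis
  have shift: "F (z + (of_int k, 0)) = F z + (of_int k, 0)" for z k
  proof (rule lift_commutes_with_shift[OF F G GF, of "to_annulus -` M"])
    show "z0 \<in> to_annulus -` M" "z0 + (1, 0) \<in> to_annulus -` M"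
      using z0 to_annulus_shift[of z0 1] by simp_all
  qed (use ord(4) in simp)
  obtain \<sigma> :: real where \<sigma>: "\<bar>\<sigma>\<bar> = 1" "\<And>x. \<sigma> * fst (tangent_map f x (0, 1)) > 0"
    and inj: "\<And>\<theta>. inj (\<lambda>r. fst (F (\<theta>, r)))"
  proof (cases "positive_twist_map f")
    case True
    then have q: "\<And>\<theta>. C1_diffeo_real (\<lambda>r. fst (F (\<theta>, r)))" "\<And>\<theta>. strict_mono (\<lambda>r. fst (F (\<theta>, r)))"
      using lift(1) unfolding positive_twist_map_def by blast+
    have "1 * fst (tangent_map f x (0, 1)) > 0" for x
    proof -
      obtain t r where x: "x = to_annulus (t, r)" using to_annulus_surj by (metis surj_pair)
      show ?thesis unfolding x using C1_diffeo_real_derivative_pos[OF q(1) fibre_derivative[OF F] q(2)] by simp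
    qed
    moreover have "\<And>\<theta>. inj (\<lambda>r. fst (F (\<theta>, r)))" using q(2) strict_mono_imp_inj_on by blast
    ultimately show thesis using that[of 1] by simp
  next
    case False
    then obtain p where p: "positive_twist_map p" "f = inv p"
      using assms(1) unfolding twist_map_def negative_twist_map_def by blast
    then have "inv f = p" by (simp add: positive_twist_map_def C1_diffeomorphism_def inv_inv_eq)
    then have "is_lift G p" using lift(2) by simp
    moreover have "inv G = F" using GF FG by (intro inv_equality) blast+
    ultimately have q: "\<And>\<theta>. C1_diffeo_real (\<lambda>r. fst (F (\<theta>, r)))"
      "\<And>\<theta>. strict_antimono_on UNIV (\<lambda>r. fst (F (\<theta>, r)))"
      using p(1) unfolding positive_twist_map_def by metis+
    have "(-1) * fst (tangent_map f x (0, 1)) > 0" for x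
    proof -
      obtain t r where x: "x = to_annulus (t, r)" using to_annulus_surj by (metis surj_pair)
      show ?thesis unfolding x using C1_diffeo_real_derivative_neg[OF q(1) fibre_derivative[OF F] q(2)] by simp
    qed
    moreover have "\<And>\<theta>. inj (\<lambda>r. fst (F (\<theta>, r)))"
      using q(1) by (simp add: C1_diffeo_real_def bij_is_inj)
    ultimately show thesis using that[of "-1"] by simp
  qed
  interpret mather_measure f "inv f" F G F' G' M \<sigma> \<mu>
  proof unfold_locales
    show "C1_lift F F' f" "C1_lift G G' (inv f)" by (rule F, rule G)
    show "G (F z) = z" "F (G z) = z" for z by (rule GF[rule_format], rule FG[rule_format])
    show "F (z + (of_int k, 0)) = F z + (of_int k, 0)" for z k by (rule shift)
    show "fst (tangent_map f x (1, 0)) * snd (tangent_map f x (0, 1))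
       - fst (tangent_map f x (0, 1)) * snd (tangent_map f x (1, 0)) = 1" for x
      by (rule exact_symplectic_det[OF C1f assms(2)])
    show "z = w" if "fst z = fst w" "fst (F z) = fst (F w)" for z w
    proof -
      have "fst (F (fst z, snd z)) = fst (F (fst z, snd w))" using that by (metis prod.collapse)
      then have "snd z = snd w" using injD[OF inj[of "fst z"], of "snd z" "snd w"] by simp
      then show "z = w" using that(1) by (simp add: prod_eq_iff)
    qed
    show "rotation_number f M F \<notin> \<rat>" using M(2) lift(1) by (simp add: irrational_set_def)
    show "\<bar>\<sigma>\<bar> = 1" "\<sigma> * fst (tangent_map f x (0, 1)) > 0" for x by (rule \<sigma>)+
    show "compact M" "M \<noteq> {}" "f ` M = M" by (rule ord)+
    show "fst z < fst w \<longleftrightarrow> fst (F z) < fst (F w)" if "to_annulus z \<in> M" "to_annulus w \<in> M" for z w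
      by (rule ord(4)[OF that])
    show "N = M" if "N \<subseteq> M" "closed N" "N \<noteq> {}" "f ` N = N" for N by (rule minimal[OF that])
    show "invariant_prob_on f M \<mu>" by (rule M(3))
  qed
  show ?thesis by (rule nowhere_C1_regular_iff)
qed

end
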